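(* Let $(\mathcal{G},X,\mu)$ be an aperiodic graphing, and let $(G,o)$ be the unimodular random graph with law $\nu_{\mathcal G}$, i.e. the rooted connected component $(\mathcal{G}_x,x)$ of a $\mu$-random vertex $x\in X$. Then $\rho(G,o)\le\rho(\mathcal{G})$ (almost surely).
   Context: A graphing is a triple $(\mathcal{G},X,\mu)$, where $X$ is a standard Borel space, $\mathcal G\subset X\times X$ is a symmetric Borel set (a Borel graph) with all degrees bounded by some $D\in\mathbb{N}$, and $\mu$ is a Borel probability measure on $X$ satisfying the Mass Transport Principle: for every Borel $f:\mathcal{G}\to\mathbb{R}_{\ge0}$, $\int_X\sum_{y\sim x} f(y,x)\,d\mu(x)=\int_X\sum_{y\sim x} f(x,y)\,d\mu(x)$, the sums being over $\mathcal G$-neighbours $y$ of $x$ (equivalently, partial Borel bijections along edges preserve $\mu$). $\mathcal{G}_x$ denotes the connected component of $x$. The graphing is aperiodic if $\mathcal{G}_x$ is infinite for $\mu$-almost every $x$. The degree-biased measure is $\int f\,d\mu^*=\int f\deg\,d\mu/\int\deg\,d\mu$. The Markov operator of $\mathcal{G}$ is the self-adjoint operator $(\mathcal{M}f)(x)=\frac{1}{\deg(x)}\sum_{(x,y)\in\mathcal{G}}f(y)$ on $L^2(X,\mu^* )$. The (global) spectral radius $\rho(\mathcal{G})$ is the spectral radius of the restriction of $\mathcal{M}$ to $L^2_0(X,\mu^* )$, the orthogonal complement of the constant functions. For a connected bounded degree graph $G$, $M_G$ is the self-adjoint operator $(M_Gf)(u)=\frac{1}{\deg(u)}\sum_{(u,v)\in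 E(G)}f(v)$ on $\ell^2(G,\deg)$, the space of functions on $V(G)$ with inner product $\langle f,g\rangle=\sum_u f(u)\overline{g(u)}\deg(u)$. The (local) spectral radius is $\rho(G,o)=\sup\{|\lambda|:\lambda\in\sigma(M_G)\}$, which does not depend on the root $o$. *)

theory Defs
  imports "HOL-Probability.Probability"
begin

text \<open>
  Elements of \<open>L\<^sup>2(N)\<close> are represented by square-integrable functions; two of them represent the
  same element iff they agree \<open>N\<close>-almost everywhere, so identities between elements are
  stated with \<open>AE\<close>. An operator is a function on representatives. In the definitions below, \<open>H\<close> is a
  closed subspace of \<open>L\<^sup>2(N)\<close>, given as the set of all representatives of its elements.
\<close>

definition L2 :: "'a measure \<Rightarrow> ('a \<Rightarrow> complex) set" where
  "L2 N = {f \<in> borel_measurable N. integrable N (\<lambda>x. (cmod (f x))\<^sup>2)}"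

definition L2_inner :: "'a measure \<Rightarrow> ('a \<Rightarrow> complex) \<Rightarrow> ('a \<Rightarrow> complex) \<Rightarrow> complex" where
  "L2_inner N f g = (\<integral>x. f x * cnj (g x) \<partial>N)"

definition L2_norm :: "'a measure \<Rightarrow> ('a \<Rightarrow> complex) \<Rightarrow> real" where
  "L2_norm N f = sqrt (\<integral>x. (cmod (f x))\<^sup>2 \<partial>N)"

definition L2_0 :: "'a measure \<Rightarrow> ('a \<Rightarrow> complex) set" where
  "L2_0 N = {f \<in> L2 N. \<forall>c. L2_inner N f (\<lambda>_. c) = 0}"

definition bounded_operator ::
    "'a measure \<Rightarrow> ('a \<Rightarrow> complex) set \<Rightarrow> (('a \<Rightarrow> complex) \<Rightarrow> ('a \<Rightarrow> complex)) \<Rightarrow> bool" where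
  "bounded_operator N H S \<longleftrightarrow>
     (\<forall>f\<in>H. S f \<in> H) \<and>
     (\<forall>f\<in>H. \<forall>g\<in>H. (AE x in N. f x = g x) \<longrightarrow> (AE x in N. S f x = S g x)) \<and>
     (\<forall>f\<in>H. \<forall>g\<in>H. AE x in N. S (\<lambda>y. f y + g y) x = S f x + S g x) \<and>
     (\<forall>c. \<forall>f\<in>H. AE x in N. S (\<lambda>y. c * f y) x = c * S f x) \<and>
     (\<exists>K. \<forall>f\<in>H. L2_norm N (S f) \<le> K * L2_norm N f)"

text \<open>The complex numbers \<open>z\<close> such that \<open>z I - T\<close> has no bounded two-sided inverse on \<open>H\<close>.\<close>

definition op_spectrum ::
    "'a measure \<Rightarrow> ('a \<Rightarrow> complex) set \<Rightarrow> (('a \<Rightarrow> complex) \<Rightarrow> ('a \<Rightarrow> complex)) \<Rightarrow> complex set" where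
  "op_spectrum N H T =
     {z. \<not> (\<exists>S. bounded_operator N H S \<and>
               (\<forall>f\<in>H. (AE x in N. S (\<lambda>y. z * f y - T f y) x = f x) \<and>
                       (AE x in N. z * S f x - T (S f) x = f x)))}"

text \<open>The supremum is taken in \<open>real\<close>; it is meaningful because the spectrum of a bounded operator
  on a nonzero Hilbert space is nonempty and bounded.\<close>

definition op_spectral_radius ::
    "'a measure \<Rightarrow> ('a \<Rightarrow> complex) set \<Rightarrow> (('a \<Rightarrow> complex) \<Rightarrow> ('a \<Rightarrow> complex)) \<Rightarrow> real" where
  "op_spectral_radius N H T = (SUP z\<in>op_spectrum N H T. cmod z)"

definition degree :: "('a \<times> 'a) set \<Rightarrow> 'a \<Rightarrow> nat" where
  "degree E x = card (E `` {x})"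

definition markov :: "('a \<times> 'a) set \<Rightarrow> ('a \<Rightarrow> complex) \<Rightarrow> 'a \<Rightarrow> complex" where
  "markov E f x = (1 / of_nat (degree E x)) * (\<Sum>y\<in>E `` {x}. f y)"

text \<open>A rooted graph \<open>(V, E, o)\<close>: vertex set, symmetric edge relation on it, and root.\<close>

type_synonym 'a rooted_graph = "'a set \<times> ('a \<times> 'a) set \<times> 'a"

definition rooted_component :: "('a \<times> 'a) set \<Rightarrow> 'a \<Rightarrow> 'a rooted_graph" where
  "rooted_component E x = (let V = E\<^sup>* `` {x} in (V, E \<inter> (V \<times> V), x))"

text \<open>
  \<open>\<ell>\<^sup>2(G, deg)\<close> is \<open>L\<^sup>2\<close> of the measure on \<open>V\<close> that gives each vertex mass \<open>deg\<close>, so that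
  \<open>L2_inner\<close> is the sum over \<open>V\<close> of \<open>f(u) cnj(g(u)) deg(u)\<close>.
\<close>

definition local_spectral_radius :: "'a rooted_graph \<Rightarrow> real" where
  "local_spectral_radius = (\<lambda>(V, E, r).
     let N = point_measure V (\<lambda>u. of_nat (degree E u)) in op_spectral_radius N (L2 N) (markov E))"

text \<open>A Polish topology on the underlying set whose open sets generate the \<open>\<sigma>\<close>-algebra; for
  completely metrizable spaces, second countability and separability coincide.\<close>

definition standard_borel :: "'a measure \<Rightarrow> bool" where
  "standard_borel M \<longleftrightarrow>
     (\<exists>T. completely_metrizable_space T \<and> second_countable T \<and> topspace T = space M \<and>
          sets M = sigma_sets (space M) {U. openin T U})"

text \<open>The vertex space \<open>X\<close> is \<open>space M\<close>, and \<open>M\<close> also carries its Borel sets and \<open>\<mu>\<close>.\<close>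

locale graphing = prob_space M for M :: "'a measure" +
  fixes G :: "('a \<times> 'a) set"
  assumes standard_borel_space: "standard_borel M"
    and borel_graph: "G \<in> sets (M \<Otimes>\<^sub>M M)"
    and symmetric: "sym G"
    and bounded_degree: "\<exists>D. \<forall>x\<in>space M. finite (G `` {x}) \<and> degree G x \<le> D"
    and mass_transport:
      "\<And>f :: 'a \<times> 'a \<Rightarrow> real.
         f \<in> borel_measurable (restrict_space (M \<Otimes>\<^sub>M M) G) \<Longrightarrow> (\<And>e. e \<in> G \<Longrightarrow> 0 \<le> f e) \<Longrightarrow>
         (\<integral>\<^sup>+x. (\<Sum>y\<in>G `` {x}. ennreal (f (y, x))) \<partial>M) = (\<integral>\<^sup>+x. (\<Sum>y\<in>G `` {x}. ennreal (f (x, y))) \<partial>M)"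

definition aperiodic :: "'a measure \<Rightarrow> ('a \<times> 'a) set \<Rightarrow> bool" where
  "aperiodic M G \<longleftrightarrow> (AE x in M. infinite (fst (rooted_component G x)))"

definition degree_biased :: "'a measure \<Rightarrow> ('a \<times> 'a) set \<Rightarrow> 'a measure" where
  "degree_biased M G =
     density M (\<lambda>x. ennreal (real (degree G x) / (\<integral>y. real (degree G y) \<partial>M)))"

definition global_spectral_radius :: "'a measure \<Rightarrow> ('a \<times> 'a) set \<Rightarrow> real" where
  "global_spectral_radius M G =
     op_spectral_radius (degree_biased M G) (L2_0 (degree_biased M G)) (markov G)"

end

theory Submission
  imports Defs "HOL-Library.Fun_Lexorder"
begin

text \<open>
  Write \<open>M\<close> for the Markov operator of the graphing, \<open>c\<close> for its norm on the mean-zero functions, and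
  \<open>p\<^sub>2\<^sub>n(x)\<close> for the probability that the random walk from \<open>x\<close> is back at \<open>x\<close> after \<open>2 n\<close> steps. On both
  sides the spectral radius is compared with the exponential growth rate of \<open>p\<^sub>2\<^sub>n(x)\<close>.

  On the global side, let \<open>A\<close> be a set of \<open>\<mu>\<^sup>*\<close>-measure \<open>a\<close>. The indicator \<open>1\<^sub>A\<close> differs from the constant \<open>a\<close> by
  a mean-zero function of squared norm at most \<open>a\<close>, so that \<open>\<langle>M\<^bsup>2n\<^esup> 1\<^sub>A, 1\<^sub>A\<rangle> \<le> c\<^bsup>2n\<^esup> a + a\<^sup>2\<close>. Mass transport makes
  all vertices of a component equally heavy, so an aperiodic graphing has no atoms, and the space can be
  partitioned into countably many sets of measure at most \<open>\<epsilon>\<close>. A walk that returns to its starting point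
  also returns to the piece where it started, so summing over the pieces gives \<open>\<integral> p\<^sub>2\<^sub>n d\<mu>\<^sup>* \<le> c\<^bsup>2n\<^esup> + \<epsilon>\<close>. Hence,
  for every \<open>c' > c\<close>, almost every \<open>x\<close> satisfies \<open>p\<^sub>2\<^sub>n(x) \<le> K\<^sub>x c'\<^bsup>2n\<^esup>\<close> for all \<open>n\<close> (\<open>return_probability_bound\<close>).

  On the local side, connectedness carries such a bound from the root to all finitely supported functions \<open>f\<close>
  of the component. The sequence \<open>\<parallel>M\<^sup>n f\<parallel>\<^sup>2 / c'\<^bsup>2n\<^esup>\<close> is then bounded, and it is convex because \<open>M\<close> is symmetric, so
  it does not increase, which means \<open>\<parallel>M f\<parallel> \<le> c' \<parallel>f\<parallel>\<close> (\<open>norm_bound\<close>).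

  Norms and spectra are related by two facts. The spectrum lies in the disc whose radius is the norm, by the
  Neumann series (\<open>not_in_spectrum\<close>), and the norm of a symmetric operator is the modulus of a spectral value
  (\<open>selfadjoint_norm_attained\<close>). The second fact also shows that the spectra are nonempty, so that the suprema
  which define the spectral radii are meaningful.

  The global Markov operator acts on measurable functions only if sums over the neighbours of \<open>x\<close> depend measurably
  on \<open>x\<close>. This is the Lusin-Novikov theorem for Borel sets with sections of bounded size. It is derived from
  Lusin's separation theorem in the space of real sequences and carried over to the graphing by an embedding.
\<close>


section \<open>Separation of analytic sets\<close>

text \<open>
  Analytic sets, coded as projections of closed sets with a sequence of reals as parameter. Such a
  parameter has room for one choice from a countable set, or for countably many further parameters.
\<close>

definition analytic :: "'z::topological_space set \<Rightarrow> bool" where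
  "analytic A \<longleftrightarrow> (\<exists>F :: ('z \<times> (nat \<Rightarrow> real)) set. closed F \<and> A = fst ` F)"

lemma continuous_on_snd_coordinate:
  "continuous_on UNIV (\<lambda>p :: 'z::topological_space \<times> (nat \<Rightarrow> real). snd p k)"
  by (rule continuous_on_product_then_coordinatewise[OF continuous_on_snd[OF continuous_on_id]])

lemma continuous_on_reindex:
  "continuous_on UNIV (\<lambda>(x :: 'z::topological_space, \<sigma> :: nat \<Rightarrow> real). (x, \<lambda>j. \<sigma> (h j)))"
proof -
  have "continuous_on UNIV (\<lambda>p :: 'z \<times> (nat \<Rightarrow> real). \<lambda>j. snd p (h j))"
    by (rule continuous_on_coordinatewise_then_product) (rule continuous_on_snd_coordinate)
  then have "continuous_on UNIV (\<lambda>p :: 'z \<times> (nat \<Rightarrow> real). (fst p, \<lambda>j. snd p (h j)))"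
    by (rule continuous_on_Pair[OF continuous_on_fst[OF continuous_on_id]])
  then show ?thesis by (simp add: case_prod_unfold)
qed

lemma analytic_closed: "closed C \<Longrightarrow> analytic C"
  unfolding analytic_def
  by (rule exI[of _ "C \<times> UNIV"]) (auto intro: closed_Times)

text \<open>
  The first entry of the parameter names a set of the family, and the remaining entries are a parameter
  for that set. On natural numbers, the implication ``entry equals \<open>i\<close> implies \<open>F i\<close>'' is the same as
  ``entry at distance at least 1 from \<open>i\<close>, or \<open>F i\<close>'', and the latter is a closed condition.
\<close>

lemma analytic_UN:
  assumes "\<And>i::nat. analytic (A i :: 'z::topological_space set)"
  shows "analytic (\<Union>i. A i)"
proof -
  have "\<exists>F :: nat \<Rightarrow> ('z \<times> (nat \<Rightarrow> real)) set. \<forall>i. closed (F i) \<and> A i = fst ` F i"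
    using assms unfolding analytic_def by (intro choice) blast
  then obtain F :: "nat \<Rightarrow> ('z \<times> (nat \<Rightarrow> real)) set" where F: "\<And>i. closed (F i)" "\<And>i. A i = fst ` F i"
    by blast
  define F' where "F' = {p. snd p 0 \<in> \<nat>} \<inter>
      (\<Inter>i. {p. \<bar>snd p 0 - real i\<bar> \<ge> 1} \<union> (\<lambda>(x, \<sigma>). (x, \<lambda>j. \<sigma> (Suc j))) -` F i)"
  note c0 = continuous_on_snd_coordinate[where 'z = 'z, of 0]
  have "closed ((\<lambda>p :: 'z \<times> (nat \<Rightarrow> real). snd p 0) -` \<nat>)"
    by (rule closed_vimage[OF closed_Nats c0])
  then have 1: "closed {p :: 'z \<times> (nat \<Rightarrow> real). snd p 0 \<in> \<nat>}"
    by (simp add: vimage_def)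
  have 2: "closed {p :: 'z \<times> (nat \<Rightarrow> real). \<bar>snd p 0 - real i\<bar> \<ge> 1}" for i
    by (intro closed_Collect_le continuous_intros c0)
  have 3: "closed ((\<lambda>(x, \<sigma>). (x, \<lambda>j. \<sigma> (Suc j))) -` F i)" for i
    by (rule closed_vimage[OF F(1) continuous_on_reindex])
  have "closed F'"
    unfolding F'_def by (intro closed_Int 1 closed_INT ballI closed_Un 2 3)
  moreover have "(\<Union>i. A i) = fst ` F'"
  proof (intro set_eqI iffI)
    fix x assume "x \<in> (\<Union>i. A i)"
    then obtain i \<sigma> where i: "(x, \<sigma>) \<in> F i" using F(2) by force
    have "\<bar>real i - real k\<bar> \<ge> 1" if "i \<noteq> k" for k
      using that by linarith
    then have "(x, case_nat (real i) \<sigma>) \<in> F'"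
      using i unfolding F'_def by auto (metis le_refl)
    then show "x \<in> fst ` F'" by force
  next
    fix x assume "x \<in> fst ` F'"
    then obtain \<sigma> where s: "(x, \<sigma>) \<in> F'" by auto
    then obtain i where i: "\<sigma> 0 = real i" unfolding F'_def Nats_def by auto
    have "(x, \<lambda>j. \<sigma> (Suc j)) \<in> F i" using s i unfolding F'_def by auto (metis diff_self abs_zero not_one_le_zero)
    then have "x \<in> A i" using F(2) by force
    then show "x \<in> (\<Union>i. A i)" by blast
  qed
  ultimately show ?thesis unfolding analytic_def by blast
qed

text \<open>
  A pairing function stores one parameter for each set of the family in a single sequence.
\<close>

lemma analytic_INT:
  assumes "\<And>i::nat. analytic (A i :: 'z::topological_space set)"
  shows "analytic (\<Inter>i. A i)"
proof -
  have "\<exists>F :: nat \<Rightarrow> ('z \<times> (nat \<Rightarrow> real)) set. \<forall>i. closed (F i) \<and> A i = fst ` F i"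
    using assms unfolding analytic_def by (intro choice) blast
  then obtain F :: "nat \<Rightarrow> ('z \<times> (nat \<Rightarrow> real)) set" where F: "\<And>i. closed (F i)" "\<And>i. A i = fst ` F i"
    by blast
  define F' where "F' = (\<Inter>i. (\<lambda>(x, \<sigma>). (x, \<lambda>j. \<sigma> (prod_encode (i, j)))) -` F i)"
  have "closed ((\<lambda>(x, \<sigma>). (x, \<lambda>j. \<sigma> (prod_encode (i, j)))) -` F i)" for i
    by (rule closed_vimage[OF F(1) continuous_on_reindex])
  then have "closed F'" unfolding F'_def by (intro closed_INT) auto
  moreover have "(\<Inter>i. A i) = fst ` F'"
  proof (intro set_eqI iffI)
    fix x assume "x \<in> (\<Inter>i. A i)"
    then have "\<forall>i. \<exists>\<sigma>. (x, \<sigma>) \<in> F i" using F(2) by force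
    then obtain \<tau> where t: "\<And>i. (x, \<tau> i) \<in> F i" by metis
    have "(x, \<lambda>n. \<tau> (fst (prod_decode n)) (snd (prod_decode n))) \<in> F'"
      unfolding F'_def using t by auto
    then show "x \<in> fst ` F'" by force
  next
    fix x assume "x \<in> fst ` F'"
    then obtain \<sigma> where "(x, \<sigma>) \<in> F'" by auto
    then have "(x, \<lambda>j. \<sigma> (prod_encode (i, j))) \<in> F i" for i unfolding F'_def by auto
    then show "x \<in> (\<Inter>i. A i)" using F(2) by force
  qed
  ultimately show ?thesis unfolding analytic_def by blast
qed

lemma analytic_open:
  fixes U :: "'z::metric_space set"
  assumes "open U"
  shows "analytic U"
proof -
  have "U = (\<Union>n. {x. \<forall>y\<in>-U. dist x y \<ge> 1 / real (Suc n)})"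
  proof (intro set_eqI iffI)
    fix x assume "x \<in> U"
    then obtain e where e: "e > 0" "\<And>y. dist y x < e \<Longrightarrow> y \<in> U" using assms unfolding open_dist by blast
    obtain n where "1 / real (Suc n) < e" using e(1) nat_approx_posE by blast
    then have "1 / real (Suc n) \<le> dist x y" if "y \<in> - U" for y
      using e(2)[of y] that by (metis ComplD dist_commute linorder_not_less order_less_trans)
    then show "x \<in> (\<Union>n. {x. \<forall>y\<in>-U. dist x y \<ge> 1 / real (Suc n)})" by blast
  qed (force)
  moreover have "closed {x. \<forall>y\<in>-U. dist x y \<ge> 1 / real (Suc n)}" for n
  proof -
    have "{x. \<forall>y\<in>-U. dist x y \<ge> 1 / real (Suc n)} = (\<Inter>y\<in>-U. {x. dist x y \<ge> 1 / real (Suc n)})" by blast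
    then show ?thesis by (auto intro!: closed_INT closed_Collect_le continuous_intros)
  qed
  then have "analytic (\<Union>n. {x. \<forall>y\<in>-U. dist x y \<ge> 1 / real (Suc n)})"
    by (intro analytic_UN analytic_closed)
  ultimately show ?thesis by simp
qed

text \<open>
  The sets that are analytic together with their complement form a \<open>\<sigma>\<close>-algebra that contains all open
  sets.
\<close>

lemma analytic_borel:
  fixes B :: "'z::metric_space set"
  assumes "B \<in> sets borel"
  shows "analytic B"
proof -
  have "B \<in> sigma_sets UNIV {S. open S}" using assms by (simp add: sets_borel)
  then have "analytic B \<and> analytic (-B)"
  proof (induction rule: sigma_sets.induct)
    case (Union a)
    have "analytic (\<Union>i. a i)" "analytic (\<Inter>i. - a i)"
      using Union by (auto intro!: analytic_UN analytic_INT)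
    then show ?case by (simp add: Compl_UN)
  qed (auto intro: analytic_open analytic_closed simp: Compl_eq_Diff_UNIV[symmetric])
  then show ?thesis ..
qed

definition borel_separated :: "'a::topological_space set \<Rightarrow> 'a set \<Rightarrow> bool" where
  "borel_separated A B \<longleftrightarrow> (\<exists>S\<in>sets borel. A \<subseteq> S \<and> S \<inter> B = {})"

text \<open>
  If every piece of one set can be separated from every piece of the other, then so can the sets.
  Contrapositively, inseparability is inherited by some pair of pieces.
\<close>

lemma borel_separated_UN:
  assumes "\<And>i j. i \<in> I \<Longrightarrow> j \<in> J \<Longrightarrow> borel_separated (A i) (B j)" "countable I" "countable J"
  shows "borel_separated (\<Union>i\<in>I. A i) (\<Union>j\<in>J. B j)"
proof -
  define S where "S i j = (SOME S. S \<in> sets borel \<and> A i \<subseteq> S \<and> S \<inter> B j = {})" for i j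
  have S: "S i j \<in> sets borel \<and> A i \<subseteq> S i j \<and> S i j \<inter> B j = {}" if "i \<in> I" "j \<in> J" for i j
    unfolding S_def by (rule someI_ex) (use assms(1)[OF that] in \<open>auto simp: borel_separated_def\<close>)
  have "(\<Union>i\<in>I. \<Inter>j\<in>J. S i j) \<in> sets borel" 
  proof (intro sets.countable_UN'' assms(2))
    fix i assume "i \<in> I"
    then show "(\<Inter>j\<in>J. S i j) \<in> sets borel"
      using S assms(3) by (cases "J = {}") (auto intro!: sets.countable_INT'')
  qed
  moreover have "(\<Union>i\<in>I. A i) \<subseteq> (\<Union>i\<in>I. \<Inter>j\<in>J. S i j)" using S by blast
  moreover have "(\<Union>i\<in>I. \<Inter>j\<in>J. S i j) \<inter> (\<Union>j\<in>J. B j) = {}" using S by blast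
  ultimately show ?thesis unfolding borel_separated_def by blast
qed

lemma countable_cball_cover:
  fixes e :: real assumes "e > 0"
  obtains D :: "'p::{metric_space, second_countable_topology} set" where "countable D" "(\<Union>d\<in>D. cball d e) = UNIV"
proof -
  obtain D :: "'p set" where D: "countable D" "\<And>X. open X \<Longrightarrow> X \<noteq> {} \<Longrightarrow> \<exists>d\<in>D. d \<in> X"
    using countable_dense_exists[where 'a = 'p] by blast
  have "\<exists>d\<in>D. x \<in> cball d e" for x
    using D(2)[of "ball x e"] assms by (force simp: dist_commute)
  then have "(\<Union>d\<in>D. cball d e) = UNIV" by blast
  with D(1) show ?thesis using that by blast
qed

lemma decreasing_closed_limit:
  fixes S :: "nat \<Rightarrow> 'p::complete_space set"
  assumes "\<And>n. closed (S n)" "\<And>n. S n \<noteq> {}" "\<And>n. S (Suc n) \<subseteq> S n \<inter> cball (d n) ((1/2)^n)"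
  obtains a where "a \<in> S 0" "\<And>U. open U \<Longrightarrow> a \<in> U \<Longrightarrow> \<exists>N. \<forall>n\<ge>N. S n \<subseteq> U"
proof -
  have dec: "S n \<subseteq> S m" if "m \<le> n" for m n
    using that assms(3) by (induction rule: dec_induct) blast+
  have small: "\<exists>N. \<forall>x\<in>S N. \<forall>y\<in>S N. dist x y < e" if e: "e > 0" for e
  proof -
    obtain n where n: "(1/2)^n < e/2" using real_arch_pow_inv[of "e/2" "1/2"] e by auto
    have "dist x y < e" if xy: "x \<in> S (Suc n)" "y \<in> S (Suc n)" for x y
    proof -
      have "dist (d n) x \<le> (1/2)^n" "dist (d n) y \<le> (1/2)^n" using xy assms(3)[of n] by auto
      then have "dist x y \<le> (1/2)^n + (1/2)^n" using dist_triangle3[of x y "d n"] by linarith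
      then show ?thesis using n by simp
    qed
    then show ?thesis by blast
  qed
  have "\<exists>a. \<forall>n. a \<in> S n"
    by (rule decreasing_closed_nest[of S, OF assms(1,2) dec small]) auto
  then obtain a where a: "\<And>n. a \<in> S n" by blast
  have "\<exists>N. \<forall>n\<ge>N. S n \<subseteq> U" if U: "open U" "a \<in> U" for U
  proof -
    obtain e where e: "e > 0" "\<And>y. dist y a < e \<Longrightarrow> y \<in> U" using U unfolding open_dist by blast
    obtain N where "\<forall>x\<in>S N. \<forall>y\<in>S N. dist x y < e" using small e(1) by blast
    then have "S N \<subseteq> U" using a e(2) by blast
    then show ?thesis using dec by blast
  qed
  then show ?thesis using that a by blast
qed

lemma separation_refine:
  fixes f :: "'p::{complete_space,second_countable_topology} \<Rightarrow> 'x::t2_space"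
  assumes "\<not> borel_separated (f ` A) (f ` B)" "e > 0"
  shows "\<exists>a b. \<not> borel_separated (f ` (A \<inter> cball a e)) (f ` (B \<inter> cball b e))"
proof (rule ccontr)
  assume *: "\<not> ?thesis"
  obtain D :: "'p set" where D: "countable D" "(\<Union>d\<in>D. cball d e) = UNIV"
    using countable_cball_cover[OF assms(2)] by blast
  have "borel_separated (\<Union>a\<in>D. f ` (A \<inter> cball a e)) (\<Union>b\<in>D. f ` (B \<inter> cball b e))"
    using * D(1) by (intro borel_separated_UN) auto
  moreover have "(\<Union>a\<in>D. f ` (C \<inter> cball a e)) = f ` C" for C
    using D(2) by blast
  ultimately show False using assms(1) by simp
qed

text \<open>
  Lusin's separation argument. If the two images were inseparable, then inseparability would persist along
  a sequence of pairs of closed pieces whose radii tend to zero. By completeness the pieces shrink to points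
  \<open>p \<in> F\<close> and \<open>q \<in> F'\<close>. Their images are distinct, hence have disjoint neighbourhoods, and by continuity
  these already separate the images of all late pieces.
\<close>

lemma closed_images_separated:
  fixes f :: "'p::{complete_space,second_countable_topology} \<Rightarrow> 'x::t2_space"
  assumes f: "continuous_on UNIV f" and cl: "closed F" "closed F'"
    and disj: "f ` F \<inter> f ` F' = {}"
  shows "borel_separated (f ` F) (f ` F')"
proof (rule ccontr)
  assume ns: "\<not> borel_separated (f ` F) (f ` F')"
  \<comment> \<open>\<open>P\<close> describes a pair of inseparable closed pieces, \<open>Q\<close> the passage to smaller pieces.\<close>
  define P where "P n p \<longleftrightarrow> closed (fst p) \<and> closed (snd p) \<and> fst p \<subseteq> F \<and> snd p \<subseteq> F' \<and>
      \<not> borel_separated (f ` fst p) (f ` snd p)" for n :: nat and p :: "'p set \<times> 'p set"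
  define Q where "Q n p q \<longleftrightarrow> (\<exists>a b. fst q \<subseteq> fst p \<inter> cball a ((1/2)^n) \<and> snd q \<subseteq> snd p \<inter> cball b ((1/2)^n))"
    for n :: nat and p q :: "'p set \<times> 'p set"
  have "\<exists>s. \<forall>n. P n (s n) \<and> Q n (s n) (s (Suc n))"
  proof (rule dependent_nat_choice)
    show "\<exists>p. P 0 p" using ns cl unfolding P_def by (intro exI[of _ "(F, F')"]) auto
  next
    fix p n assume p: "P n p"
    then obtain a b where "\<not> borel_separated (f ` (fst p \<inter> cball a ((1/2)^n))) (f ` (snd p \<inter> cball b ((1/2)^n)))"
      using separation_refine[of f "fst p" "snd p" "(1/2)^n"] unfolding P_def by auto
    then show "\<exists>q. P (Suc n) q \<and> Q n p q"
      using p unfolding P_def Q_def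
      by (intro exI[of _ "(fst p \<inter> cball a ((1/2)^n), snd p \<inter> cball b ((1/2)^n))"]) auto
  qed
  then obtain s where s: "\<And>n. P n (s n)" "\<And>n. Q n (s n) (s (Suc n))" by blast
  have ex: "\<forall>n. \<exists>a. fst (s (Suc n)) \<subseteq> fst (s n) \<inter> cball a ((1/2)^n)"
    "\<forall>n. \<exists>b. snd (s (Suc n)) \<subseteq> snd (s n) \<inter> cball b ((1/2)^n)"
    using s(2) unfolding Q_def by blast+
  obtain a where a: "\<And>n. fst (s (Suc n)) \<subseteq> fst (s n) \<inter> cball (a n) ((1/2)^n)"
    using choice[OF ex(1)] by blast
  obtain b where b: "\<And>n. snd (s (Suc n)) \<subseteq> snd (s n) \<inter> cball (b n) ((1/2)^n)"
    using choice[OF ex(2)] by blast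
  have ne: "fst (s n) \<noteq> {}" "snd (s n) \<noteq> {}" for n
  proof -
    have "borel_separated {} X" "borel_separated X {}" for X :: "'x set"
      unfolding borel_separated_def by (auto intro: bexI[of _ "{}"] bexI[of _ UNIV])
    then show "fst (s n) \<noteq> {}" "snd (s n) \<noteq> {}" using s(1)[of n] unfolding P_def by auto
  qed
  obtain p where p: "p \<in> fst (s 0)" "\<And>U. open U \<Longrightarrow> p \<in> U \<Longrightarrow> \<exists>N. \<forall>n\<ge>N. fst (s n) \<subseteq> U"
    by (rule decreasing_closed_limit[of "\<lambda>n. fst (s n)" a, OF _ ne(1) a]) (use s(1) in \<open>auto simp: P_def\<close>)
  obtain q where q: "q \<in> snd (s 0)" "\<And>U. open U \<Longrightarrow> q \<in> U \<Longrightarrow> \<exists>N. \<forall>n\<ge>N. snd (s n) \<subseteq> U"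
    by (rule decreasing_closed_limit[of "\<lambda>n. snd (s n)" b, OF _ ne(2) b]) (use s(1) in \<open>auto simp: P_def\<close>)
  have "f p \<noteq> f q" using p(1) q(1) s(1)[of 0] disj unfolding P_def by blast
  then obtain U V where UV: "open U" "open V" "f p \<in> U" "f q \<in> V" "U \<inter> V = {}"
    using hausdorff[of "f p" "f q"] by blast
  have "open (f -` U)" "open (f -` V)" using UV f by (auto intro: open_vimage)
  then obtain N1 N2 where N: "\<forall>n\<ge>N1. fst (s n) \<subseteq> f -` U" "\<forall>n\<ge>N2. snd (s n) \<subseteq> f -` V"
    using p(2)[of "f -` U"] q(2)[of "f -` V"] UV(3,4) by auto
  have "fst (s (max N1 N2)) \<subseteq> f -` U" "snd (s (max N1 N2)) \<subseteq> f -` V" using N by simp_all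
  then have "borel_separated (f ` fst (s (max N1 N2))) (f ` snd (s (max N1 N2)))"
    using UV unfolding borel_separated_def by (intro bexI[of _ U]) auto
  then show False using s(1) unfolding P_def by blast
qed

lemma borel_projections_separated:
  fixes C C' :: "('x::polish_space \<times> 'y::polish_space) set"
  assumes "C \<in> sets borel" "C' \<in> sets borel" "fst ` C \<inter> fst ` C' = {}"
  shows "borel_separated (fst ` C) (fst ` C')"
proof -
  obtain F F' :: "(('x \<times> 'y) \<times> (nat \<Rightarrow> real)) set" where F: "closed F" "C = fst ` F" "closed F'" "C' = fst ` F'"
    using analytic_borel[OF assms(1)] analytic_borel[OF assms(2)] unfolding analytic_def by blast
  have "borel_separated ((\<lambda>p. fst (fst p)) ` F) ((\<lambda>p. fst (fst p)) ` F')"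
    using F assms(3) by (intro closed_images_separated continuous_intros) (auto simp: image_image)
  then show ?thesis using F by (simp add: image_image)
qed

text \<open>
  A Borel set with at most one point above each \<open>x\<close> is contained in the graph of a Borel function, so that
  its projection is Borel. For a coordinate \<open>k\<close> and a rational \<open>r\<close>, the base points whose point above has
  \<open>k\<close>-th coordinate \<open>< r\<close>, and those for which it is \<open>\<ge> r\<close>, are disjoint projections of Borel sets. A Borel
  set \<open>Q k r\<close> that separates them answers the question whether the coordinate is below \<open>r\<close>, and the coordinate
  is the infimum of all \<open>r\<close> with a positive answer.
\<close>

lemma borel_uniformization:
  fixes G :: "('x::polish_space \<times> (nat \<Rightarrow> real)) set"
  assumes G: "G \<in> sets borel" and single: "\<And>x y z. (x, y) \<in> G \<Longrightarrow> (x, z) \<in> G \<Longrightarrow> y = z"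
  obtains g where "g \<in> borel_measurable borel" "\<And>x y. (x, y) \<in> G \<Longrightarrow> y = g x"
proof -
  note G[measurable]
  have coord[measurable]: "(\<lambda>p :: 'x \<times> (nat \<Rightarrow> real). snd p k) \<in> borel_measurable borel" for k
    by (rule borel_measurable_continuous_onI[OF continuous_on_snd_coordinate])
  define L U where "L k r = G \<inter> {p. snd p k < real_of_rat r}" and "U k r = G \<inter> {p. snd p k \<ge> real_of_rat r}" for k r
  have LU[measurable]: "L k r \<in> sets borel" "U k r \<in> sets borel" for k r
  proof -
    have "{p \<in> space (borel :: ('x \<times> (nat \<Rightarrow> real)) measure). snd p k < real_of_rat r} \<in> sets borel"
      "{p \<in> space (borel :: ('x \<times> (nat \<Rightarrow> real)) measure). snd p k \<ge> real_of_rat r} \<in> sets borel"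
      by measurable
    then show "L k r \<in> sets borel" "U k r \<in> sets borel"
      using G unfolding L_def U_def by auto
  qed
  define Q where "Q k r = (SOME S. S \<in> sets borel \<and> fst ` L k r \<subseteq> S \<and> S \<inter> fst ` U k r = {})" for k r
  have Q: "Q k r \<in> sets borel \<and> fst ` L k r \<subseteq> Q k r \<and> Q k r \<inter> fst ` U k r = {}" for k r
    unfolding Q_def
  proof (rule someI_ex)
    have "fst ` L k r \<inter> fst ` U k r = {}"
      unfolding L_def U_def using single by fastforce
    then have "borel_separated (fst ` L k r) (fst ` U k r)"
      by (intro borel_projections_separated LU)
    then show "\<exists>S. S \<in> sets borel \<and> fst ` L k r \<subseteq> S \<and> S \<inter> fst ` U k r = {}"
      unfolding borel_separated_def by blast
  qed
  have Qm[measurable]: "Q k r \<in> sets borel" for k r using Q by blast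
  define g where "g x k = real_of_ereal (INF r. if x \<in> Q k r then ereal (real_of_rat r) else \<infinity>)" for x k
  have "g \<in> borel_measurable borel"
    by (rule measurable_coordinatewise_then_product) (unfold g_def, measurable)
  moreover have "y = g x" if xy: "(x, y) \<in> G" for x y
  proof
    fix k
    have Qiff: "x \<in> Q k r \<longleftrightarrow> y k < real_of_rat r" for r
    proof
      assume "x \<in> Q k r"
      then have "(x, y) \<notin> U k r" using Q[of k r] by force
      then show "y k < real_of_rat r" using xy unfolding U_def by auto
    next
      assume "y k < real_of_rat r"
      then have "(x, y) \<in> L k r" using xy unfolding L_def by auto
      then show "x \<in> Q k r" using Q[of k r] by force
    qed
    have "(INF r. if x \<in> Q k r then ereal (real_of_rat r) else \<infinity>) = ereal (y k)"
    proof (rule antisym)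
      show "ereal (y k) \<le> (INF r. if x \<in> Q k r then ereal (real_of_rat r) else \<infinity>)"
        by (rule INF_greatest) (auto simp: Qiff)
      show "(INF r. if x \<in> Q k r then ereal (real_of_rat r) else \<infinity>) \<le> ereal (y k)"
      proof (rule dense_ge)
        fix z assume z: "ereal (y k) < z"
        then obtain t where t: "y k < t" "ereal t \<le> z"
          by (metis ereal_dense2 less_ereal.simps(1) order_less_imp_le)
        obtain r where r: "y k < real_of_rat r" "real_of_rat r < t" using of_rat_dense[OF t(1)] by blast
        have "(INF r. if x \<in> Q k r then ereal (real_of_rat r) else \<infinity>) \<le> ereal (real_of_rat r)"
          by (rule INF_lower2[of r]) (use r in \<open>auto simp: Qiff\<close>)
        also have "\<dots> \<le> z" using r t(2) by (meson ereal_less_eq(3) less_imp_le order_trans)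
        finally show "(INF r. if x \<in> Q k r then ereal (real_of_rat r) else \<infinity>) \<le> z" .
      qed
    qed
    then show "y k = g x k" unfolding g_def by simp
  qed
  ultimately show ?thesis using that by blast
qed

section \<open>Borel graphs of bounded degree\<close>

text \<open>
  The lexicographic order on sequences is a Borel linear order. It is used to single out one point of every
  finite section.
\<close>

lemma less_fun_linear:
  fixes f g :: "nat \<Rightarrow> real"
  assumes "f \<noteq> g"
  shows "less_fun f g \<or> less_fun g f"
proof -
  have "\<exists>k. f k \<noteq> g k" using assms by auto
  then have k: "f (LEAST k. f k \<noteq> g k) \<noteq> g (LEAST k. f k \<noteq> g k)" by (rule LeastI_ex)
  have l: "f j = g j" if "j < (LEAST k. f k \<noteq> g k)" for j using not_less_Least[OF that] by simp
  from k have "f (LEAST k. f k \<noteq> g k) < g (LEAST k. f k \<noteq> g k) \<or> g (LEAST k. f k \<noteq> g k) < f (LEAST k. f k \<noteq> g k)"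
    by linarith
  then show ?thesis unfolding less_fun_def using l l[symmetric] by blast
qed

lemma less_fun_maximal:
  fixes A :: "(nat \<Rightarrow> real) set"
  assumes "finite A" "A \<noteq> {}"
  shows "\<exists>m\<in>A. \<forall>y\<in>A. \<not> less_fun m y"
  using assms
proof (induction rule: finite_ne_induct)
  case (singleton x)
  then show ?case by (simp add: less_fun_irrefl)
next
  case (insert x A)
  then obtain m where m: "m \<in> A" "\<forall>y\<in>A. \<not> less_fun m y" by blast
  show ?case
  proof (cases "less_fun m x")
    case True
    then have "\<forall>y\<in>insert x A. \<not> less_fun x y"
      using m(2) less_fun_trans less_fun_irrefl by blast
    then show ?thesis by blast
  next
    case False
    then show ?thesis using m by blast
  qed
qed

text \<open>
  Lusin-Novikov for sections of bounded size, by induction on the bound. Let \<open>H\<close> arise from \<open>G\<close> by removing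
  the lexicographic maximum from every section. The sections of \<open>G - H\<close> have at most one point, so they are
  covered by \<open>borel_uniformization\<close>, and \<open>H\<close> has smaller sections. That \<open>H\<close> is Borel is itself an instance of the
  induction hypothesis: a point \<open>(x, y)\<close> belongs to \<open>H\<close> iff the set of all \<open>z > y\<close> in the section of \<open>G\<close> at
  \<open>x\<close> is nonempty, and this set is smaller than the section. The base points \<open>(x, y)\<close> of this auxiliary set \<open>K\<close>
  are interleaved into single sequences, so that the hypothesis applies to it.
\<close>

lemma borel_bounded_sections:
  fixes G :: "((nat \<Rightarrow> real) \<times> (nat \<Rightarrow> real)) set"
  assumes "G \<in> sets borel" "\<And>x. finite (G `` {x}) \<and> card (G `` {x}) \<le> D"
  shows "Domain G \<in> sets borel \<and>
    (\<forall>f :: _ \<Rightarrow> 'b::{second_countable_topology, real_normed_vector}. f \<in> borel_measurable borel \<longrightarrow>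
        (\<lambda>x. \<Sum>y\<in>G `` {x}. f (x, y)) \<in> borel_measurable borel)"
  using assms
proof (induction D arbitrary: G)
  case 0
  then have "G `` {x} = {}" for x
    using 0(2)[of x] by (simp only: le_zero_eq card_eq_0_iff) blast
  then have "G = {}" by auto
  then show ?case by simp
next
  case (Suc D)
  note G[measurable] = Suc.prems(1)
  define H where "H = {(x, y) \<in> G. \<exists>z. less_fun y z \<and> (x, z) \<in> G}"
  \<comment> \<open>\<open>mg\<close> interleaves two sequences; \<open>ev\<close> and \<open>od\<close> recover them.\<close>
  define ev where "ev w j = w (2 * j)" for w :: "nat \<Rightarrow> real" and j
  define od where "od w j = w (2 * j + 1)" for w :: "nat \<Rightarrow> real" and j
  define mg where "mg p n = (if even n then fst p (n div 2) else snd p (n div 2))"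
    for p :: "(nat \<Rightarrow> real) \<times> (nat \<Rightarrow> real)" and n :: nat
  define K where "K = {(w, z). (ev w, od w) \<in> G \<and> (ev w, z) \<in> G \<and> less_fun (od w) z}"
  have H_K: "H = mg -` Domain K"
    unfolding H_def K_def ev_def od_def mg_def by auto
  have m1: "(\<lambda>p :: (nat \<Rightarrow> real) \<times> (nat \<Rightarrow> real). fst p k) \<in> borel_measurable borel"
    and m2: "(\<lambda>p :: (nat \<Rightarrow> real) \<times> (nat \<Rightarrow> real). snd p k) \<in> borel_measurable borel" for k
    by (intro borel_measurable_continuous_onI continuous_on_snd_coordinate
      continuous_on_product_then_coordinatewise[OF continuous_on_fst[OF continuous_on_id]])+
  have mev: "(\<lambda>p :: (nat \<Rightarrow> real) \<times> (nat \<Rightarrow> real). ev (fst p)) \<in> borel_measurable borel"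
    and mod: "(\<lambda>p :: (nat \<Rightarrow> real) \<times> (nat \<Rightarrow> real). od (fst p)) \<in> borel_measurable borel"
    and msnd: "(\<lambda>p :: (nat \<Rightarrow> real) \<times> (nat \<Rightarrow> real). snd p) \<in> borel_measurable borel"
    unfolding ev_def od_def
    by (rule measurable_coordinatewise_then_product, simp add: m1 m2)+
  have mmg: "mg \<in> borel_measurable borel"
  proof (rule measurable_coordinatewise_then_product)
    fix i show "(\<lambda>p. mg p i) \<in> borel_measurable borel"
      unfolding mg_def by (cases "even i") (simp_all add: m1 m2)
  qed
  have "K = (\<lambda>p. (ev (fst p), od (fst p))) -` G \<inter> (\<lambda>p. (ev (fst p), snd p)) -` G
      \<inter> {p. \<exists>k. fst p (2 * k + 1) < snd p k \<and> (\<forall>j\<in>{..<k}. fst p (2 * j + 1) = snd p j)}"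
    unfolding K_def less_fun_def ev_def od_def by auto
  moreover have "(\<lambda>p :: (nat \<Rightarrow> real) \<times> (nat \<Rightarrow> real). (ev (fst p), od (fst p))) -` G \<in> sets borel"
    using measurable_sets_borel[OF borel_measurable_Pair[OF mev mod] G] .
  moreover have "(\<lambda>p. (ev (fst p), snd p)) -` G \<in> sets borel"
    using measurable_sets_borel[OF borel_measurable_Pair[OF mev msnd] G] .
  moreover have "{p \<in> space borel. \<exists>k. fst p (2 * k + 1) < snd p k \<and> (\<forall>j\<in>{..<k}. fst p (2 * j + 1) = snd p j)}
      \<in> sets (borel :: ((nat \<Rightarrow> real) \<times> (nat \<Rightarrow> real)) measure)"
  proof -
    have lex: "{p \<in> space borel. \<exists>k. a k p < b k p \<and> (\<forall>j\<in>{..<k}. a j p = b j p)} \<in> sets borel"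
      if [measurable]: "\<And>k. a k \<in> borel_measurable borel" "\<And>k. b k \<in> borel_measurable borel"
      for a b :: "nat \<Rightarrow> (nat \<Rightarrow> real) \<times> (nat \<Rightarrow> real) \<Rightarrow> real"
      by measurable
    show ?thesis by (rule lex) (rule m1 m2)+
  qed
  ultimately have K: "K \<in> sets borel" by auto
  have K_sec: "finite (K `` {w}) \<and> card (K `` {w}) \<le> D" for w
  proof (cases "(ev w, od w) \<in> G")
    case True
    have sub: "K `` {w} \<subseteq> G `` {ev w} - {od w}" unfolding K_def using less_fun_irrefl by auto
    have "finite (G `` {ev w})" "card (G `` {ev w} - {od w}) \<le> D"
      using Suc.prems(2)[of "ev w"] True by (auto simp: card_Diff_singleton_if)
    then show ?thesis using sub card_mono[OF _ sub] finite_subset[OF sub] by fastforce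
  next
    case False
    then have "K `` {w} = {}" unfolding K_def by auto
    then show ?thesis by simp
  qed
  have "H \<in> sets borel"
    unfolding H_K using Suc.IH[OF K K_sec] measurable_sets_borel[OF mmg] by blast
  note H[measurable] = this
  have max_unique: "y = z" if "(x, y) \<in> G - H" "(x, z) \<in> G - H" for x y z
    using that less_fun_linear[of y z] unfolding H_def by auto
  have max_ex: "\<exists>m. (x, m) \<in> G - H" if "(x, y) \<in> G" for x y
    using less_fun_maximal[of "G `` {x}"] Suc.prems(2)[of x] that unfolding H_def by blast
  obtain g where g: "g \<in> borel_measurable borel" "\<And>x y. (x, y) \<in> G - H \<Longrightarrow> y = g x"
    using borel_uniformization[of "G - H"] G H max_unique by blast
  have mg': "(\<lambda>x. (x, g x)) \<in> borel_measurable borel"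
    using g(1) by (intro borel_measurable_Pair) auto
  have top: "(\<lambda>x. (x, g x)) -` (G - H) \<in> sets borel"
    using measurable_sets_borel[OF mg'] G H by blast
  have dom: "Domain G = (\<lambda>x. (x, g x)) -` (G - H)"
    using max_ex g(2) by blast
  have H_sec: "finite (H `` {x}) \<and> card (H `` {x}) \<le> D" for x
  proof (cases "x \<in> Domain G")
    case True
    then have "(x, g x) \<in> G - H" using dom by blast
    then have sub: "H `` {x} \<subseteq> G `` {x} - {g x}" and "g x \<in> G `` {x}" unfolding H_def by auto
    then have "finite (G `` {x})" "card (G `` {x} - {g x}) \<le> D"
      using Suc.prems(2)[of x] by (auto simp: card_Diff_singleton_if)
    then show ?thesis using sub card_mono[OF _ sub] finite_subset[OF sub] by fastforce
  next
    case False
    then have "H `` {x} = {}" unfolding H_def by auto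
    then show ?thesis by simp
  qed
  have "(\<lambda>x. \<Sum>y\<in>G `` {x}. f (x, y)) \<in> borel_measurable borel" if f: "f \<in> borel_measurable borel" for f :: "_ \<Rightarrow> 'b"
  proof -
    have "(\<Sum>y\<in>G `` {x}. f (x, y)) = (\<Sum>y\<in>H `` {x}. f (x, y)) + indicator ((\<lambda>x. (x, g x)) -` (G - H)) x *\<^sub>R f (x, g x)" for x
    proof (cases "(x, g x) \<in> G - H")
      case True
      have "G `` {x} = insert (g x) (H `` {x})"
        using True g(2) unfolding H_def by blast
      moreover have "g x \<notin> H `` {x}" using True by blast
      ultimately show ?thesis using True H_sec[of x] by (simp add: add.commute)
    next
      case False
      then have "G `` {x} = {}" using dom by blast
      moreover from this have "H `` {x} = {}" unfolding H_def by auto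
      ultimately show ?thesis using False by simp
    qed
    moreover have "(\<lambda>x. (\<Sum>y\<in>H `` {x}. f (x, y)) + indicator ((\<lambda>x. (x, g x)) -` (G - H)) x *\<^sub>R f (x, g x)) \<in> borel_measurable borel"
    proof (intro borel_measurable_add borel_measurable_scaleR)
      show "(\<lambda>x. \<Sum>y\<in>H `` {x}. f (x, y)) \<in> borel_measurable borel"
        using Suc.IH[OF H H_sec] f by blast
      show "(\<lambda>x. f (x, g x)) \<in> borel_measurable borel"
        using measurable_compose[OF mg' f] .
    qed (use top in simp)
    ultimately show ?thesis by simp
  qed
  then show ?case using dom top by simp
qed

section \<open>Sums over neighbours in a standard Borel space\<close>

text \<open>
  The distances to a dense sequence embed a Polish space into the space of real sequences. The image is
  completely metrizable, hence a \<open>G\<^sub>\<delta>\<close> set, hence Borel, so the inverse of the embedding can be extended to a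
  Borel function \<open>h\<close> that is constant off the image.
\<close>

lemma standard_borel_retract:
  assumes M: "standard_borel M" and ne: "space M \<noteq> {}"
  obtains e :: "'a \<Rightarrow> (nat \<Rightarrow> real)" and h
  where "e \<in> M \<rightarrow>\<^sub>M borel" "h \<in> borel \<rightarrow>\<^sub>M M" "\<And>x. x \<in> space M \<Longrightarrow> h (e x) = x"
proof -
  obtain T where T: "completely_metrizable_space T" "second_countable T" "topspace T = space M"
    "sets M = sigma_sets (space M) {U. openin T U}"
    using M unfolding standard_borel_def by blast
  obtain X d where X: "Metric_space X d" "T = Metric_space.mtopology X d"
    using T(1) unfolding completely_metrizable_space_def by blast
  interpret Metric_space X d by (rule X(1))
  have XM: "X = space M" using T(3) X(2) by simp
  obtain C where C: "countable C" "C \<subseteq> X" "T closure_of C = X"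
    using second_countable_imp_separable_space[OF T(2)] unfolding separable_space_def
    using X(2) by auto
  have "C \<noteq> {}" using C(3) XM ne by auto
  define q where "q = from_nat_into C"
  have q: "q n \<in> X" for n using from_nat_into[OF \<open>C \<noteq> {}\<close>] C(2) unfolding q_def by blast
  have q_dense: "\<exists>n. d x (q n) < r" if "x \<in> X" "r > 0" for x r
  proof -
    have "x \<in> T closure_of C" using C(3) that by simp
    moreover have "openin T (mball x r)" "x \<in> mball x r" using X(2) that by auto
    ultimately obtain c where "c \<in> C" "c \<in> mball x r" unfolding in_closure_of by blast
    moreover obtain n where "q n = c" using from_nat_into_surj[OF C(1) \<open>c \<in> C\<close>] unfolding q_def by blast
    ultimately show ?thesis by auto
  qed
  define e where "e x n = d x (q n)" for x n
  \<comment> \<open>An open set is the union of the balls around points of the dense sequence that it contains, and such a ball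
    is a condition on a single coordinate of \<open>e\<close>.\<close>
  have open_iff: "\<exists>W. open W \<and> U = {x \<in> X. e x \<in> W}" if U: "openin T U" for U
  proof (intro exI conjI)
    let ?S = "{p :: nat \<times> real. {x \<in> X. e x (fst p) < snd p} \<subseteq> U}"
    let ?W = "\<Union>p\<in>?S. {w :: nat \<Rightarrow> real. w (fst p) < snd p}"
    show "open ?W"
      by (intro open_UN ballI open_Collect_less continuous_on_product_coordinates continuous_on_const)
    show "U = {x \<in> X. e x \<in> ?W}"
    proof (intro set_eqI iffI)
      fix x assume x: "x \<in> U"
      then have xX: "x \<in> X" using openin_subset[OF U] X(2) by auto
      obtain r where r: "r > 0" "mball x r \<subseteq> U"
        using U x unfolding X(2) openin_mtopology by blast
      obtain n where n: "d x (q n) < r / 2" using q_dense[OF xX, of "r / 2"] r by auto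
      have "{x \<in> X. e x n < r / 2} \<subseteq> U"
      proof
        fix y assume y: "y \<in> {x \<in> X. e x n < r / 2}"
        have "d x y \<le> d x (q n) + d (q n) y" using triangle[of x "q n" y] xX q y by auto
        then have "d x y < r" using n y commute[of y "q n"] unfolding e_def by auto
        then show "y \<in> U" using r(2) xX y by auto
      qed
      then have "(n, r / 2) \<in> ?S" by simp
      moreover have "e x n < r / 2" using n unfolding e_def .
      ultimately have "e x \<in> ?W" by (intro UN_I[of "(n, r / 2)"]) simp_all
      then show "x \<in> {x \<in> X. e x \<in> ?W}" using xX by simp
    qed auto
  qed
  have inj: "inj_on e X"
  proof (rule inj_onI, rule ccontr)
    fix x y assume xy: "x \<in> X" "y \<in> X" "e x = e y" "x \<noteq> y"
    then have "d x y > 0" by simp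
    then obtain n where n: "d x (q n) < d x y / 2" using q_dense[of x "d x y / 2"] xy(1) by auto
    moreover have "d y (q n) = d x (q n)" using fun_cong[OF xy(3), of n] unfolding e_def by simp
    moreover have "d x y \<le> d x (q n) + d (q n) y" using triangle[of x "q n" y] xy q by auto
    ultimately show False using commute[of y "q n"] by simp
  qed
  define S where "S = e ` X"
  define i where "i = inv_into X e"
  have ie: "i (e x) = x" if "x \<in> X" for x using inj that unfolding i_def by simp
  have e_cont: "continuous_map T euclidean e"
  proof -
    have "continuous_map T euclidean (\<lambda>x. e x n)" for n
    proof -
      have "continuous_map mtopology euclideanreal (\<lambda>x. d x (q n))"
        unfolding continuous_map_def
      proof (intro conjI allI impI)
        fix U :: "real set" assume U: "openin euclideanreal U"
        show "openin mtopology {x \<in> topspace mtopology. d x (q n) \<in> U}"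
          unfolding openin_mtopology
        proof (intro conjI allI impI)
          fix x assume x: "x \<in> {x \<in> topspace mtopology. d x (q n) \<in> U}"
          obtain r where r: "r > 0" "\<And>t. dist t (d x (q n)) < r \<Longrightarrow> t \<in> U"
            using U x unfolding open_openin[symmetric] open_dist by blast
          have "mball x r \<subseteq> {x \<in> topspace mtopology. d x (q n) \<in> U}"
          proof
            fix y assume y: "y \<in> mball x r"
            have "\<bar>d y (q n) - d x (q n)\<bar> \<le> d x y"
              using triangle[of x y "q n"] triangle[of y x "q n"] commute[of x y] x y q by auto
            then show "y \<in> {x \<in> topspace mtopology. d x (q n) \<in> U}"
              using r(2) y by (auto simp: dist_real_def)
          qed
          then show "\<exists>r>0. mball x r \<subseteq> {x \<in> topspace mtopology. d x (q n) \<in> U}" using r(1) by blast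
        qed auto
      qed auto
      then show "continuous_map T euclidean (\<lambda>x. e x n)" unfolding e_def X(2) .
    qed
    then show ?thesis
      unfolding euclidean_product_topology[symmetric] by (intro continuous_map_coordinatewise_then_product) auto
  qed
  have "homeomorphic_maps T (top_of_set S) e i"
    unfolding homeomorphic_maps_def
  proof (intro conjI ballI)
    show "continuous_map T (top_of_set S) e"
      using e_cont unfolding S_def continuous_map_in_subtopology X(2) by auto
    show "continuous_map (top_of_set S) T i"
      unfolding continuous_map_def
    proof (intro conjI allI impI)
      show "i \<in> topspace (top_of_set S) \<rightarrow> topspace T" unfolding S_def X(2) using ie by auto
      fix U assume U: "openin T U"
      then obtain W where W: "open W" "U = {x \<in> X. e x \<in> W}" using open_iff by blast
      have "{w \<in> topspace (top_of_set S). i w \<in> U} = S \<inter> W"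
        using W(2) ie unfolding S_def by auto
      then show "openin (top_of_set S) {w \<in> topspace (top_of_set S). i w \<in> U}"
        using W(1) by auto
    qed
  qed (use ie X(2) in \<open>auto simp: S_def\<close>)
  then have "T homeomorphic_space (top_of_set S)" unfolding homeomorphic_space_def by blast
  then have "completely_metrizable_space (top_of_set S)"
    using homeomorphic_completely_metrizable_space T(1) by blast
  then have "gdelta_in euclidean S"
    by (intro completely_metrizable_space_imp_gdelta_in) (auto simp: metrizable_space_euclidean)
  then obtain W where W: "\<And>n::nat. open (W n)" "\<Inter>(range W) = S"
    unfolding gdelta_in_descending by auto
  have S: "S \<in> sets borel"
    unfolding W(2)[symmetric] using W(1) by (intro sets.countable_INT) auto
  have e_meas: "e \<in> M \<rightarrow>\<^sub>M borel"
  proof (rule borel_measurableI)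
    fix U :: "(nat \<Rightarrow> real) set" assume "open U"
    then have "openin T {x \<in> topspace T. e x \<in> U}" using e_cont unfolding continuous_map_def by auto
    then have "{x \<in> space M. e x \<in> U} \<in> sets M" using T(3,4) by auto
    then show "e -` U \<inter> space M \<in> sets M" by (simp add: vimage_def Int_def conj_commute)
  qed
  have trace: "\<exists>B\<in>sets borel. A = {x \<in> X. e x \<in> B}" if "A \<in> sets M" for A
    using that unfolding T(4)
  proof (induction rule: sigma_sets.induct)
    case (Basic U)
    then show ?case using open_iff[of U] by auto
  next
    case Empty
    show ?case by (intro bexI[of _ "{}"]) auto
  next
    case (Compl A)
    then obtain B where "B \<in> sets borel" "A = {x \<in> X. e x \<in> B}" by blast
    then show ?case by (intro bexI[of _ "- B"]) (auto simp: XM)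
  next
    case (Union A)
    then have "\<forall>n. \<exists>B. B \<in> sets borel \<and> A n = {x \<in> X. e x \<in> B}" by blast
    from choice[OF this] obtain B where "\<And>n. B n \<in> sets borel" "\<And>n. A n = {x \<in> X. e x \<in> B n}" by blast
    then show ?case by (intro bexI[of _ "\<Union>n. B n"]) auto
  qed
  obtain x0 where x0: "x0 \<in> space M" using ne by blast
  define h where "h w = (if w \<in> S then i w else x0)" for w
  have "h \<in> borel \<rightarrow>\<^sub>M M"
  proof (rule measurableI)
    fix w show "h w \<in> space M" using x0 ie XM unfolding h_def S_def by auto
  next
    fix A assume A: "A \<in> sets M"
    obtain B where B: "B \<in> sets borel" "A = {x \<in> X. e x \<in> B}" using trace[OF A] by blast
    have "h -` A \<inter> space borel = (S \<inter> B) \<union> (if x0 \<in> A then - S else {})"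
    proof (intro set_eqI)
      fix w show "w \<in> h -` A \<inter> space borel \<longleftrightarrow> w \<in> (S \<inter> B) \<union> (if x0 \<in> A then - S else {})"
      proof (cases "w \<in> S")
        case True
        then obtain x where "x \<in> X" "w = e x" unfolding S_def by blast
        then show ?thesis using True B(2) ie unfolding h_def by auto
      qed (auto simp: h_def)
    qed
    then show "h -` A \<inter> space borel \<in> sets borel" using S B(1) by auto
  qed
  moreover have "h (e x) = x" if "x \<in> space M" for x
    using that ie unfolding h_def S_def XM by auto
  ultimately show ?thesis using that e_meas by blast
qed

text \<open>
  The measurability of degrees, and of all sums over neighbours. The graph is carried over to the space of
  sequences, where \<open>borel_bounded_sections\<close> applies.
\<close>

lemma borel_measurable_neighbour_sum:
  fixes f :: "'a \<times> 'a \<Rightarrow> 'b::{second_countable_topology, real_normed_vector}"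
  assumes M: "standard_borel M" and ne: "space M \<noteq> {}" and G: "G \<in> sets (M \<Otimes>\<^sub>M M)"
    and bd: "\<And>x. x \<in> space M \<Longrightarrow> finite (G `` {x}) \<and> card (G `` {x}) \<le> D"
    and f: "f \<in> borel_measurable (M \<Otimes>\<^sub>M M)"
  shows "(\<lambda>x. \<Sum>y\<in>G `` {x}. f (x, y)) \<in> borel_measurable M"
proof -
  obtain e :: "'a \<Rightarrow> (nat \<Rightarrow> real)" and h where e[measurable]: "e \<in> M \<rightarrow>\<^sub>M borel" and h[measurable]: "h \<in> borel \<rightarrow>\<^sub>M M"
    and he: "\<And>x. x \<in> space M \<Longrightarrow> h (e x) = x"
    using standard_borel_retract[OF M ne] by blast
  have hs: "h w \<in> space M" for w using measurable_space[OF h] by simp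
  have GX: "x \<in> space M \<and> y \<in> space M" if "(x, y) \<in> G" for x y
    using sets.sets_into_space[OF G] that by (auto simp: space_pair_measure)
  \<comment> \<open>Off the image of \<open>e\<close> the values of \<open>h\<close> are arbitrary. The conditions \<open>e (h w) = w\<close> restrict to the image, so that
    the sections keep their size.\<close>
  define G' where "G' = {p \<in> space (borel \<Otimes>\<^sub>M borel). (h (fst p), h (snd p)) \<in> G \<and> e (h (fst p)) = fst p \<and> e (h (snd p)) = snd p}"
  have hh: "(\<lambda>p. (h (fst p), h (snd p))) \<in> borel \<Otimes>\<^sub>M borel \<rightarrow>\<^sub>M M \<Otimes>\<^sub>M M" by measurable
  have m0: "{p \<in> space (borel \<Otimes>\<^sub>M borel). (h (fst p), h (snd p)) \<in> G} \<in> sets (borel \<Otimes>\<^sub>M borel)"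
    using measurable_sets[OF hh G] by (simp add: vimage_def Int_def conj_commute)
  have eqm: "{p \<in> space (borel \<Otimes>\<^sub>M borel). a p = (b p :: nat \<Rightarrow> real)} \<in> sets (borel \<Otimes>\<^sub>M borel)"
    if "a \<in> borel_measurable (borel \<Otimes>\<^sub>M borel)" "b \<in> borel_measurable (borel \<Otimes>\<^sub>M borel)"
    for a b :: "(nat \<Rightarrow> real) \<times> (nat \<Rightarrow> real) \<Rightarrow> _"
  proof -
    have coord: "(\<lambda>p. c p k) \<in> borel_measurable (borel \<Otimes>\<^sub>M borel)"
      if "c \<in> borel_measurable (borel \<Otimes>\<^sub>M borel)" for c :: "(nat \<Rightarrow> real) \<times> (nat \<Rightarrow> real) \<Rightarrow> nat \<Rightarrow> real" and k
      by (rule measurable_compose[OF that measurable_product_coordinates])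
    have "{p \<in> space (borel \<Otimes>\<^sub>M borel). \<forall>k. a p k = b p k} \<in> sets (borel \<Otimes>\<^sub>M borel)"
      by (intro sets.sets_Collect_countable_All borel_measurable_eq coord that)
    then show ?thesis by (simp only: fun_eq_iff)
  qed
  have "G' = {p \<in> space (borel \<Otimes>\<^sub>M borel). (h (fst p), h (snd p)) \<in> G} \<inter> {p \<in> space (borel \<Otimes>\<^sub>M borel). e (h (fst p)) = fst p}
      \<inter> {p \<in> space (borel \<Otimes>\<^sub>M borel). e (h (snd p)) = snd p}"
    unfolding G'_def by blast
  also have "\<dots> \<in> sets (borel \<Otimes>\<^sub>M borel)" by (intro sets.Int m0 eqm) measurable
  finally have "G' \<in> sets (borel \<Otimes>\<^sub>M borel)" .
  moreover have bp: "borel \<Otimes>\<^sub>M borel = (borel :: ((nat \<Rightarrow> real) \<times> (nat \<Rightarrow> real)) measure)" by (rule borel_prod)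
  ultimately have G': "G' \<in> sets borel" by (simp only: bp)
  have G'_sec: "G' `` {e x} = e ` (G `` {x})" if "x \<in> space M" for x
  proof (intro set_eqI iffI)
    fix v assume "v \<in> G' `` {e x}"
    then have "(x, h v) \<in> G" "e (h v) = v" using he[OF that] unfolding G'_def by auto
    then show "v \<in> e ` (G `` {x})" by force
  next
    fix v assume "v \<in> e ` (G `` {x})"
    then obtain y where "(x, y) \<in> G" "v = e y" by blast
    then show "v \<in> G' `` {e x}" using he GX unfolding G'_def by (auto simp: space_pair_measure)
  qed
  have G'_bd: "finite (G' `` {w}) \<and> card (G' `` {w}) \<le> D" for w
  proof (cases "e (h w) = w")
    case True
    then have "G' `` {w} = e ` (G `` {h w})" using G'_sec[OF hs[of w]] by simp
    then show ?thesis using bd[OF hs[of w]] card_image_le[of "G `` {h w}" e] by auto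
  next
    case False
    then have "G' `` {w} = {}" unfolding G'_def by auto
    then show ?thesis by simp
  qed
  define f' where "f' p = f (h (fst p), h (snd p))" for p
  have "f' \<in> borel_measurable borel"
    unfolding f'_def bp[symmetric] by (rule measurable_compose[OF hh f])
  then have "(\<lambda>w. \<Sum>v\<in>G' `` {w}. f' (w, v)) \<in> borel_measurable borel"
    using borel_bounded_sections[OF G' G'_bd] by blast
  then have "(\<lambda>x. \<Sum>v\<in>G' `` {e x}. f' (e x, v)) \<in> borel_measurable M"
    by (rule measurable_compose[OF e])
  moreover have "(\<Sum>v\<in>G' `` {e x}. f' (e x, v)) = (\<Sum>y\<in>G `` {x}. f (x, y))" if x: "x \<in> space M" for x
  proof -
    have "inj_on e (G `` {x})" using he GX by (metis Image_singleton_iff inj_onI)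
    then have "(\<Sum>v\<in>G' `` {e x}. f' (e x, v)) = (\<Sum>y\<in>G `` {x}. f' (e x, e y))"
      unfolding G'_sec[OF x] by (simp add: sum.reindex)
    also have "\<dots> = (\<Sum>y\<in>G `` {x}. f (x, y))"
      using he x GX unfolding f'_def by (intro sum.cong) auto
    finally show ?thesis .
  qed
  ultimately show ?thesis by (simp cong: measurable_cong)
qed

section \<open>Norm and spectrum of a symmetric operator\<close>

lemma L2_norm_nonneg: "0 \<le> L2_norm N f"
  unfolding L2_norm_def by simp

lemma L2_norm_square: "(L2_norm N f)\<^sup>2 = (\<integral>x. (cmod (f x))\<^sup>2 \<partial>N)"
  unfolding L2_norm_def by simp

lemma L2_measurable: "f \<in> L2 N \<Longrightarrow> f \<in> borel_measurable N"
  and L2_integrable: "f \<in> L2 N \<Longrightarrow> integrable N (\<lambda>x. (cmod (f x))\<^sup>2)"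
  unfolding L2_def by auto

lemma L2_I: "f \<in> borel_measurable N \<Longrightarrow> integrable N (\<lambda>x. (cmod (f x))\<^sup>2) \<Longrightarrow> f \<in> L2 N"
  unfolding L2_def by simp

lemma norm_add_square_le: "(cmod (a + b))\<^sup>2 \<le> 2 * (cmod a)\<^sup>2 + 2 * (cmod b)\<^sup>2"
proof -
  have "(cmod (a + b))\<^sup>2 \<le> (cmod a + cmod b)\<^sup>2" by (intro power_mono norm_triangle_ineq) simp
  also have "\<dots> \<le> 2 * (cmod a)\<^sup>2 + 2 * (cmod b)\<^sup>2"
    using zero_le_power2[of "cmod a - cmod b"] by (simp add: power2_eq_square algebra_simps)
  finally show ?thesis .
qed

lemma abs_mult_le_add_squares: "\<bar>a * b\<bar> \<le> a\<^sup>2 + (b :: real)\<^sup>2"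
proof -
  have "2 * (\<bar>a\<bar> * \<bar>b\<bar>) \<le> a\<^sup>2 + b\<^sup>2" using sum_squares_bound[of "\<bar>a\<bar>" "\<bar>b\<bar>"] by simp
  moreover have "0 \<le> \<bar>a\<bar> * \<bar>b\<bar>" by simp
  ultimately show ?thesis unfolding abs_mult by linarith
qed

lemma L2_add: "f \<in> L2 N \<Longrightarrow> g \<in> L2 N \<Longrightarrow> (\<lambda>x. f x + g x) \<in> L2 N"
proof (rule L2_I)
  assume fg: "f \<in> L2 N" "g \<in> L2 N"
  note [measurable] = fg[THEN L2_measurable]
  show "(\<lambda>x. f x + g x) \<in> borel_measurable N" by measurable
  show "integrable N (\<lambda>x. (cmod (f x + g x))\<^sup>2)"
    by (rule Bochner_Integration.integrable_bound[of _ "\<lambda>x. 2 * (cmod (f x))\<^sup>2 + 2 * (cmod (g x))\<^sup>2"])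
      (use fg[THEN L2_integrable] norm_add_square_le in auto)
qed

lemma L2_scale: "f \<in> L2 N \<Longrightarrow> (\<lambda>x. c * f x) \<in> L2 N"
  by (auto simp: L2_def norm_mult power_mult_distrib)

lemma L2_diff: "f \<in> L2 N \<Longrightarrow> g \<in> L2 N \<Longrightarrow> (\<lambda>x. f x - g x) \<in> L2 N"
  using L2_add[of f N "\<lambda>x. (-1) * g x"] L2_scale[of g N "-1"] by simp

lemma L2_norm_scale: "L2_norm N (\<lambda>x. c * f x) = cmod c * L2_norm N f"
  unfolding L2_norm_def by (simp add: norm_mult power_mult_distrib real_sqrt_mult)

lemma L2_norm_cong_AE:
  assumes "f \<in> borel_measurable N" "g \<in> borel_measurable N" "AE x in N. f x = g x"
  shows "L2_norm N f = L2_norm N g"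
  unfolding L2_norm_def
  by (rule arg_cong[where f = sqrt], rule integral_cong_AE) (use assms in auto)

lemma L2_norm_eq_0_AE:
  assumes "f \<in> L2 N" "L2_norm N f = 0"
  shows "AE x in N. f x = 0"
proof -
  have "(\<integral>x. (cmod (f x))\<^sup>2 \<partial>N) = 0" using assms(2) L2_norm_square[of N f] by simp
  then have "AE x in N. (cmod (f x))\<^sup>2 = 0"
    using integral_nonneg_eq_0_iff_AE[OF L2_integrable[OF assms(1)]] by simp
  then show ?thesis by simp
qed

lemma L2_norm_add_square_le:
  assumes "f \<in> L2 N" "g \<in> L2 N"
  shows "(L2_norm N (\<lambda>x. f x + g x))\<^sup>2 \<le> 2 * (L2_norm N f)\<^sup>2 + 2 * (L2_norm N g)\<^sup>2"
proof -
  have "(\<integral>x. (cmod (f x + g x))\<^sup>2 \<partial>N) \<le> (\<integral>x. 2 * (cmod (f x))\<^sup>2 + 2 * (cmod (g x))\<^sup>2 \<partial>N)"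
    using L2_integrable[OF L2_add[OF assms]] assms[THEN L2_integrable]
    by (intro integral_mono) (auto intro: norm_add_square_le)
  also have "\<dots> = 2 * (\<integral>x. (cmod (f x))\<^sup>2 \<partial>N) + 2 * (\<integral>x. (cmod (g x))\<^sup>2 \<partial>N)"
    using assms[THEN L2_integrable] by simp
  finally show ?thesis unfolding L2_norm_square .
qed

lemma L2_limit_unique_AE:
  assumes "f \<in> L2 N" "g \<in> L2 N" "\<And>n. s n \<in> L2 N"
    and "(\<lambda>n. L2_norm N (\<lambda>x. s n x - f x)) \<longlonglongrightarrow> 0" "(\<lambda>n. L2_norm N (\<lambda>x. s n x - g x)) \<longlonglongrightarrow> 0"
  shows "AE x in N. f x = g x"
proof -
  let ?d = "\<lambda>x. f x - g x"
  have bd: "(L2_norm N ?d)\<^sup>2 \<le> 2 * (L2_norm N (\<lambda>x. s n x - f x))\<^sup>2 + 2 * (L2_norm N (\<lambda>x. s n x - g x))\<^sup>2" for n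
  proof -
    have "?d = (\<lambda>x. (-1) * (s n x - f x) + (s n x - g x))" by auto
    then have "(L2_norm N ?d)\<^sup>2 \<le> 2 * (L2_norm N (\<lambda>x. (-1) * (s n x - f x)))\<^sup>2 + 2 * (L2_norm N (\<lambda>x. s n x - g x))\<^sup>2"
      using L2_norm_add_square_le[OF L2_scale[OF L2_diff[OF assms(3,1)], of "-1"] L2_diff[OF assms(3,2)]]
      by (simp only:)
    then show ?thesis unfolding L2_norm_scale by simp
  qed
  have "(\<lambda>n. 2 * (L2_norm N (\<lambda>x. s n x - f x))\<^sup>2 + 2 * (L2_norm N (\<lambda>x. s n x - g x))\<^sup>2) \<longlonglongrightarrow> 2 * 0\<^sup>2 + 2 * 0\<^sup>2"
    by (intro tendsto_intros assms)
  then have "(L2_norm N ?d)\<^sup>2 \<le> 2 * 0\<^sup>2 + 2 * 0\<^sup>2"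
    using bd by (intro tendsto_lowerbound) auto
  then have "L2_norm N ?d = 0" by simp
  then show ?thesis using L2_norm_eq_0_AE[OF L2_diff[OF assms(1,2)]] by simp
qed

text \<open>
  The Cauchy-Schwarz inequality for the splitting \<open>a k = sqrt (r ^ k) * (a k / sqrt (r ^ k))\<close>.
\<close>

lemma weighted_Cauchy_Schwarz:
  fixes a :: "nat \<Rightarrow> real"
  assumes r: "0 < r" "r < 1" and W: "summable (\<lambda>k. (a k)\<^sup>2 / r ^ k)" and a: "\<And>k. 0 \<le> a k"
  shows "summable a" "(\<Sum>k. a k)\<^sup>2 \<le> (\<Sum>k. (a k)\<^sup>2 / r ^ k) / (1 - r)"
proof -
  let ?W = "\<Sum>k. (a k)\<^sup>2 / r ^ k"
  have geo: "summable (\<lambda>k. r ^ k)" "(\<Sum>k. r ^ k) = 1 / (1 - r)" using r by (auto simp: suminf_geometric)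
  have fin: "(\<Sum>k<n. a k)\<^sup>2 \<le> ?W / (1 - r)" for n
  proof -
    have "(\<Sum>k<n. a k) = (\<Sum>k<n. sqrt (r ^ k) * (a k / sqrt (r ^ k)))"
      using r by (intro sum.cong) auto
    then have "(\<Sum>k<n. a k)\<^sup>2 \<le> (\<Sum>k<n. (sqrt (r ^ k))\<^sup>2) * (\<Sum>k<n. (a k / sqrt (r ^ k))\<^sup>2)"
      by (simp only: Cauchy_Schwarz_ineq_sum)
    also have "\<dots> = (\<Sum>k<n. r ^ k) * (\<Sum>k<n. (a k)\<^sup>2 / r ^ k)"
      using r by (simp add: power_divide)
    also have "\<dots> \<le> (\<Sum>k. r ^ k) * ?W"
      using r geo W by (intro mult_mono sum_le_suminf sum_nonneg suminf_nonneg) auto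
    finally show ?thesis using geo by simp
  qed
  have W0: "0 \<le> ?W / (1 - r)" using order_trans[OF zero_le_power2 fin[of 0]] .
  have bd: "(\<Sum>k<n. a k) \<le> sqrt (?W / (1 - r))" for n
    using real_le_rsqrt[OF fin] .
  show s: "summable a"
  proof (rule bounded_imp_summable[of a "sqrt (?W / (1 - r))"])
    show "(\<Sum>k\<le>n. a k) \<le> sqrt (?W / (1 - r))" for n
      using bd[of "Suc n"] by (simp add: lessThan_Suc_atMost)
  qed (rule a)
  have "(\<Sum>k. a k) \<le> sqrt (?W / (1 - r))"
    using s bd by (intro suminf_le_const)
  then have "(\<Sum>k. a k)\<^sup>2 \<le> (sqrt (?W / (1 - r)))\<^sup>2"
    using suminf_nonneg[OF s a] by (intro power_mono)
  then show "(\<Sum>k. a k)\<^sup>2 \<le> ?W / (1 - r)" using W0 by simp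
qed

text \<open>
  The value 0 is used where the series does not converge absolutely. In the applications this is a null set.
\<close>

definition pointwise_sum :: "(nat \<Rightarrow> 'a \<Rightarrow> complex) \<Rightarrow> 'a \<Rightarrow> complex" where
  "pointwise_sum g x = (if summable (\<lambda>k. cmod (g k x)) then \<Sum>k. g k x else 0)"

text \<open>
  A series in \<open>L\<^sup>2\<close> whose norms decay geometrically converges almost everywhere and in norm. It
  provides the sum of the Neumann series. By \<open>weighted_Cauchy_Schwarz\<close>, the square of the tail is at
  most a constant times the series \<open>W\<close> of nonnegative functions, which can be integrated term by term.
\<close>

lemma L2_geometric_series:
  fixes g :: "nat \<Rightarrow> 'a \<Rightarrow> complex"
  assumes g: "\<And>k. g k \<in> L2 N" and r: "0 < r" "r < 1"
    and B: "\<And>k. (L2_norm N (g k))\<^sup>2 \<le> B * r ^ (2 * k)"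
  shows "AE x in N. summable (\<lambda>k. cmod (g k x))"
    and "(\<lambda>x. pointwise_sum g x - (\<Sum>k<n. g k x)) \<in> L2 N"
    and "(L2_norm N (\<lambda>x. pointwise_sum g x - (\<Sum>k<n. g k x)))\<^sup>2 \<le> B * r ^ (2 * n) / (1 - r)\<^sup>2"
proof -
  note [measurable] = g[THEN L2_measurable]
  have B0: "0 \<le> B" using order_trans[OF zero_le_power2 B[of 0]] by simp
  have geo: "(\<lambda>k. r ^ k) sums (1 / (1 - r))" using r by (intro geometric_sums) auto
  define W where "W n x = (\<Sum>k. ennreal ((cmod (g (k + n) x))\<^sup>2 / r ^ k))" for n x
  have Wm[measurable]: "W n \<in> borel_measurable N" for n unfolding W_def by measurable
  have Wint: "(\<integral>\<^sup>+x. W n x \<partial>N) \<le> ennreal (B * r ^ (2 * n) / (1 - r))" for n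
  proof -
    have "(\<integral>\<^sup>+x. W n x \<partial>N) = (\<Sum>k. \<integral>\<^sup>+x. ennreal ((cmod (g (k + n) x))\<^sup>2 / r ^ k) \<partial>N)"
      unfolding W_def by (rule nn_integral_suminf) measurable
    also have "\<dots> \<le> (\<Sum>k. ennreal (B * r ^ (2 * n) * r ^ k))"
    proof (intro suminf_le summableI)
      fix k
      have "(\<integral>\<^sup>+x. ennreal ((cmod (g (k + n) x))\<^sup>2 / r ^ k) \<partial>N) = ennreal (\<integral>x. (cmod (g (k + n) x))\<^sup>2 / r ^ k \<partial>N)"
        using L2_integrable[OF g] r by (intro nn_integral_eq_integral) auto
      also have "\<dots> = ennreal ((L2_norm N (g (k + n)))\<^sup>2 / r ^ k)" by (simp add: L2_norm_square)
      also have "\<dots> \<le> ennreal (B * r ^ (2 * (k + n)) / r ^ k)"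
        using B[of "k + n"] r by (intro ennreal_leI divide_right_mono) auto
      also have "B * r ^ (2 * (k + n)) / r ^ k = B * r ^ (2 * n) * r ^ k"
      proof -
        have "r ^ (2 * (k + n)) = r ^ (2 * n) * r ^ k * r ^ k"
          unfolding power_add[symmetric] by (simp add: algebra_simps)
        then show ?thesis using r by simp
      qed
      finally show "(\<integral>\<^sup>+x. ennreal ((cmod (g (k + n) x))\<^sup>2 / r ^ k) \<partial>N) \<le> ennreal (B * r ^ (2 * n) * r ^ k)" .
    qed
    also have "\<dots> = ennreal (B * r ^ (2 * n) * (1 / (1 - r)))"
      using sums_mult[OF geo, of "B * r ^ (2 * n)"] B0 r
      by (intro suminf_ennreal_eq) auto
    finally show ?thesis by simp
  qed
  have Wfin: "AE x in N. W n x \<noteq> \<infinity>" for n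
    using Wint[of n] by (intro nn_integral_PInf_AE) (auto simp: top_unique)
  have tail: "summable (\<lambda>k. cmod (g k x)) \<and>
      ennreal ((cmod (pointwise_sum g x - (\<Sum>k<n. g k x)))\<^sup>2) \<le> W n x * ennreal (1 / (1 - r))"
    if "W n x \<noteq> \<infinity>" for n x
  proof -
    have s: "summable (\<lambda>k. (cmod (g (k + n) x))\<^sup>2 / r ^ k)"
      using that r unfolding W_def by (intro summable_suminf_not_top) auto
    note cs = weighted_Cauchy_Schwarz[OF r s]
    have s': "summable (\<lambda>k. cmod (g k x))" using cs(1) summable_iff_shift[of "\<lambda>k. cmod (g k x)" n] by simp
    have sg: "summable (\<lambda>k. g k x)" using summable_norm_cancel[OF s'] .
    have "pointwise_sum g x - (\<Sum>k<n. g k x) = (\<Sum>k. g (k + n) x)"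
      using s' suminf_minus_initial_segment[OF sg, of n] unfolding pointwise_sum_def by simp
    then have "cmod (pointwise_sum g x - (\<Sum>k<n. g k x)) \<le> (\<Sum>k. cmod (g (k + n) x))"
      using cs(1) by (simp add: summable_norm)
    then have "(cmod (pointwise_sum g x - (\<Sum>k<n. g k x)))\<^sup>2 \<le> (\<Sum>k. (cmod (g (k + n) x))\<^sup>2 / r ^ k) / (1 - r)"
      using cs(2) by (meson norm_ge_zero order_trans power_mono)
    then have "ennreal ((cmod (pointwise_sum g x - (\<Sum>k<n. g k x)))\<^sup>2) \<le> ennreal ((\<Sum>k. (cmod (g (k + n) x))\<^sup>2 / r ^ k) * (1 / (1 - r)))"
      by (intro ennreal_leI) simp
    also have "\<dots> = ennreal (\<Sum>k. (cmod (g (k + n) x))\<^sup>2 / r ^ k) * ennreal (1 / (1 - r))"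
      using r s by (intro ennreal_mult suminf_nonneg) auto
    also have "ennreal (\<Sum>k. (cmod (g (k + n) x))\<^sup>2 / r ^ k) = W n x"
      unfolding W_def using s r by (intro suminf_ennreal2[symmetric]) auto
    finally show ?thesis using s' by simp
  qed
  show "AE x in N. summable (\<lambda>k. cmod (g k x))" using Wfin[of 0] tail by (auto elim: eventually_mono)
  have "summable (\<lambda>k. cmod (g k x)) \<longleftrightarrow> (\<Sum>k. ennreal (cmod (g k x))) \<noteq> \<infinity>" for x
    by (auto simp: suminf_ennreal2 intro: summable_suminf_not_top)
  then have sm[measurable]: "pointwise_sum g \<in> borel_measurable N"
    unfolding pointwise_sum_def[abs_def] by simp
  let ?h = "\<lambda>x. pointwise_sum g x - (\<Sum>k<n. g k x)"
  have "(\<integral>\<^sup>+x. ennreal ((cmod (?h x))\<^sup>2) \<partial>N) \<le> (\<integral>\<^sup>+x. W n x * ennreal (1 / (1 - r)) \<partial>N)"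
    using Wfin[of n] tail[of n] by (intro nn_integral_mono_AE) (auto elim: eventually_mono)
  also have "\<dots> = (\<integral>\<^sup>+x. W n x \<partial>N) * ennreal (1 / (1 - r))" by (rule nn_integral_multc) measurable
  also have "\<dots> \<le> ennreal (B * r ^ (2 * n) / (1 - r)) * ennreal (1 / (1 - r))"
    using Wint by (intro mult_right_mono) auto
  also have "\<dots> = ennreal (B * r ^ (2 * n) / (1 - r)\<^sup>2)"
    using r B0 by (subst ennreal_mult[symmetric]) (auto simp: power2_eq_square)
  finally have le: "(\<integral>\<^sup>+x. ennreal ((cmod (?h x))\<^sup>2) \<partial>N) \<le> ennreal (B * r ^ (2 * n) / (1 - r)\<^sup>2)" .
  have int: "integrable N (\<lambda>x. (cmod (?h x))\<^sup>2)"
    using le by (intro integrableI_nonneg) (auto simp: less_top[symmetric] top_unique)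
  then show "?h \<in> L2 N" by (intro L2_I) measurable
  have "ennreal (\<integral>x. (cmod (?h x))\<^sup>2 \<partial>N) \<le> ennreal (B * r ^ (2 * n) / (1 - r)\<^sup>2)"
    using le nn_integral_eq_integral[OF int] by simp
  then show "(L2_norm N ?h)\<^sup>2 \<le> B * r ^ (2 * n) / (1 - r)\<^sup>2"
    unfolding L2_norm_square using B0 r by (subst (asm) ennreal_le_iff) auto
qed

lemma tendsto_zero_bound:
  fixes a b :: "nat \<Rightarrow> real"
  assumes "\<And>n. 0 \<le> a n" "\<And>n. a n \<le> b n" "b \<longlonglongrightarrow> 0"
  shows "a \<longlonglongrightarrow> 0"
  by (rule tendsto_sandwich[OF _ _ tendsto_const assms(3)]) (use assms(1,2) in auto)

text \<open>
  A linear operator on a closed subspace \<open>H\<close> of \<open>L\<^sup>2(N)\<close>, given on representatives. Linearity is required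
  pointwise, as holds for averaging operators; that the operator respects almost everywhere equality follows
  once it is bounded.
\<close>

locale L2_operator =
  fixes N :: "'a measure" and H :: "('a \<Rightarrow> complex) set" and T :: "('a \<Rightarrow> complex) \<Rightarrow> ('a \<Rightarrow> complex)"
  assumes H_L2: "H \<subseteq> L2 N"
    and H_add: "\<And>f g. f \<in> H \<Longrightarrow> g \<in> H \<Longrightarrow> (\<lambda>x. f x + g x) \<in> H"
    and H_scale: "\<And>c f. f \<in> H \<Longrightarrow> (\<lambda>x. c * f x) \<in> H"
    and H_zero: "(\<lambda>x. 0) \<in> H"
    and H_closed: "\<And>s f. (\<And>n. s n \<in> H) \<Longrightarrow> f \<in> L2 N \<Longrightarrow>
      (\<lambda>n. L2_norm N (\<lambda>x. s n x - f x)) \<longlonglongrightarrow> 0 \<Longrightarrow> f \<in> H"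
    and T_H: "\<And>f. f \<in> H \<Longrightarrow> T f \<in> H"
    and T_add: "\<And>f g. T (\<lambda>x. f x + g x) = (\<lambda>x. T f x + T g x)"
    and T_scale: "\<And>c f. T (\<lambda>x. c * f x) = (\<lambda>x. c * T f x)"
begin

lemma H_measurable: "f \<in> H \<Longrightarrow> f \<in> borel_measurable N"
  using H_L2 L2_measurable by blast

lemma H_diff: "f \<in> H \<Longrightarrow> g \<in> H \<Longrightarrow> (\<lambda>x. f x - g x) \<in> H"
  using H_add[of f "\<lambda>x. (-1) * g x"] H_scale[of g "-1"] by simp

lemma T_diff: "T (\<lambda>x. f x - g x) = (\<lambda>x. T f x - T g x)"
  using T_add[of f "\<lambda>x. (-1) * g x"] T_scale[of "-1" g] by simp

lemma T_zero: "T (\<lambda>x. 0) = (\<lambda>x. 0)"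
  using T_scale[of 0 "\<lambda>x. 0"] by simp

lemma H_sum: "(\<And>k. k \<in> I \<Longrightarrow> g k \<in> H) \<Longrightarrow> (\<lambda>x. \<Sum>k\<in>I. g k x) \<in> H"
  by (induction I rule: infinite_finite_induct) (auto intro: H_zero H_add)

lemma T_sum: "T (\<lambda>x. \<Sum>k\<in>I. g k x) = (\<lambda>x. \<Sum>k\<in>I. T (g k) x)"
  by (induction I rule: infinite_finite_induct) (auto simp: T_zero T_add)

lemma Tn_H: "f \<in> H \<Longrightarrow> (T ^^ k) f \<in> H"
  by (induction k) (auto intro: T_H)

lemma Tn_add: "(T ^^ k) (\<lambda>x. f x + g x) = (\<lambda>x. (T ^^ k) f x + (T ^^ k) g x)"
  by (induction k) (auto simp: T_add)

lemma Tn_scale: "(T ^^ k) (\<lambda>x. c * f x) = (\<lambda>x. c * (T ^^ k) f x)"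
  by (induction k) (auto simp: T_scale)

lemma Tn_bound:
  assumes "0 \<le> c" "\<And>f. f \<in> H \<Longrightarrow> L2_norm N (T f) \<le> c * L2_norm N f" "f \<in> H"
  shows "L2_norm N ((T ^^ k) f) \<le> c ^ k * L2_norm N f"
proof (induction k)
  case (Suc k)
  have "L2_norm N ((T ^^ Suc k) f) \<le> c * L2_norm N ((T ^^ k) f)" using assms(2)[OF Tn_H[OF assms(3)]] by simp
  also have "\<dots> \<le> c * (c ^ k * L2_norm N f)" using Suc assms(1) by (rule mult_left_mono)
  finally show ?case by simp
qed simp

lemma T_cong_AE:
  assumes "\<And>f. f \<in> H \<Longrightarrow> L2_norm N (T f) \<le> c * L2_norm N f"
    and "f \<in> H" "g \<in> H" "AE x in N. f x = g x"
  shows "AE x in N. T f x = T g x"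
proof -
  let ?d = "\<lambda>x. f x - g x"
  have d: "?d \<in> H" using H_diff assms by blast
  have "L2_norm N ?d = L2_norm N (\<lambda>x. 0)"
    using assms by (intro L2_norm_cong_AE H_measurable d H_zero) auto
  then have "L2_norm N ?d = 0" by (simp add: L2_norm_def)
  then have "L2_norm N (T ?d) = 0" using assms(1)[OF d] L2_norm_nonneg[of N "T ?d"] by simp
  then have "AE x in N. T ?d x = 0" using L2_norm_eq_0_AE T_H[OF d] H_L2 by blast
  then show ?thesis by (simp add: T_diff)
qed

definition resolvent_term :: "complex \<Rightarrow> ('a \<Rightarrow> complex) \<Rightarrow> nat \<Rightarrow> 'a \<Rightarrow> complex" where
  "resolvent_term z f k x = (T ^^ k) f x / z ^ (k + 1)"

text \<open>
  The spectrum is bounded by the operator norm: for larger \<open>z\<close> the Neumann series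
  \<open>S f = (\<Sum>k. T\<^sup>k f / z\<^bsup>k+1\<^esup>)\<close> is an inverse of \<open>z I - T\<close>.
\<close>

theorem not_in_spectrum:
  assumes c: "0 \<le> c" "c < cmod z" and bd: "\<And>f. f \<in> H \<Longrightarrow> L2_norm N (T f) \<le> c * L2_norm N f"
  shows "z \<notin> op_spectrum N H T"
proof -
  have z: "cmod z > 0" "z \<noteq> 0" using c by auto
  \<comment> \<open>The ratio of the geometric bound must be positive even if \<open>c = 0\<close>.\<close>
  obtain r where r: "0 < r" "r < 1" "c / cmod z \<le> r"
  proof (rule that[of "max (1/2) (c / cmod z)"])
    show "max (1/2) (c / cmod z) < 1" using c z by (simp add: divide_less_eq)
  qed auto
  define g where "g = resolvent_term z"
  define S where "S f = pointwise_sum (g f)" for f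
  have gH: "g f k \<in> H" if "f \<in> H" for f k
  proof -
    have "g f k = (\<lambda>x. (1 / z ^ (k + 1)) * (T ^^ k) f x)" unfolding g_def resolvent_term_def by auto
    then show ?thesis using H_scale[OF Tn_H[OF that], of "1 / z ^ (k + 1)"] by (simp only:)
  qed
  have gL2: "g f k \<in> L2 N" if "f \<in> H" for f k using gH that H_L2 by blast
  have gB: "(L2_norm N (g f k))\<^sup>2 \<le> (L2_norm N f / cmod z)\<^sup>2 * r ^ (2 * k)" if f: "f \<in> H" for f k
  proof -
    have "g f k = (\<lambda>x. (1 / z ^ (k + 1)) * (T ^^ k) f x)" unfolding g_def resolvent_term_def by auto
    then have "L2_norm N (g f k) = L2_norm N ((T ^^ k) f) / cmod z ^ (k + 1)"
      by (simp only: L2_norm_scale) (simp add: norm_divide norm_power norm_mult)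
    also have "\<dots> \<le> c ^ k * L2_norm N f / cmod z ^ (k + 1)"
      using Tn_bound[OF c(1) bd f] z by (intro divide_right_mono) auto
    also have "\<dots> = L2_norm N f / cmod z * (c / cmod z) ^ k" by (simp add: power_divide)
    also have "\<dots> \<le> L2_norm N f / cmod z * r ^ k"
      using r c z L2_norm_nonneg[of N f] by (intro mult_left_mono power_mono) auto
    finally have "(L2_norm N (g f k))\<^sup>2 \<le> (L2_norm N f / cmod z * r ^ k)\<^sup>2"
      using L2_norm_nonneg by (intro power_mono)
    then show ?thesis by (simp only: power_mult_distrib power_even_eq)
  qed
  have series: "AE x in N. summable (\<lambda>k. cmod (g f k x))"
    "\<And>n. (\<lambda>x. S f x - (\<Sum>k<n. g f k x)) \<in> L2 N"
    "\<And>n. (L2_norm N (\<lambda>x. S f x - (\<Sum>k<n. g f k x)))\<^sup>2 \<le> (L2_norm N f / cmod z)\<^sup>2 * r ^ (2 * n) / (1 - r)\<^sup>2"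
    if f: "f \<in> H" for f
    using L2_geometric_series[of "g f" N r "(L2_norm N f / cmod z)\<^sup>2", OF gL2[OF f] r(1,2) gB[OF f]]
    unfolding S_def by blast+
  have S_L2: "S f \<in> L2 N" if "f \<in> H" for f
    using series(2)[OF that, of 0] by simp
  have tends: "(\<lambda>n. L2_norm N (\<lambda>x. (\<Sum>k<n. g f k x) - S f x)) \<longlonglongrightarrow> 0" if f: "f \<in> H" for f
  proof -
    let ?B = "(L2_norm N f / cmod z)\<^sup>2"
    have "L2_norm N (\<lambda>x. (\<Sum>k<n. g f k x) - S f x) \<le> sqrt (?B / (1 - r)\<^sup>2) * r ^ n" for n
    proof -
      have "L2_norm N (\<lambda>x. (\<Sum>k<n. g f k x) - S f x) = L2_norm N (\<lambda>x. S f x - (\<Sum>k<n. g f k x))"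
        unfolding L2_norm_def by (simp add: norm_minus_commute)
      also have "\<dots> \<le> sqrt (?B * r ^ (2 * n) / (1 - r)\<^sup>2)"
        using series(3)[OF f] by (rule real_le_rsqrt)
      also have "\<dots> = sqrt (?B / (1 - r)\<^sup>2 * (r ^ n)\<^sup>2)" by (simp add: power_even_eq)
      also have "\<dots> = sqrt (?B / (1 - r)\<^sup>2) * r ^ n"
        unfolding real_sqrt_mult using r by (simp only: real_sqrt_abs) simp
      finally show ?thesis .
    qed
    moreover have "(\<lambda>n. sqrt (?B / (1 - r)\<^sup>2) * r ^ n) \<longlonglongrightarrow> sqrt (?B / (1 - r)\<^sup>2) * 0"
      using r by (intro tendsto_intros LIMSEQ_power_zero) auto
    ultimately show ?thesis
      unfolding mult_zero_right by (rule tendsto_zero_bound[OF L2_norm_nonneg])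
  qed
  have S_H: "S f \<in> H" if f: "f \<in> H" for f
    using f by (intro H_closed[OF _ S_L2 tends] H_sum gH)
  have S_add: "AE x in N. S (\<lambda>y. f y + h y) x = S f x + S h x" if "f \<in> H" "h \<in> H" for f h
    using series(1)[OF that(1)] series(1)[OF that(2)]
  proof eventually_elim
    case (elim x)
    have e: "g (\<lambda>y. f y + h y) k x = g f k x + g h k x" for k
      unfolding g_def resolvent_term_def by (simp add: Tn_add add_divide_distrib)
    have "summable (\<lambda>k. cmod (g f k x + g h k x))"
      by (rule summable_comparison_test'[OF summable_add[OF elim], of 0]) (simp add: norm_triangle_ineq)
    then show ?case
      using elim[THEN summable_norm_cancel] elim unfolding S_def pointwise_sum_def e by (simp add: suminf_add)
  qed
  have S_scale: "AE x in N. S (\<lambda>y. a * f y) x = a * S f x" if "f \<in> H" for a f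
    using series(1)[OF that]
  proof eventually_elim
    case (elim x)
    have e: "g (\<lambda>y. a * f y) k x = a * g f k x" for k
      unfolding g_def resolvent_term_def by (simp add: Tn_scale)
    have "summable (\<lambda>k. cmod (a * g f k x))"
      unfolding norm_mult by (rule summable_mult[OF elim])
    then show ?case
      using elim[THEN summable_norm_cancel] elim unfolding S_def pointwise_sum_def e by (simp add: suminf_mult)
  qed
  have S_cong: "AE x in N. S f x = S h x" if fh: "f \<in> H" "h \<in> H" "AE x in N. f x = h x" for f h
  proof -
    have "AE x in N. (T ^^ k) f x = (T ^^ k) h x" for k
    proof (induction k)
      case (Suc k)
      show ?case using T_cong_AE[OF bd Tn_H[OF fh(1)] Tn_H[OF fh(2)] Suc] by simp
    qed (use fh(3) in simp)
    then have "AE x in N. \<forall>k. (T ^^ k) f x = (T ^^ k) h x" by (simp add: AE_all_countable)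
    then show ?thesis
      by eventually_elim (simp add: S_def pointwise_sum_def g_def resolvent_term_def)
  qed
  have S_bound: "L2_norm N (S f) \<le> (1 / (cmod z * (1 - r))) * L2_norm N f" if f: "f \<in> H" for f
  proof -
    have "(L2_norm N (S f))\<^sup>2 \<le> ((1 / (cmod z * (1 - r))) * L2_norm N f)\<^sup>2"
      using series(3)[OF f, of 0] by (simp add: power_divide power_mult_distrib)
    then show ?thesis
      by (rule power2_le_imp_le) (use r z L2_norm_nonneg[of N f] in auto)
  qed
  have tele: "AE x in N. z * S f x - S (T f) x = f x" if f: "f \<in> H" for f
    using series(1)[OF f]
  proof eventually_elim
    case (elim x)
    have e: "g (T f) k x = z * g f (k + 1) x" for k
      unfolding g_def resolvent_term_def using z by (simp add: funpow_swap1)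
    have s1: "summable (\<lambda>k. cmod (g f (k + 1) x))" using elim by (subst summable_iff_shift)
    then have "summable (\<lambda>k. cmod (z * g f (k + 1) x))"
      unfolding norm_mult by (rule summable_mult)
    then have "S (T f) x = z * (\<Sum>k. g f (k + 1) x)"
      unfolding S_def pointwise_sum_def e using suminf_mult[OF summable_norm_cancel[OF s1]] by simp
    also have "\<dots> = z * ((\<Sum>k. g f k x) - g f 0 x)"
      using suminf_split_head[OF summable_norm_cancel[OF elim]] by simp
    also have "\<dots> = z * S f x - f x"
      using elim z unfolding S_def pointwise_sum_def by (simp add: right_diff_distrib g_def resolvent_term_def)
    finally show ?case by simp
  qed
  \<comment> \<open>The operator need not respect pointwise limits, so this is deduced from convergence in norm.\<close>
  have comm: "AE x in N. T (S f) x = S (T f) x" if f: "f \<in> H" for f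
  proof (rule L2_limit_unique_AE)
    show "T (S f) \<in> L2 N" "S (T f) \<in> L2 N" using S_H T_H f H_L2 by blast+
    show "(\<lambda>x. \<Sum>k<n. g (T f) k x) \<in> L2 N" for n
      by (rule subsetD[OF H_L2 H_sum[OF gH[OF T_H[OF f]]]])
    show "(\<lambda>n. L2_norm N (\<lambda>x. (\<Sum>k<n. g (T f) k x) - S (T f) x)) \<longlonglongrightarrow> 0"
      by (rule tends[OF T_H[OF f]])
    have Tg: "T (g f k) = g (T f) k" for k
    proof -
      have "g f k = (\<lambda>x. (1 / z ^ (k + 1)) * (T ^^ k) f x)" unfolding g_def resolvent_term_def by auto
      then have "T (g f k) = (\<lambda>x. (1 / z ^ (k + 1)) * T ((T ^^ k) f) x)" by (simp only: T_scale)
      then show ?thesis unfolding g_def resolvent_term_def by (auto simp: funpow_swap1)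
    qed
    have "L2_norm N (\<lambda>x. (\<Sum>k<n. g (T f) k x) - T (S f) x) \<le> c * L2_norm N (\<lambda>x. (\<Sum>k<n. g f k x) - S f x)" for n
    proof -
      have "(\<lambda>x. (\<Sum>k<n. g (T f) k x) - T (S f) x) = T (\<lambda>x. (\<Sum>k<n. g f k x) - S f x)"
        unfolding T_diff T_sum Tg ..
      then show ?thesis using bd[OF H_diff[OF H_sum[OF gH[OF f]] S_H[OF f]]] by simp
    qed
    moreover have "(\<lambda>n. c * L2_norm N (\<lambda>x. (\<Sum>k<n. g f k x) - S f x)) \<longlonglongrightarrow> c * 0"
      by (intro tendsto_intros tends f)
    ultimately show "(\<lambda>n. L2_norm N (\<lambda>x. (\<Sum>k<n. g (T f) k x) - T (S f) x)) \<longlonglongrightarrow> 0"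
      unfolding mult_zero_right by (rule tendsto_zero_bound[OF L2_norm_nonneg])
  qed
  have "bounded_operator N H S"
    unfolding bounded_operator_def
    using S_H S_cong S_add S_scale S_bound by blast
  moreover have "AE x in N. z * S f x - T (S f) x = f x" if "f \<in> H" for f
    using tele[OF that] comm[OF that] by eventually_elim simp
  moreover have "AE x in N. S (\<lambda>y. z * f y - T f y) x = f x" if f: "f \<in> H" for f
  proof -
    have "AE x in N. S (\<lambda>y. z * f y + (-1) * T f y) x = S (\<lambda>y. z * f y) x + S (\<lambda>y. (-1) * T f y) x"
      by (rule S_add[OF H_scale[OF f, of z] H_scale[OF T_H[OF f], of "-1"]])
    then show ?thesis
      using S_scale[OF f, of z] S_scale[OF T_H[OF f], of "-1"] tele[OF f] by eventually_elim simp
  qed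
  ultimately show ?thesis unfolding op_spectrum_def by blast
qed

text \<open>
  Off the spectrum the operator \<open>z I - T\<close> is bounded below, by the reciprocal of the norm of its inverse.
\<close>

lemma resolvent_bounded_below:
  assumes "z \<notin> op_spectrum N H T"
  obtains K where "\<And>f. f \<in> H \<Longrightarrow> L2_norm N f \<le> K * L2_norm N (\<lambda>x. z * f x - T f x)"
proof -
  obtain S where S: "bounded_operator N H S"
    "\<forall>f\<in>H. (AE x in N. S (\<lambda>y. z * f y - T f y) x = f x) \<and> (AE x in N. z * S f x - T (S f) x = f x)"
    using assms unfolding op_spectrum_def by blast
  have SH: "\<And>f. f \<in> H \<Longrightarrow> S f \<in> H" using S(1) unfolding bounded_operator_def by (elim conjE) blast
  obtain K where K: "\<forall>f\<in>H. L2_norm N (S f) \<le> K * L2_norm N f"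
    using S(1) unfolding bounded_operator_def by (elim conjE exE)
  have "L2_norm N f \<le> K * L2_norm N (\<lambda>x. z * f x - T f x)" if f: "f \<in> H" for f
  proof -
    let ?w = "\<lambda>x. z * f x - T f x"
    have w: "?w \<in> H" using f by (intro H_diff H_scale T_H)
    have "L2_norm N f = L2_norm N (S ?w)"
      using S(2) f by (intro L2_norm_cong_AE H_measurable f SH w) auto
    then show ?thesis using K w by simp
  qed
  then show ?thesis using that by blast
qed

text \<open>
  The norm \<open>c\<close> of a symmetric operator, or its negative, is a spectral value. Let \<open>s = c\<^sup>2\<close> be the best constant
  in \<open>\<parallel>T f\<parallel>\<^sup>2 \<le> s \<parallel>f\<parallel>\<^sup>2\<close>. Symmetry gives \<open>\<parallel>T\<^sup>2 f - s f\<parallel>\<^sup>2 \<le> s\<^sup>2 \<parallel>f\<parallel>\<^sup>2 - s \<parallel>T f\<parallel>\<^sup>2\<close>. If neither \<open>c\<close> nor \<open>-c\<close> were in the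
  spectrum, then \<open>T\<^sup>2 - s I = (T - c I) (T + c I)\<close> would be bounded below, and this inequality would improve
  the constant \<open>s\<close>. The hypothesis on \<open>f\<^sub>0\<close> excludes the zero space, whose spectrum is empty.
\<close>

theorem selfadjoint_norm_attained:
  assumes bd: "\<And>f. f \<in> H \<Longrightarrow> L2_norm N (T f) \<le> B * L2_norm N f"
    and sa: "\<And>f. f \<in> H \<Longrightarrow> (\<integral>x. Re (T (T f) x * cnj (f x)) \<partial>N) = (L2_norm N (T f))\<^sup>2"
    and nontrivial: "f\<^sub>0 \<in> H" "L2_norm N f\<^sub>0 \<noteq> 0"
  shows "\<exists>z\<in>op_spectrum N H T. \<forall>f\<in>H. L2_norm N (T f) \<le> cmod z * L2_norm N f"
proof -
  define n where "n f = (L2_norm N f)\<^sup>2" for f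
  have n0: "0 \<le> n f" for f unfolding n_def by simp
  define I where "I = {s. 0 \<le> s \<and> (\<forall>f\<in>H. n (T f) \<le> s * n f)}"
  have "B\<^sup>2 \<in> I"
  proof -
    have "n (T f) \<le> B\<^sup>2 * n f" if "f \<in> H" for f
      unfolding n_def power_mult_distrib[symmetric]
      using bd[OF that] L2_norm_nonneg by (intro power_mono)
    then show ?thesis unfolding I_def by simp
  qed
  then have ne: "I \<noteq> {}" by blast
  have bb: "bdd_below I" unfolding I_def by (intro bdd_belowI[of _ 0]) auto
  define s where "s = Inf I"
  have s0: "0 \<le> s" unfolding s_def using ne by (intro cInf_greatest) (auto simp: I_def)
  have sT: "n (T f) \<le> s * n f" if f: "f \<in> H" for f
  proof (cases "n f = 0")
    case True
    then show ?thesis using \<open>B\<^sup>2 \<in> I\<close> f unfolding I_def by auto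
  next
    case False
    then have "n f > 0" using n0[of f] by simp
    then have "n (T f) / n f \<le> s"
      unfolding s_def using ne f by (intro cInf_greatest) (auto simp: I_def divide_le_eq)
    then show ?thesis using \<open>n f > 0\<close> by (simp add: divide_le_eq)
  qed
  define c where "c = sqrt s"
  have c: "0 \<le> c" "c\<^sup>2 = s" unfolding c_def using s0 by auto
  have "complex_of_real c \<in> op_spectrum N H T \<or> - complex_of_real c \<in> op_spectrum N H T"
  proof (rule ccontr)
    assume "\<not> ?thesis"
    then obtain K1 K2 where K: "\<And>f. f \<in> H \<Longrightarrow> L2_norm N f \<le> K1 * L2_norm N (\<lambda>x. complex_of_real c * f x - T f x)"
      "\<And>f. f \<in> H \<Longrightarrow> L2_norm N f \<le> K2 * L2_norm N (\<lambda>x. - complex_of_real c * f x - T f x)"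
      using resolvent_bounded_below by metis
    define C where "C = K2\<^sup>2 * K1\<^sup>2"
    have key: "n f \<le> C * (s\<^sup>2 * n f - s * n (T f))" if f: "f \<in> H" for f
    proof -
      let ?w = "\<lambda>x. - complex_of_real c * f x - T f x"
      let ?v = "\<lambda>x. complex_of_real c * ?w x - T ?w x"
      \<comment> \<open>\<open>?v\<close> is \<open>T\<^sup>2 f - s f\<close>, written as a product of the two factors that are bounded below.\<close>
      have w: "?w \<in> H" using f by (intro H_diff H_scale T_H)
      have n1: "n f \<le> K2\<^sup>2 * n ?w"
        unfolding n_def power_mult_distrib[symmetric] using K(2)[OF f] L2_norm_nonneg by (intro power_mono)
      have n2: "n ?w \<le> K1\<^sup>2 * n ?v"
        unfolding n_def power_mult_distrib[symmetric] using K(1)[OF w] L2_norm_nonneg by (intro power_mono)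
      have v: "?v x = T (T f) x - complex_of_real s * f x" for x
      proof -
        have "T ?w x = - complex_of_real c * T f x - T (T f) x" unfolding T_diff T_scale ..
        then show ?thesis by (simp add: c(2)[symmetric] power2_eq_square algebra_simps)
      qed
      have Tf: "T f \<in> L2 N" "T (T f) \<in> L2 N" "f \<in> L2 N" using f T_H H_L2 by blast+
      note [measurable] = Tf[THEN L2_measurable]
      have sq: "(cmod (a - complex_of_real s * b))\<^sup>2 = (cmod a)\<^sup>2 - 2 * s * Re (a * cnj b) + s\<^sup>2 * (cmod b)\<^sup>2" for a b
        unfolding cmod_power2 by (simp add: power2_eq_square algebra_simps)
      have ip: "integrable N (\<lambda>x. Re (T (T f) x * cnj (f x)))"
      proof (rule Bochner_Integration.integrable_bound[of _ "\<lambda>x. (cmod (T (T f) x))\<^sup>2 + (cmod (f x))\<^sup>2"])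
        show "AE x in N. norm (Re (T (T f) x * cnj (f x))) \<le> norm ((cmod (T (T f) x))\<^sup>2 + (cmod (f x))\<^sup>2)"
        proof (intro AE_I2)
          fix x
          have "\<bar>Re (T (T f) x * cnj (f x))\<bar> \<le> cmod (T (T f) x) * cmod (f x)"
            using abs_Re_le_cmod[of "T (T f) x * cnj (f x)"] by (simp add: norm_mult)
          also have "\<dots> \<le> (cmod (T (T f) x))\<^sup>2 + (cmod (f x))\<^sup>2"
            using abs_mult_le_add_squares[of "cmod (T (T f) x)" "cmod (f x)"] by simp
          finally show "norm (Re (T (T f) x * cnj (f x))) \<le> norm ((cmod (T (T f) x))\<^sup>2 + (cmod (f x))\<^sup>2)" by simp
        qed
      qed (use Tf[THEN L2_integrable] in auto)
      have "n ?v = (\<integral>x. (cmod (T (T f) x))\<^sup>2 - 2 * s * Re (T (T f) x * cnj (f x)) + s\<^sup>2 * (cmod (f x))\<^sup>2 \<partial>N)"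
        unfolding n_def L2_norm_square v sq ..
      also have "\<dots> = n (T (T f)) - 2 * s * n (T f) + s\<^sup>2 * n f"
        using ip Tf[THEN L2_integrable] sa[OF f] unfolding n_def L2_norm_square by simp
      also have "\<dots> \<le> s\<^sup>2 * n f - s * n (T f)" using sT[OF T_H[OF f]] by simp
      finally have "n ?v \<le> s\<^sup>2 * n f - s * n (T f)" .
      then have "K1\<^sup>2 * n ?v \<le> K1\<^sup>2 * (s\<^sup>2 * n f - s * n (T f))" by (intro mult_left_mono) auto
      with n2 have "n ?w \<le> K1\<^sup>2 * (s\<^sup>2 * n f - s * n (T f))" by linarith
      then have "K2\<^sup>2 * n ?w \<le> K2\<^sup>2 * (K1\<^sup>2 * (s\<^sup>2 * n f - s * n (T f)))" by (intro mult_left_mono) auto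
      with n1 show ?thesis unfolding C_def by (simp add: mult.assoc)
    qed
    have pos: "n f\<^sub>0 > 0" using nontrivial n0[of f\<^sub>0] unfolding n_def by simp
    have C0: "0 \<le> C" unfolding C_def by simp
    have "C \<noteq> 0" "s \<noteq> 0" using key[OF nontrivial(1)] pos by auto
    then have Cs: "C * s > 0" using C0 s0 by simp
    have le: "n (T f) \<le> (s - 1 / (C * s)) * n f" if "f \<in> H" for f
    proof -
      have "C * s * n (T f) \<le> (C * s) * (s * n f) - n f"
        using key[OF that] by (simp add: power2_eq_square algebra_simps)
      also have "\<dots> = (C * s) * ((s - 1 / (C * s)) * n f)"
        using \<open>C \<noteq> 0\<close> \<open>s \<noteq> 0\<close> by (simp add: algebra_simps)
      finally show ?thesis using Cs by (subst (asm) mult_le_cancel_left_pos) 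
    qed
    have "0 \<le> (s - 1 / (C * s)) * n f\<^sub>0" using le[OF nontrivial(1)] n0[of "T f\<^sub>0"] by linarith
    then have "0 \<le> s - 1 / (C * s)" using pos by (simp add: zero_le_mult_iff)
    then have "s - 1 / (C * s) \<in> I" unfolding I_def using le by simp
    then have "s \<le> s - 1 / (C * s)" unfolding s_def using bb by (intro cInf_lower)
    then show False using Cs by (simp add: divide_le_0_iff)
  qed
  then obtain z where z: "z \<in> op_spectrum N H T" "cmod z = c" using c(1) by (metis abs_of_nonneg norm_minus_cancel norm_of_real)
  have "L2_norm N (T f) \<le> c * L2_norm N f" if "f \<in> H" for f
  proof (rule power2_le_imp_le)
    show "(L2_norm N (T f))\<^sup>2 \<le> (c * L2_norm N f)\<^sup>2"
      using sT[OF that] unfolding power_mult_distrib c(2) n_def .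
  qed (use c(1) L2_norm_nonneg[of N f] in simp)
  then show ?thesis using z by (intro bexI[of _ z]) simp_all
qed

end

section \<open>Reversible random walks\<close>

text \<open>
  The real form of the Markov operator, for which positivity and monotonicity can be stated.
\<close>

definition avg :: "('a \<times> 'a) set \<Rightarrow> ('a \<Rightarrow> real) \<Rightarrow> 'a \<Rightarrow> real" where
  "avg E u x = (\<Sum>y\<in>E `` {x}. u y) / real (degree E x)"

lemma markov_of_real: "markov E (\<lambda>x. complex_of_real (u x)) = (\<lambda>x. complex_of_real (avg E u x))"
  by (auto simp: markov_def avg_def)

lemma Re_markov: "Re (markov E f x) = avg E (\<lambda>y. Re (f y)) x"
  and Im_markov: "Im (markov E f x) = avg E (\<lambda>y. Im (f y)) x"
proof -
  have "markov E f x = (1 / real (degree E x)) *\<^sub>R (\<Sum>y\<in>E `` {x}. f y)"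
    by (simp add: markov_def scaleR_conv_of_real)
  then show "Re (markov E f x) = avg E (\<lambda>y. Re (f y)) x" "Im (markov E f x) = avg E (\<lambda>y. Im (f y)) x"
    by (simp_all add: avg_def)
qed

lemma markov_add: "markov E (\<lambda>x. f x + g x) = (\<lambda>x. markov E f x + markov E g x)"
  by (auto simp: markov_def sum.distrib distrib_left)

lemma markov_scale: "markov E (\<lambda>x. c * f x) = (\<lambda>x. c * markov E f x)"
  by (auto simp: markov_def sum_distrib_left algebra_simps)

lemma avg_add: "avg E (\<lambda>x. u x + v x) = (\<lambda>x. avg E u x + avg E v x)"
  by (auto simp: avg_def sum.distrib add_divide_distrib)

lemma avg_diff: "avg E (\<lambda>x. u x - v x) = (\<lambda>x. avg E u x - avg E v x)"
  by (auto simp: avg_def sum_subtractf diff_divide_distrib)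

lemma avg_scale: "avg E (\<lambda>x. c * u x) = (\<lambda>x. c * avg E u x)"
  by (auto simp: avg_def sum_distrib_left)

lemma avg_mono: "(\<And>x. u x \<le> v x) \<Longrightarrow> avg E u x \<le> avg E v x"
  unfolding avg_def by (intro divide_right_mono sum_mono) auto

lemma avg_nonneg: "(\<And>x. 0 \<le> u x) \<Longrightarrow> 0 \<le> avg E u x"
  unfolding avg_def by (intro divide_nonneg_nonneg sum_nonneg) auto

lemma iter_avg_mono: "(\<And>x. u x \<le> v x) \<Longrightarrow> (avg E ^^ n) u x \<le> (avg E ^^ n) v x"
  by (induction n arbitrary: x) (auto intro: avg_mono)

lemma iter_avg_nonneg: "(\<And>x. 0 \<le> u x) \<Longrightarrow> 0 \<le> (avg E ^^ n) u x"
  by (induction n arbitrary: x) (auto intro: avg_nonneg)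

lemma iter_markov_of_real:
  "(markov E ^^ n) (\<lambda>x. complex_of_real (u x)) = (\<lambda>x. complex_of_real ((avg E ^^ n) u x))"
  by (induction n) (auto simp: markov_of_real)

lemma norm_markov_square_le: "(cmod (markov E f x))\<^sup>2 \<le> avg E (\<lambda>y. (cmod (f y))\<^sup>2) x"
proof (cases "degree E x = 0")
  case True
  then show ?thesis by (simp add: markov_def avg_def)
next
  case False
  then have d: "real (card (E `` {x})) > 0" by (simp add: degree_def)
  have "cmod (markov E f x) \<le> (\<Sum>y\<in>E `` {x}. cmod (f y)) / real (card (E `` {x}))"
    unfolding markov_def degree_def using norm_sum[of f "E `` {x}"] d by (simp add: norm_mult norm_divide divide_right_mono)
  then have "(cmod (markov E f x))\<^sup>2 \<le> ((\<Sum>y\<in>E `` {x}. cmod (f y)) / real (card (E `` {x})))\<^sup>2"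
    by (intro power_mono) auto
  also have "\<dots> = (\<Sum>y\<in>E `` {x}. 1 * cmod (f y))\<^sup>2 / (real (card (E `` {x})))\<^sup>2" by (simp add: power_divide)
  also have "\<dots> \<le> (\<Sum>y\<in>E `` {x}. 1\<^sup>2) * (\<Sum>y\<in>E `` {x}. (cmod (f y))\<^sup>2) / (real (card (E `` {x})))\<^sup>2"
    by (intro divide_right_mono Cauchy_Schwarz_ineq_sum) simp
  also have "\<dots> = avg E (\<lambda>y. (cmod (f y))\<^sup>2) x"
    using d by (simp add: avg_def degree_def power2_eq_square)
  finally show ?thesis .
qed

text \<open>
  A measure for which the simple random walk on the graph is reversible. There are two instances: the
  degree-biased measure of a graphing, and the measure with mass \<open>deg\<close> at each vertex of a countable graph.
  Reversibility for nonnegative functions is a form of the mass transport principle.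
\<close>

locale reversible_graph =
  fixes N :: "'a measure" and E :: "('a \<times> 'a) set"
  assumes markov_measurable: "\<And>f. f \<in> borel_measurable N \<Longrightarrow> markov E f \<in> borel_measurable N"
    and reversible: "\<And>u v :: 'a \<Rightarrow> real. u \<in> borel_measurable N \<Longrightarrow> v \<in> borel_measurable N \<Longrightarrow>
      (\<And>x. 0 \<le> u x) \<Longrightarrow> (\<And>x. 0 \<le> v x) \<Longrightarrow>
      (\<integral>\<^sup>+x. ennreal (v x * avg E u x) \<partial>N) = (\<integral>\<^sup>+x. ennreal (u x * avg E v x) \<partial>N)"
    and degree_nonzero: "AE x in N. degree E x \<noteq> 0"
begin

lemma avg_measurable[measurable]:
  assumes "u \<in> borel_measurable N"
  shows "avg E u \<in> borel_measurable N"
proof -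
  have "(\<lambda>x. complex_of_real (u x)) \<in> borel_measurable N" using assms by simp
  from markov_measurable[OF this] have "(\<lambda>x. Re (complex_of_real (avg E u x))) \<in> borel_measurable N"
    unfolding markov_of_real by measurable
  then show ?thesis by simp
qed

lemma iter_avg_measurable[measurable]:
  "u \<in> borel_measurable N \<Longrightarrow> (avg E ^^ n) u \<in> borel_measurable N"
  by (induction n) auto

lemma nn_integral_avg:
  assumes "u \<in> borel_measurable N" "\<And>x. 0 \<le> u x"
  shows "(\<integral>\<^sup>+x. ennreal (avg E u x) \<partial>N) = (\<integral>\<^sup>+x. ennreal (u x) \<partial>N)"
proof -
  have "(\<integral>\<^sup>+x. ennreal (avg E u x) \<partial>N) = (\<integral>\<^sup>+x. ennreal (u x * avg E (\<lambda>x. 1) x) \<partial>N)"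
    using reversible[OF assms(1), of "\<lambda>x. 1"] assms by simp
  also have "\<dots> = (\<integral>\<^sup>+x. ennreal (u x) \<partial>N)"
    by (rule nn_integral_cong_AE) (use degree_nonzero in \<open>auto simp: avg_def degree_def elim: eventually_mono\<close>)
  finally show ?thesis .
qed

lemma avg_cong_AE:
  assumes m: "u \<in> borel_measurable N" "v \<in> borel_measurable N" and ae: "AE x in N. u x = v x"
  shows "AE x in N. avg E u x = avg E v x"
proof -
  let ?w = "\<lambda>x. u x - v x"
  have am: "(\<lambda>x. \<bar>?w x\<bar>) \<in> borel_measurable N" using m by measurable
  have "(\<integral>\<^sup>+x. ennreal (avg E (\<lambda>x. \<bar>?w x\<bar>) x) \<partial>N) = (\<integral>\<^sup>+x. ennreal \<bar>?w x\<bar> \<partial>N)"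
    by (rule nn_integral_avg[OF am]) simp
  also have "\<dots> = (\<integral>\<^sup>+x. 0 \<partial>N)" by (rule nn_integral_cong_AE) (use ae in auto)
  finally have "AE x in N. ennreal (avg E (\<lambda>x. \<bar>?w x\<bar>) x) = 0"
    using am by (simp add: nn_integral_0_iff_AE)
  then show ?thesis
  proof eventually_elim
    case (elim x)
    have "avg E (\<lambda>x. \<bar>?w x\<bar>) x = 0" using elim avg_nonneg[of "\<lambda>x. \<bar>?w x\<bar>" E x] by (simp add: ennreal_eq_0_iff)
    moreover have "avg E ?w x \<le> avg E (\<lambda>x. \<bar>?w x\<bar>) x" by (rule avg_mono) simp
    moreover have "avg E (\<lambda>x. (-1) * ?w x) x \<le> avg E (\<lambda>x. \<bar>?w x\<bar>) x" by (rule avg_mono) simp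
    then have "(-1) * avg E ?w x \<le> avg E (\<lambda>x. \<bar>?w x\<bar>) x" unfolding avg_scale .
    ultimately have "avg E ?w x = 0" by linarith
    then show ?case by (subst (asm) avg_diff) simp
  qed
qed

lemma avg_one: "AE x in N. avg E (\<lambda>x. 1) x = 1"
  using degree_nonzero by eventually_elim (simp add: avg_def degree_def)

lemma iter_avg_one: "AE x in N. (avg E ^^ n) (\<lambda>x. 1) x = 1"
proof (induction n)
  case (Suc n)
  have "AE x in N. avg E ((avg E ^^ n) (\<lambda>x. 1)) x = avg E (\<lambda>x. 1) x"
    by (intro avg_cong_AE iter_avg_measurable Suc) simp_all
  with avg_one show ?case by eventually_elim simp
qed simp

text \<open>
  Jensen's inequality (\<open>norm_markov_square_le\<close>) and invariance of the measure under the walk.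
\<close>

lemma markov_L2:
  assumes f: "f \<in> L2 N"
  shows "markov E f \<in> L2 N" and "L2_norm N (markov E f) \<le> L2_norm N f"
proof -
  note fm[measurable] = L2_measurable[OF f] and fi = L2_integrable[OF f]
  note mm[measurable] = markov_measurable[OF fm]
  have "(\<integral>\<^sup>+x. ennreal ((cmod (markov E f x))\<^sup>2) \<partial>N) \<le> (\<integral>\<^sup>+x. ennreal (avg E (\<lambda>y. (cmod (f y))\<^sup>2) x) \<partial>N)"
    by (intro nn_integral_mono ennreal_leI norm_markov_square_le)
  also have "\<dots> = (\<integral>\<^sup>+x. ennreal ((cmod (f x))\<^sup>2) \<partial>N)" by (rule nn_integral_avg) auto
  also have "\<dots> = ennreal (\<integral>x. (cmod (f x))\<^sup>2 \<partial>N)" by (rule nn_integral_eq_integral[OF fi]) simp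
  finally have le: "(\<integral>\<^sup>+x. ennreal ((cmod (markov E f x))\<^sup>2) \<partial>N) \<le> ennreal (\<integral>x. (cmod (f x))\<^sup>2 \<partial>N)" .
  have int: "integrable N (\<lambda>x. (cmod (markov E f x))\<^sup>2)"
    using le by (intro integrableI_nonneg) (auto simp: less_top[symmetric] top_unique)
  then show "markov E f \<in> L2 N" by (intro L2_I mm)
  have "ennreal (\<integral>x. (cmod (markov E f x))\<^sup>2 \<partial>N) \<le> ennreal (\<integral>x. (cmod (f x))\<^sup>2 \<partial>N)"
    using le nn_integral_eq_integral[OF int] by simp
  then have "(\<integral>x. (cmod (markov E f x))\<^sup>2 \<partial>N) \<le> (\<integral>x. (cmod (f x))\<^sup>2 \<partial>N)"
    by (subst (asm) ennreal_le_iff) auto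
  then show "L2_norm N (markov E f) \<le> L2_norm N f" unfolding L2_norm_def by simp
qed

definition square_integrable :: "('a \<Rightarrow> real) \<Rightarrow> bool" where
  "square_integrable u \<longleftrightarrow> u \<in> borel_measurable N \<and> integrable N (\<lambda>x. (u x)\<^sup>2)"

lemma square_integrable_L2: "square_integrable u \<longleftrightarrow> (\<lambda>x. complex_of_real (u x)) \<in> L2 N"
proof -
  have "u \<in> borel_measurable N \<longleftrightarrow> (\<lambda>x. complex_of_real (u x)) \<in> borel_measurable N"
  proof
    assume "(\<lambda>x. complex_of_real (u x)) \<in> borel_measurable N"
    then have "(\<lambda>x. Re (complex_of_real (u x))) \<in> borel_measurable N" by measurable
    then show "u \<in> borel_measurable N" by simp
  qed simp
  then show ?thesis unfolding square_integrable_def L2_def by simp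
qed

lemma square_integrable_avg: "square_integrable u \<Longrightarrow> square_integrable (avg E u)"
  unfolding square_integrable_L2 markov_of_real[symmetric] by (rule markov_L2(1))

lemma square_integrable_iter_avg: "square_integrable u \<Longrightarrow> square_integrable ((avg E ^^ n) u)"
  by (induction n) (auto intro: square_integrable_avg)

lemma integrable_product:
  assumes "square_integrable u" "square_integrable v"
  shows "integrable N (\<lambda>x. u x * v x)"
proof (rule Bochner_Integration.integrable_bound[of _ "\<lambda>x. (u x)\<^sup>2 + (v x)\<^sup>2"])
  show "AE x in N. norm (u x * v x) \<le> norm ((u x)\<^sup>2 + (v x)\<^sup>2)"
    by (intro AE_I2) (simp add: abs_mult_le_add_squares)
qed (use assms in \<open>auto simp: square_integrable_def\<close>)

lemma square_integrable_positive_part: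
  assumes "square_integrable u"
  shows "square_integrable (\<lambda>x. max 0 (u x))" "square_integrable (\<lambda>x. max 0 (- u x))"
proof -
  have m: "u \<in> borel_measurable N" and i: "integrable N (\<lambda>x. (u x)\<^sup>2)"
    using assms unfolding square_integrable_def by auto
  have "integrable N (\<lambda>x. (max 0 (u x))\<^sup>2)" "integrable N (\<lambda>x. (max 0 (- u x))\<^sup>2)"
    by (rule Bochner_Integration.integrable_bound[OF i]; use m in \<open>auto simp: max_def\<close>)+
  then show "square_integrable (\<lambda>x. max 0 (u x))" "square_integrable (\<lambda>x. max 0 (- u x))"
    using m unfolding square_integrable_def by auto
qed

text \<open>
  Both sides are bilinear, so it suffices to split both functions into positive and negative parts.
\<close>

lemma avg_selfadjoint:
  assumes u: "square_integrable u" and v: "square_integrable v"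
  shows "(\<integral>x. v x * avg E u x \<partial>N) = (\<integral>x. u x * avg E v x \<partial>N)"
proof -
  have pos: "(\<integral>x. v x * avg E u x \<partial>N) = (\<integral>x. u x * avg E v x \<partial>N)"
    if "square_integrable u" "square_integrable v" "\<And>x. 0 \<le> u x" "\<And>x. 0 \<le> v x" for u v
  proof -
    have m[measurable]: "u \<in> borel_measurable N" "v \<in> borel_measurable N" using that unfolding square_integrable_def by auto
    show ?thesis
      using reversible[OF m that(3,4)] that(3,4)
      by (simp add: integral_eq_nn_integral avg_nonneg)
  qed
  let ?u1 = "\<lambda>x. max 0 (u x)" and ?u2 = "\<lambda>x. max 0 (- u x)"
  let ?v1 = "\<lambda>x. max 0 (v x)" and ?v2 = "\<lambda>x. max 0 (- v x)"
  note si = square_integrable_positive_part[OF u] square_integrable_positive_part[OF v]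
  note sa = si[THEN square_integrable_avg]
  have dec: "w = (\<lambda>x. max 0 (w x) - max 0 (- w x))" for w :: "'a \<Rightarrow> real" by (auto simp: max_def)
  have exp: "(\<integral>x. (a1 x - a2 x) * (b1 x - b2 x) \<partial>N) =
      (\<integral>x. a1 x * b1 x \<partial>N) - (\<integral>x. a1 x * b2 x \<partial>N) - (\<integral>x. a2 x * b1 x \<partial>N) + (\<integral>x. a2 x * b2 x \<partial>N)"
    if "square_integrable a1" "square_integrable a2" "square_integrable b1" "square_integrable b2" for a1 a2 b1 b2
    using integrable_product[OF that(1) that(3)] integrable_product[OF that(1) that(4)]
      integrable_product[OF that(2) that(3)] integrable_product[OF that(2) that(4)]
    by (simp add: algebra_simps)
  have au: "avg E u x = avg E ?u1 x - avg E ?u2 x" and av: "avg E v x = avg E ?v1 x - avg E ?v2 x" for x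
    using arg_cong[OF dec[of u], of "\<lambda>w. avg E w x"] arg_cong[OF dec[of v], of "\<lambda>w. avg E w x"]
    by (simp_all add: avg_diff)
  have "(\<integral>x. v x * avg E u x \<partial>N) = (\<integral>x. (?v1 x - ?v2 x) * (avg E ?u1 x - avg E ?u2 x) \<partial>N)"
    unfolding au by (intro Bochner_Integration.integral_cong) (auto simp: max_def)
  also have "\<dots> = (\<integral>x. (?u1 x - ?u2 x) * (avg E ?v1 x - avg E ?v2 x) \<partial>N)"
    unfolding exp[OF si(3,4) sa(1,2)] exp[OF si(1,2) sa(3,4)]
    by (simp add: pos si)
  also have "\<dots> = (\<integral>x. u x * avg E v x \<partial>N)"
    unfolding av by (intro Bochner_Integration.integral_cong) (auto simp: max_def)
  finally show ?thesis .
qed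

lemma iter_avg_selfadjoint:
  assumes u: "square_integrable u" and v: "square_integrable v"
  shows "(\<integral>x. v x * (avg E ^^ (m + n)) u x \<partial>N) = (\<integral>x. (avg E ^^ m) v x * (avg E ^^ n) u x \<partial>N)"
  using v
proof (induction m arbitrary: v)
  case (Suc m)
  have "(\<integral>x. v x * (avg E ^^ (Suc m + n)) u x \<partial>N) = (\<integral>x. v x * avg E ((avg E ^^ (m + n)) u) x \<partial>N)" by simp
  also have "\<dots> = (\<integral>x. (avg E ^^ (m + n)) u x * avg E v x \<partial>N)"
    by (intro avg_selfadjoint square_integrable_iter_avg u Suc.prems)
  also have "\<dots> = (\<integral>x. avg E v x * (avg E ^^ (m + n)) u x \<partial>N)" by (simp add: mult.commute)
  also have "\<dots> = (\<integral>x. (avg E ^^ m) (avg E v) x * (avg E ^^ n) u x \<partial>N)"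
    by (intro Suc.IH square_integrable_avg Suc.prems)
  finally show ?case by (simp add: funpow_swap1)
qed simp

lemma L2_Re_Im:
  assumes "f \<in> L2 N"
  shows "square_integrable (\<lambda>x. Re (f x))" "square_integrable (\<lambda>x. Im (f x))"
proof -
  note [measurable] = L2_measurable[OF assms]
  have "integrable N (\<lambda>x. (Re (f x))\<^sup>2)" "integrable N (\<lambda>x. (Im (f x))\<^sup>2)"
    by (rule Bochner_Integration.integrable_bound[OF L2_integrable[OF assms]]; auto simp: cmod_power2)+
  then show "square_integrable (\<lambda>x. Re (f x))" "square_integrable (\<lambda>x. Im (f x))"
    unfolding square_integrable_def by auto
qed

lemma markov_selfadjoint:
  assumes f: "f \<in> L2 N"
  shows "(\<integral>x. Re (markov E (markov E f) x * cnj (f x)) \<partial>N) = (L2_norm N (markov E f))\<^sup>2"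
proof -
  let ?r = "\<lambda>x. Re (f x)" and ?i = "\<lambda>x. Im (f x)"
  note si = L2_Re_Im[OF f]
  have e: "Re (markov E (markov E f) x * cnj (f x)) = ?r x * avg E (avg E ?r) x + ?i x * avg E (avg E ?i) x" for x
    by (simp add: Re_markov Im_markov mult.commute)
  have "(\<integral>x. Re (markov E (markov E f) x * cnj (f x)) \<partial>N) = (\<integral>x. ?r x * avg E (avg E ?r) x \<partial>N) + (\<integral>x. ?i x * avg E (avg E ?i) x \<partial>N)"
    unfolding e by (intro Bochner_Integration.integral_add integrable_product si square_integrable_avg)
  also have "\<dots> = (\<integral>x. avg E ?r x * avg E ?r x \<partial>N) + (\<integral>x. avg E ?i x * avg E ?i x \<partial>N)"
    by (simp add: avg_selfadjoint si square_integrable_avg)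
  also have "\<dots> = (\<integral>x. avg E ?r x * avg E ?r x + avg E ?i x * avg E ?i x \<partial>N)"
    by (intro Bochner_Integration.integral_add[symmetric] integrable_product si square_integrable_avg)
  also have "\<dots> = (L2_norm N (markov E f))\<^sup>2"
    unfolding L2_norm_square cmod_power2 Re_markov Im_markov by (simp add: power2_eq_square)
  finally show ?thesis .
qed

lemma L2_operator_markov: "L2_operator N (L2 N) (markov E)"
proof
  show "(\<lambda>x. 0) \<in> L2 N" by (simp add: L2_def)
qed (auto intro: L2_add L2_scale markov_L2 simp: markov_add markov_scale)

end

section \<open>Return probabilities and the norm on mean-zero functions\<close>

locale reversible_prob_graph = reversible_graph N E + prob_space N for N :: "'a measure" and E
begin

lemma L2_integrable1:
  assumes "f \<in> L2 N"
  shows "integrable N f"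
proof (rule Bochner_Integration.integrable_bound[of _ "\<lambda>x. 1 + (cmod (f x))\<^sup>2"])
  show "AE x in N. norm (f x) \<le> norm (1 + (cmod (f x))\<^sup>2)"
  proof (intro AE_I2)
    fix x
    have "2 * cmod (f x) \<le> 1 + (cmod (f x))\<^sup>2" using sum_squares_bound[of 1 "cmod (f x)"] by simp
    then have "cmod (f x) \<le> 1 + (cmod (f x))\<^sup>2" using norm_ge_zero[of "f x"] by linarith
    then show "norm (f x) \<le> norm (1 + (cmod (f x))\<^sup>2)" by simp
  qed
qed (use L2_measurable[OF assms] L2_integrable[OF assms] in auto)

lemma norm_integral_le_L2_norm:
  assumes "f \<in> L2 N"
  shows "cmod (\<integral>x. f x \<partial>N) \<le> L2_norm N f"
proof -
  have i: "integrable N (\<lambda>x. cmod (f x))" using L2_integrable1[OF assms] by simp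
  have "(\<integral>x. (cmod (f x))\<^sup>2 \<partial>N) - (\<integral>x. cmod (f x) \<partial>N)\<^sup>2 \<ge> 0"
    using variance_eq[OF i L2_integrable[OF assms]] variance_positive[of "\<lambda>x. cmod (f x)"] by simp
  then have "(\<integral>x. cmod (f x) \<partial>N)\<^sup>2 \<le> (\<integral>x. (cmod (f x))\<^sup>2 \<partial>N)" by simp
  then have "(\<integral>x. cmod (f x) \<partial>N) \<le> L2_norm N f" unfolding L2_norm_def by (rule real_le_rsqrt)
  then show ?thesis using integral_norm_bound[of N f] by linarith
qed

lemma L2_0_iff: "f \<in> L2_0 N \<longleftrightarrow> f \<in> L2 N \<and> (\<integral>x. f x \<partial>N) = 0"
proof -
  have "(\<forall>c. L2_inner N f (\<lambda>_. c) = 0) \<longleftrightarrow> (\<integral>x. f x \<partial>N) = 0" if "f \<in> L2 N"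
  proof
    assume "\<forall>c. L2_inner N f (\<lambda>_. c) = 0"
    then have "L2_inner N f (\<lambda>_. 1) = 0" by blast
    then show "(\<integral>x. f x \<partial>N) = 0" by (simp add: L2_inner_def)
  qed (simp add: L2_inner_def)
  then show ?thesis unfolding L2_0_def by auto
qed

lemma square_integrable_const: "square_integrable (\<lambda>x. c)"
  unfolding square_integrable_def by simp

lemma square_integrable_indicator:
  assumes "A \<in> sets N"
  shows "square_integrable (indicator A)"
proof -
  have "(indicator A x :: real)\<^sup>2 = indicator A x" for x by (simp add: indicator_def)
  then show ?thesis
    using assms unfolding square_integrable_def by (simp add: emeasure_eq_measure)
qed

lemma integral_avg:
  assumes "square_integrable u"
  shows "(\<integral>x. avg E u x \<partial>N) = (\<integral>x. u x \<partial>N)"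
proof -
  have "(\<integral>x. avg E u x \<partial>N) = (\<integral>x. u x * avg E (\<lambda>x. 1) x \<partial>N)"
    using avg_selfadjoint[OF assms square_integrable_const[of 1]] by simp
  also have "\<dots> = (\<integral>x. u x \<partial>N)"
  proof (rule integral_cong_AE)
    show "AE x in N. u x * avg E (\<lambda>x. 1) x = u x"
      using degree_nonzero by eventually_elim (simp add: avg_def degree_def)
  qed (use assms in \<open>auto simp: square_integrable_def\<close>)
  finally show ?thesis .
qed

lemma markov_L2_0:
  assumes "f \<in> L2_0 N"
  shows "markov E f \<in> L2_0 N"
proof -
  have f: "f \<in> L2 N" "(\<integral>x. f x \<partial>N) = 0" using assms L2_0_iff by auto
  note i = L2_integrable1[OF f(1)] L2_integrable1[OF markov_L2(1)[OF f(1)]]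
  have "(\<integral>x. markov E f x \<partial>N) = (\<integral>x. f x \<partial>N)"
  proof (rule complex_eqI)
    show "Re (\<integral>x. markov E f x \<partial>N) = Re (\<integral>x. f x \<partial>N)"
      unfolding integral_Re[OF i(1), symmetric] integral_Re[OF i(2), symmetric] Re_markov
      by (rule integral_avg[OF L2_Re_Im(1)[OF f(1)]])
    show "Im (\<integral>x. markov E f x \<partial>N) = Im (\<integral>x. f x \<partial>N)"
      unfolding integral_Im[OF i(1), symmetric] integral_Im[OF i(2), symmetric] Im_markov
      by (rule integral_avg[OF L2_Re_Im(2)[OF f(1)]])
  qed
  then show ?thesis using f markov_L2(1) L2_0_iff by auto
qed

lemma L2_operator_markov_L2_0: "L2_operator N (L2_0 N) (markov E)"
proof
  show "(\<lambda>x. 0) \<in> L2_0 N" by (simp add: L2_0_iff L2_def)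
  fix s f assume s: "\<And>n. s n \<in> L2_0 N" and f: "f \<in> L2 N" and lim: "(\<lambda>n. L2_norm N (\<lambda>x. s n x - f x)) \<longlonglongrightarrow> 0"
  have "cmod (\<integral>x. f x \<partial>N) \<le> L2_norm N (\<lambda>x. s n x - f x)" for n
  proof -
    have sn: "s n \<in> L2 N" "(\<integral>x. s n x \<partial>N) = 0" using s[of n] L2_0_iff by auto
    have "(\<integral>x. s n x - f x \<partial>N) = - (\<integral>x. f x \<partial>N)"
      using sn L2_integrable1[OF sn(1)] L2_integrable1[OF f] by simp
    then show ?thesis using norm_integral_le_L2_norm[OF L2_diff[OF sn(1) f]] by simp
  qed
  then have "cmod (\<integral>x. f x \<partial>N) \<le> 0" using lim by (intro LIMSEQ_le_const[OF lim]) auto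
  then show "f \<in> L2_0 N" using f L2_0_iff by simp
next
  fix f assume "f \<in> L2_0 N"
  then show "markov E f \<in> L2_0 N" by (rule markov_L2_0)
next
  fix f g assume "f \<in> L2_0 N" "g \<in> L2_0 N"
  then show "(\<lambda>x. f x + g x) \<in> L2_0 N"
    unfolding L2_0_iff using L2_integrable1[of f] L2_integrable1[of g] by (simp add: L2_add)
next
  fix c f assume "f \<in> L2_0 N"
  then show "(\<lambda>x. c * f x) \<in> L2_0 N" unfolding L2_0_iff by (simp add: L2_scale)
next
  show "L2_0 N \<subseteq> L2 N" unfolding L2_0_def by blast
qed (rule markov_add markov_scale)+

lemma centered_indicator:
  fixes A :: "'a set"
  assumes A: "A \<in> sets N"
  defines "g \<equiv> \<lambda>x. indicator A x - prob A :: real"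
  shows "square_integrable g" and "(\<integral>x. g x \<partial>N) = 0" and "(\<integral>x. (g x)\<^sup>2 \<partial>N) = prob A * (1 - prob A)"
    and "(\<lambda>x. complex_of_real (g x)) \<in> L2_0 N"
proof -
  have i1: "integrable N (indicator A :: 'a \<Rightarrow> real)"
    using A by (intro integrable_real_indicator) (auto simp: emeasure_eq_measure)
  have gsq: "(g x)\<^sup>2 = (1 - 2 * prob A) * indicator A x + (prob A)\<^sup>2" for x
    by (simp add: g_def indicator_def power2_eq_square algebra_simps)
  have gm: "g \<in> borel_measurable N" using A unfolding g_def by simp
  show si: "square_integrable g"
    unfolding square_integrable_def gsq using gm i1 by simp
  show "(\<integral>x. (g x)\<^sup>2 \<partial>N) = prob A * (1 - prob A)"
    unfolding gsq using i1 A by (simp add: prob_space power2_eq_square algebra_simps)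
  show g0: "(\<integral>x. g x \<partial>N) = 0" using i1 A unfolding g_def by (simp add: prob_space)
  show "(\<lambda>x. complex_of_real (g x)) \<in> L2_0 N"
    unfolding L2_0_iff using si[unfolded square_integrable_L2] g0 by (simp only: integral_complex_of_real) simp
qed

text \<open>
  By symmetry the left-hand side is the squared norm of the \<open>n\<close>-th iterate applied to the indicator of \<open>A\<close>. Write
  the indicator as \<open>prob A\<close> plus a function of integral zero. The iterates fix the constant and shrink the
  other summand by \<open>c\<^sup>n\<close>, and the two stay orthogonal.
\<close>

lemma return_estimate:
  assumes c: "0 \<le> c" "\<And>f. f \<in> L2_0 N \<Longrightarrow> L2_norm N (markov E f) \<le> c * L2_norm N f"
    and A: "A \<in> sets N"
  shows "(\<integral>x. indicator A x * (avg E ^^ (2 * n)) (indicator A) x \<partial>N) \<le> c ^ (2 * n) * prob A + (prob A)\<^sup>2"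
proof -
  interpret L2_operator N "L2_0 N" "markov E" by (rule L2_operator_markov_L2_0)
  let ?a = "prob A"
  let ?g = "\<lambda>x. indicator A x - ?a :: real"
  have Asi: "square_integrable (indicator A)"
    by (rule square_integrable_indicator[OF A])
  let ?gc = "\<lambda>x. complex_of_real (?g x)"
  note gsi = centered_indicator(1)[OF A] and g0 = centered_indicator(2)[OF A] and gH = centered_indicator(4)[OF A]
  have g2: "(\<integral>x. (?g x)\<^sup>2 \<partial>N) \<le> ?a"
    unfolding centered_indicator(3)[OF A] by (simp add: algebra_simps)
  let ?h = "(avg E ^^ n) ?g"
  have "(L2_norm N ((markov E ^^ n) ?gc))\<^sup>2 \<le> (c ^ n * L2_norm N ?gc)\<^sup>2"
    using Tn_bound[OF c gH, of n] L2_norm_nonneg by (intro power_mono)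
  also have "\<dots> = c ^ (2 * n) * (\<integral>x. (?g x)\<^sup>2 \<partial>N)"
    unfolding power_mult_distrib L2_norm_square norm_of_real power2_abs by (simp add: power_even_eq)
  also have "\<dots> \<le> c ^ (2 * n) * ?a" using c(1) g2 by (intro mult_left_mono) auto
  finally have h2: "(\<integral>x. (?h x)\<^sup>2 \<partial>N) \<le> c ^ (2 * n) * ?a"
    unfolding iter_markov_of_real L2_norm_square norm_of_real power2_abs .
  have h0: "(\<integral>x. ?h x \<partial>N) = 0"
  proof (induction n)
    case (Suc n)
    then show ?case using integral_avg[OF square_integrable_iter_avg[OF gsi, of n]] by simp
  qed (use g0 in simp)
  have hsi: "square_integrable ?h" by (rule square_integrable_iter_avg[OF gsi])
  have split: "AE x in N. (avg E ^^ n) (indicator A) x = ?h x + ?a"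
  proof -
    have "AE x in N. (avg E ^^ n) (\<lambda>x. 1) x = 1" by (rule iter_avg_one)
    moreover have "(avg E ^^ n) (indicator A) x = ?h x + ?a * (avg E ^^ n) (\<lambda>x. 1) x" for x
    proof -
      have "(avg E ^^ n) (\<lambda>x. ?g x + ?a * 1) = (\<lambda>x. ?h x + ?a * (avg E ^^ n) (\<lambda>x. 1) x)"
        by (induction n) (auto simp: avg_add avg_scale)
      then show ?thesis by (simp add: fun_eq_iff)
    qed
    ultimately show ?thesis by (auto elim: eventually_mono)
  qed
  have "(\<integral>x. indicator A x * (avg E ^^ (2 * n)) (indicator A) x \<partial>N) = (\<integral>x. (avg E ^^ n) (indicator A) x * (avg E ^^ n) (indicator A) x \<partial>N)"
    using iter_avg_selfadjoint[OF Asi Asi, of n n] by (simp add: mult_2)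
  also have "\<dots> = (\<integral>x. (?h x)\<^sup>2 + 2 * ?a * ?h x + ?a\<^sup>2 \<partial>N)"
  proof (rule integral_cong_AE)
    show "AE x in N. (avg E ^^ n) (indicator A) x * (avg E ^^ n) (indicator A) x = (?h x)\<^sup>2 + 2 * ?a * ?h x + ?a\<^sup>2"
      using split by eventually_elim (simp add: power2_eq_square algebra_simps)
    show "(\<lambda>x. (avg E ^^ n) (indicator A) x * (avg E ^^ n) (indicator A) x) \<in> borel_measurable N"
      using square_integrable_iter_avg[OF Asi, of n] unfolding square_integrable_def by auto
    show "(\<lambda>x. (?h x)\<^sup>2 + 2 * ?a * ?h x + ?a\<^sup>2) \<in> borel_measurable N"
      using hsi unfolding square_integrable_def by auto
  qed
  also have "\<dots> = (\<integral>x. (?h x)\<^sup>2 \<partial>N) + ?a\<^sup>2"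
    using hsi h0 integrable_product[OF square_integrable_const[of 1] hsi] unfolding square_integrable_def by (simp add: prob_space)
  also have "\<dots> \<le> c ^ (2 * n) * ?a + ?a\<^sup>2" using h2 by simp
  finally show ?thesis .
qed

text \<open>
  The return probability \<open>p\<close> after \<open>2 n\<close> steps satisfies \<open>p(x) \<le> (M\<^bsup>2n\<^esup> 1\<^sub>A)(x)\<close> whenever \<open>x \<in> A\<close>. For a countable
  partition into pieces \<open>A\<close> of mass at most \<open>\<epsilon>\<close>, the function \<open>Q n\<close> that takes the value \<open>(M\<^bsup>2n\<^esup> 1\<^sub>A)(x)\<close> for \<open>x\<close> in the
  piece \<open>A\<close> therefore dominates \<open>p\<close>. Summing \<open>return_estimate\<close> over the pieces shows that its integral is at most
  \<open>c\<^bsup>2n\<^esup> + \<epsilon>\<close>. With \<open>\<epsilon> = c1\<^bsup>2n\<^esup>\<close> for some \<open>c1\<close> strictly between \<open>c\<close> and \<open>c'\<close>, the series of the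
  \<open>Q n / c'\<^bsup>2n\<^esup>\<close> has finite integral, so it is finite almost everywhere.
\<close>

lemma return_probability_bound:
  assumes c: "0 \<le> c" "\<And>f. f \<in> L2_0 N \<Longrightarrow> L2_norm N (markov E f) \<le> c * L2_norm N f"
    and fine: "\<And>\<epsilon>. \<epsilon> > 0 \<Longrightarrow> \<exists>A :: nat \<Rightarrow> 'a set. range A \<subseteq> sets N \<and> disjoint_family A \<and> (\<Union>i. A i) = space N \<and> (\<forall>i. prob (A i) \<le> \<epsilon>)"
    and c': "c < c'"
  shows "AE x in N. \<exists>K. \<forall>n. (avg E ^^ (2 * n)) (indicator {x}) x \<le> K * c' ^ (2 * n)"
proof -
  \<comment> \<open>The pieces of the \<open>n\<close>-th partition have mass at most \<open>c1 ^ (2 * n)\<close>, which is positive even if \<open>c = 0\<close>.\<close>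
  define c1 where "c1 = (c + c') / 2"
  have c1: "0 < c1" "c \<le> c1" "c1 < c'" "0 < c'" using c(1) c' unfolding c1_def by auto
  have "\<forall>n. \<exists>A :: nat \<Rightarrow> 'a set. range A \<subseteq> sets N \<and> disjoint_family A \<and> (\<Union>i. A i) = space N \<and> (\<forall>i. prob (A i) \<le> c1 ^ (2 * n))"
  proof
    fix n
    have "0 < c1 ^ (2 * n)" using c1 by simp
    then show "\<exists>A :: nat \<Rightarrow> 'a set. range A \<subseteq> sets N \<and> disjoint_family A \<and> (\<Union>i. A i) = space N \<and> (\<forall>i. prob (A i) \<le> c1 ^ (2 * n))"
      by (rule fine)
  qed
  from choice[OF this] obtain A :: "nat \<Rightarrow> nat \<Rightarrow> 'a set" where
    A': "\<forall>n. range (A n) \<subseteq> sets N \<and> disjoint_family (A n) \<and> (\<Union>i. A n i) = space N \<and> (\<forall>i. prob (A n i) \<le> c1 ^ (2 * n))" ..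
  then have A: "range (A n) \<subseteq> sets N" "disjoint_family (A n)" "(\<Union>i. A n i) = space N" "prob (A n i) \<le> c1 ^ (2 * n)" for n i
    by simp_all
  have Am[measurable]: "A n i \<in> sets N" for n i using A(1)[of n] by auto
  define q where "q n i x = indicator (A n i) x * (avg E ^^ (2 * n)) (indicator (A n i)) x" for n i x
  have q0: "0 \<le> q n i x" for n i x unfolding q_def by (intro mult_nonneg_nonneg iter_avg_nonneg) auto
  have qm[measurable]: "q n i \<in> borel_measurable N" for n i unfolding q_def by measurable
  define Q where "Q n x = (\<Sum>i. ennreal (q n i x))" for n x
  have Qm[measurable]: "Q n \<in> borel_measurable N" for n unfolding Q_def by measurable
  have Qint: "(\<integral>\<^sup>+x. Q n x \<partial>N) \<le> ennreal (2 * c1 ^ (2 * n))" for n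
  proof -
    have si: "square_integrable (indicator (A n i))" for i
      by (rule square_integrable_indicator[OF Am])
    have "(\<integral>\<^sup>+x. Q n x \<partial>N) = (\<Sum>i. \<integral>\<^sup>+x. ennreal (q n i x) \<partial>N)"
      unfolding Q_def by (rule nn_integral_suminf) measurable
    also have "\<dots> \<le> (\<Sum>i. ennreal (2 * c1 ^ (2 * n)) * emeasure N (A n i))"
    proof (intro suminf_le summableI)
      fix i
      have "(\<integral>\<^sup>+x. ennreal (q n i x) \<partial>N) = ennreal (\<integral>x. q n i x \<partial>N)"
        using integrable_product[OF si square_integrable_iter_avg[OF si]] q0
        unfolding q_def by (intro nn_integral_eq_integral) auto
      also have "(\<integral>x. q n i x \<partial>N) \<le> c ^ (2 * n) * prob (A n i) + (prob (A n i))\<^sup>2"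
        unfolding q_def by (rule return_estimate[OF c Am])
      also have "\<dots> \<le> c1 ^ (2 * n) * prob (A n i) + c1 ^ (2 * n) * prob (A n i)"
        unfolding power2_eq_square using c c1 A(4) by (intro add_mono mult_right_mono power_mono) auto
      also have "\<dots> = 2 * c1 ^ (2 * n) * prob (A n i)" by simp
      also have "ennreal (2 * c1 ^ (2 * n) * prob (A n i)) = ennreal (2 * c1 ^ (2 * n)) * emeasure N (A n i)"
        using c1 by (simp add: ennreal_mult emeasure_eq_measure)
      finally show "(\<integral>\<^sup>+x. ennreal (q n i x) \<partial>N) \<le> ennreal (2 * c1 ^ (2 * n)) * emeasure N (A n i)"
        by (simp add: ennreal_leI)
    qed
    also have "\<dots> = ennreal (2 * c1 ^ (2 * n)) * emeasure N (\<Union>i. A n i)"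
      using suminf_emeasure[OF A(1,2)[of n]] by (simp add: ennreal_suminf_cmult)
    also have "\<dots> = ennreal (2 * c1 ^ (2 * n))" using A(3) emeasure_space_1 by simp
    finally show ?thesis .
  qed
  define W where "W x = (\<Sum>n. Q n x * ennreal (1 / c' ^ (2 * n)))" for x
  have Wm: "W \<in> borel_measurable N" unfolding W_def by measurable
  have "(\<integral>\<^sup>+x. W x \<partial>N) = (\<Sum>n. (\<integral>\<^sup>+x. Q n x \<partial>N) * ennreal (1 / c' ^ (2 * n)))"
    unfolding W_def by (simp add: nn_integral_suminf nn_integral_multc)
  also have "\<dots> \<le> (\<Sum>n. ennreal (2 * ((c1 / c')\<^sup>2) ^ n))"
  proof (intro suminf_le summableI)
    fix n
    have "(\<integral>\<^sup>+x. Q n x \<partial>N) * ennreal (1 / c' ^ (2 * n)) \<le> ennreal (2 * c1 ^ (2 * n)) * ennreal (1 / c' ^ (2 * n))"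
      by (intro mult_right_mono Qint) simp
    also have "\<dots> = ennreal (2 * ((c1 / c')\<^sup>2) ^ n)"
      using c1 by (subst ennreal_mult[symmetric]) (auto simp: power_mult power_divide)
    finally show "(\<integral>\<^sup>+x. Q n x \<partial>N) * ennreal (1 / c' ^ (2 * n)) \<le> ennreal (2 * ((c1 / c')\<^sup>2) ^ n)" .
  qed
  also have "\<dots> < \<infinity>"
  proof -
    have "(c1 / c')\<^sup>2 < 1" using c1 by (simp add: power_less_one_iff abs_square_less_1)
    then have "summable (\<lambda>n. 2 * ((c1 / c')\<^sup>2) ^ n)" by (intro summable_mult summable_geometric) auto
    then show ?thesis using c1 by (subst suminf_ennreal2) auto
  qed
  finally have "AE x in N. W x \<noteq> \<infinity>" using Wm by (intro nn_integral_PInf_AE) auto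
  then show ?thesis
  proof (rule AE_mp, intro AE_I2 impI)
    fix x assume x: "x \<in> space N" and Wx: "W x \<noteq> \<infinity>"
    have "(avg E ^^ (2 * n)) (indicator {x}) x \<le> enn2real (W x) * c' ^ (2 * n)" for n
    proof -
      let ?p = "(avg E ^^ (2 * n)) (indicator {x}) x"
      obtain i where i: "x \<in> A n i" using A(3)[of n] x by blast
      have "?p \<le> (avg E ^^ (2 * n)) (indicator (A n i)) x"
        by (rule iter_avg_mono) (use i in \<open>auto simp: indicator_def\<close>)
      then have "?p \<le> q n i x" unfolding q_def using i by simp
      then have "ennreal ?p \<le> ennreal (q n i x)" by (rule ennreal_leI)
      also have "\<dots> \<le> Q n x" unfolding Q_def
        using sum_le_suminf[of "\<lambda>i. ennreal (q n i x)" "{i}"] by (simp add: summableI)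
      finally have "ennreal ?p * ennreal (1 / c' ^ (2 * n)) \<le> Q n x * ennreal (1 / c' ^ (2 * n))"
        by (rule mult_right_mono) (rule zero_le)
      also have "\<dots> \<le> W x" unfolding W_def
        using sum_le_suminf[of "\<lambda>n. Q n x * ennreal (1 / c' ^ (2 * n))" "{n}"] by (simp add: summableI)
      finally have "ennreal (?p * (1 / c' ^ (2 * n))) \<le> W x"
        using c1 by (subst ennreal_mult) (auto intro: iter_avg_nonneg)
      also have "W x = ennreal (enn2real (W x))" using Wx by (simp add: less_top)
      finally have "?p * (1 / c' ^ (2 * n)) \<le> enn2real (W x)" by (simp add: ennreal_le_iff)
      then show ?thesis using c1 by (simp add: divide_le_eq)
    qed
    then show "\<exists>K. \<forall>n. (avg E ^^ (2 * n)) (indicator {x}) x \<le> K * c' ^ (2 * n)" by blast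
  qed
qed

end

section \<open>The norm of the Markov operator of a countable graph\<close>

definition degree_measure :: "'a set \<Rightarrow> ('a \<times> 'a) set \<Rightarrow> 'a measure" where
  "degree_measure V E = point_measure V (\<lambda>u. of_nat (degree E u))"

text \<open>
  The mass transport principle for the counting measure is Tonelli's theorem.
\<close>

lemma nn_integral_edge_swap:
  fixes g :: "'a \<times> 'a \<Rightarrow> ennreal"
  assumes E: "E \<subseteq> V \<times> V" "sym E" and fin: "\<And>x. x \<in> V \<Longrightarrow> finite (E `` {x})"
  shows "(\<integral>\<^sup>+x. (\<Sum>y\<in>E `` {x}. g (x, y)) \<partial>count_space V) = (\<integral>\<^sup>+x. (\<Sum>y\<in>E `` {x}. g (y, x)) \<partial>count_space V)"
proof -
  have fin': "finite (E `` {x})" for x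
  proof (cases "x \<in> V")
    case False
    then have "E `` {x} = {}" using E(1) by auto
    then show ?thesis by simp
  qed (rule fin)
  have sum_nn: "(\<integral>\<^sup>+x. (\<Sum>y\<in>E `` {x}. h x y) \<partial>count_space V) =
      (\<integral>\<^sup>+x. (\<integral>\<^sup>+y. h x y * indicator E (x, y) \<partial>count_space UNIV) \<partial>count_space UNIV)" for h :: "'a \<Rightarrow> 'a \<Rightarrow> ennreal"
  proof -
    have "(\<integral>\<^sup>+y. h x y * indicator E (x, y) \<partial>count_space UNIV) = (\<Sum>y\<in>E `` {x}. h x y)" for x
    proof -
      have "(\<integral>\<^sup>+y. h x y * indicator E (x, y) \<partial>count_space UNIV) = (\<integral>\<^sup>+y. h x y * indicator (E `` {x}) y \<partial>count_space UNIV)"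
        by (intro nn_integral_cong) (auto simp: indicator_def)
      also have "\<dots> = (\<integral>\<^sup>+y. h x y \<partial>count_space (E `` {x}))" by (simp add: nn_integral_count_space_indicator)
      also have "\<dots> = (\<Sum>y\<in>E `` {x}. h x y)" using fin' by (rule nn_integral_count_space_finite)
      finally show ?thesis .
    qed
    moreover have "(\<integral>\<^sup>+x. (\<Sum>y\<in>E `` {x}. h x y) \<partial>count_space V) = (\<integral>\<^sup>+x. (\<Sum>y\<in>E `` {x}. h x y) * indicator V x \<partial>count_space UNIV)"
      by (simp add: nn_integral_count_space_indicator)
    moreover have "(\<Sum>y\<in>E `` {x}. h x y) * indicator V x = (\<Sum>y\<in>E `` {x}. h x y)" for x
    proof (cases "x \<in> V")
      case False
      then have "E `` {x} = {}" using E(1) by auto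
      then show ?thesis by simp
    qed simp
    ultimately show ?thesis by simp
  qed
  have symE: "indicator E (x, y) = (indicator E (y, x) :: ennreal)" for x y
    using E(2) by (auto simp: indicator_def dest: symD)
  have "(\<integral>\<^sup>+x. (\<Sum>y\<in>E `` {x}. g (x, y)) \<partial>count_space V) =
      (\<integral>\<^sup>+p. g p * indicator E p \<partial>count_space UNIV)"
    unfolding sum_nn by (rule nn_integral_fst_count_space)
  also have "\<dots> = (\<integral>\<^sup>+y. (\<integral>\<^sup>+x. g (x, y) * indicator E (x, y) \<partial>count_space UNIV) \<partial>count_space UNIV)"
    by (rule nn_integral_snd_count_space[symmetric])
  also have "\<dots> = (\<integral>\<^sup>+x. (\<Sum>y\<in>E `` {x}. g (y, x)) \<partial>count_space V)"
    unfolding sum_nn by (simp only: symE)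
  finally show ?thesis .
qed

lemma bounded_convex_sequence:
  fixes d :: "nat \<Rightarrow> real"
  assumes convex: "\<And>n. 2 * d (Suc n) \<le> d n + d (Suc (Suc n))" and bounded: "\<And>n. d n \<le> D"
  shows "d 1 \<le> d 0"
proof (rule ccontr)
  assume "\<not> ?thesis"
  then have pos: "d 1 - d 0 > 0" by simp
  have step: "d (Suc n) - d n \<ge> d 1 - d 0" for n
  proof (induction n)
    case (Suc n)
    then show ?case using convex[of n] by linarith
  qed simp
  have lin: "d n \<ge> d 0 + real n * (d 1 - d 0)" for n
  proof (induction n)
    case (Suc n)
    have "real (Suc n) * (d 1 - d 0) = real n * (d 1 - d 0) + (d 1 - d 0)" by (simp add: algebra_simps)
    then show ?case using Suc step[of n] by linarith
  qed simp
  obtain n where "D - d 0 < real n * (d 1 - d 0)" using reals_Archimedean3[OF pos] by blast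
  then show False using lin[of n] bounded[of n] by linarith
qed

locale rooted_network =
  fixes V :: "'a set" and E :: "('a \<times> 'a) set" and r :: 'a
  assumes edges: "E \<subseteq> V \<times> V" and sym_edges: "sym E"
    and locally_finite: "\<And>x. x \<in> V \<Longrightarrow> finite (E `` {x})"
    and connected: "V = E\<^sup>* `` {r}"
    and degree_pos: "\<And>x. x \<in> V \<Longrightarrow> 0 < degree E x"
begin

abbreviation "N \<equiv> degree_measure V E"

lemma sets_N: "sets N = Pow V" and space_N: "space N = V"
  by (simp_all add: degree_measure_def sets_point_measure space_point_measure)

lemma measurable_N: "f \<in> borel_measurable N"
  unfolding degree_measure_def by simp

lemma root_in: "r \<in> V"
  using connected by auto

lemma countable_V: "countable V"
proof -
  have "countable (E `` Y)" if "countable Y" for Y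
  proof -
    have "countable (E `` {y})" for y
    proof (cases "y \<in> V")
      case False
      then have "E `` {y} = {}" using edges by auto
      then show ?thesis by simp
    qed (use locally_finite countable_finite in blast)
    moreover have "E `` Y = (\<Union>y\<in>Y. E `` {y})" by auto
    ultimately show ?thesis using that by simp
  qed
  then show ?thesis unfolding connected by (intro countable_rtrancl) auto
qed

sublocale reversible_graph N E
proof
  show "markov E f \<in> borel_measurable N" for f by (rule measurable_N)
  show "AE x in N. degree E x \<noteq> 0"
    using degree_pos by (intro AE_I2) (auto simp: space_N)
  fix u v :: "'a \<Rightarrow> real" assume nonneg: "\<And>x. 0 \<le> u x" "\<And>x. 0 \<le> v x"
  have int: "(\<integral>\<^sup>+x. ennreal (v x * avg E u x) \<partial>N) = (\<integral>\<^sup>+x. (\<Sum>y\<in>E `` {x}. ennreal (v x) * ennreal (u y)) \<partial>count_space V)"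
    if "\<And>x. 0 \<le> u x" "\<And>x. 0 \<le> v x" for u v :: "'a \<Rightarrow> real"
  proof -
    have "(\<integral>\<^sup>+x. ennreal (v x * avg E u x) \<partial>N) = (\<integral>\<^sup>+x. of_nat (degree E x) * ennreal (v x * avg E u x) \<partial>count_space V)"
      unfolding degree_measure_def point_measure_def by (rule nn_integral_density) auto
    also have "\<dots> = (\<integral>\<^sup>+x. (\<Sum>y\<in>E `` {x}. ennreal (v x) * ennreal (u y)) \<partial>count_space V)"
    proof (rule nn_integral_cong)
      fix x assume "x \<in> space (count_space V)"
      then have d: "0 < degree E x" using degree_pos by simp
      have "of_nat (degree E x) * ennreal (v x * avg E u x) = ennreal (real (degree E x) * (v x * avg E u x))"
        using that by (simp add: ennreal_mult avg_nonneg ennreal_of_nat_eq_real_of_nat)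
      also have "real (degree E x) * (v x * avg E u x) = v x * (\<Sum>y\<in>E `` {x}. u y)"
        using d by (simp add: avg_def)
      also have "\<dots> = (\<Sum>y\<in>E `` {x}. v x * u y)" by (rule sum_distrib_left)
      also have "ennreal (\<Sum>y\<in>E `` {x}. v x * u y) = (\<Sum>y\<in>E `` {x}. ennreal (v x) * ennreal (u y))"
        using that by (simp add: sum_ennreal[symmetric] ennreal_mult)
      finally show "of_nat (degree E x) * ennreal (v x * avg E u x) = (\<Sum>y\<in>E `` {x}. ennreal (v x) * ennreal (u y))" .
    qed
    finally show ?thesis .
  qed
  show "(\<integral>\<^sup>+x. ennreal (v x * avg E u x) \<partial>N) = (\<integral>\<^sup>+x. ennreal (u x * avg E v x) \<partial>N)"
    unfolding int[OF nonneg] int[OF nonneg(2,1)]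
    using nn_integral_edge_swap[OF edges sym_edges locally_finite, of "\<lambda>(x, y). ennreal (v x) * ennreal (u y)"]
    by (simp add: mult.commute)
qed

lemma emeasure_singleton: "x \<in> V \<Longrightarrow> emeasure N {x} = ennreal (real (degree E x))"
  unfolding degree_measure_def by (simp add: emeasure_point_measure_finite2 ennreal_of_nat_eq_real_of_nat)

lemma singleton_integrable:
  assumes "x \<in> V"
  shows "integrable N (\<lambda>y. indicator {x} y * a :: real)" "(\<integral>y. indicator {x} y * a \<partial>N) = real (degree E x) * a"
proof -
  have s: "{x} \<in> sets N" "emeasure N {x} < \<infinity>" using assms by (auto simp: sets_N emeasure_singleton)
  show "integrable N (\<lambda>y. indicator {x} y * a :: real)"
    using s by (intro integrable_mult_left) auto
  show "(\<integral>y. indicator {x} y * a \<partial>N) = real (degree E x) * a"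
    using s assms by (simp add: measure_def emeasure_singleton space_N)
qed

lemma square_integrable_singleton:
  assumes "x \<in> V"
  shows "square_integrable (indicator {x})"
proof -
  have "(\<lambda>y. (indicator {x} y)\<^sup>2) = (\<lambda>y. indicator {x} y * (1 :: real))" by (auto simp: indicator_def)
  then show ?thesis
    unfolding square_integrable_def using singleton_integrable(1)[OF assms, of 1] measurable_N by simp
qed

text \<open>
  Nonnegative functions whose iterates grow at most like \<open>c\<^sup>n\<close> in norm. They form a cone that is closed under
  domination and under the walk. If the root belongs to it, then by connectedness so does every vertex, and
  hence every finitely supported function.
\<close>

definition tempered :: "real \<Rightarrow> ('a \<Rightarrow> real) \<Rightarrow> bool" where
  "tempered c w \<longleftrightarrow> square_integrable w \<and> (\<forall>x. 0 \<le> w x) \<and>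
     (\<exists>D. \<forall>n. (\<integral>x. ((avg E ^^ n) w x)\<^sup>2 \<partial>N) \<le> D * c ^ (2 * n))"

lemma square_integrable_mono:
  assumes "square_integrable w" "\<And>x. 0 \<le> u x" "\<And>x. u x \<le> w x"
  shows "square_integrable u" "(\<integral>x. (u x)\<^sup>2 \<partial>N) \<le> (\<integral>x. (w x)\<^sup>2 \<partial>N)"
proof -
  have le: "(u x)\<^sup>2 \<le> (w x)\<^sup>2" for x using assms by (intro power_mono) auto
  have w: "integrable N (\<lambda>x. (w x)\<^sup>2)" using assms(1) unfolding square_integrable_def by simp
  have u: "integrable N (\<lambda>x. (u x)\<^sup>2)"
    by (rule Bochner_Integration.integrable_bound[OF w measurable_N]) (use le in auto)
  show "square_integrable u" unfolding square_integrable_def using u measurable_N by simp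
  show "(\<integral>x. (u x)\<^sup>2 \<partial>N) \<le> (\<integral>x. (w x)\<^sup>2 \<partial>N)" by (rule integral_mono[OF u w le])
qed

lemma square_integrable_add:
  assumes "square_integrable u" "square_integrable w"
  shows "square_integrable (\<lambda>x. u x + w x)"
    "(\<integral>x. (u x + w x)\<^sup>2 \<partial>N) \<le> 2 * (\<integral>x. (u x)\<^sup>2 \<partial>N) + 2 * (\<integral>x. (w x)\<^sup>2 \<partial>N)"
proof -
  note L = assms[unfolded square_integrable_L2]
  show "square_integrable (\<lambda>x. u x + w x)"
    unfolding square_integrable_L2 using L2_add[OF L] by simp
  have "(cmod (complex_of_real (u x) + complex_of_real (w x)))\<^sup>2 = (u x + w x)\<^sup>2" for x
    by (metis norm_of_real of_real_add power2_abs)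
  then show "(\<integral>x. (u x + w x)\<^sup>2 \<partial>N) \<le> 2 * (\<integral>x. (u x)\<^sup>2 \<partial>N) + 2 * (\<integral>x. (w x)\<^sup>2 \<partial>N)"
    using L2_norm_add_square_le[OF L] by (simp add: L2_norm_square)
qed

lemma tempered_mono:
  assumes w: "tempered c w" and u: "\<And>x. 0 \<le> u x" "\<And>x. u x \<le> w x"
  shows "tempered c u"
proof -
  obtain D where D: "\<And>n. (\<integral>x. ((avg E ^^ n) w x)\<^sup>2 \<partial>N) \<le> D * c ^ (2 * n)" and wsi: "square_integrable w"
    using w unfolding tempered_def by blast
  have "(\<integral>x. ((avg E ^^ n) u x)\<^sup>2 \<partial>N) \<le> D * c ^ (2 * n)" for n
    using square_integrable_mono(2)[OF square_integrable_iter_avg[OF wsi] iter_avg_nonneg[OF u(1)] iter_avg_mono[OF u(2)]] D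
    by (rule order_trans)
  then show ?thesis unfolding tempered_def using square_integrable_mono(1)[OF wsi u] u(1) by blast
qed

lemma iter_avg_add: "(avg E ^^ n) (\<lambda>x. u x + w x) = (\<lambda>x. (avg E ^^ n) u x + (avg E ^^ n) w x)"
  by (induction n) (auto simp: avg_add)

lemma iter_avg_scale: "(avg E ^^ n) (\<lambda>x. a * u x) = (\<lambda>x. a * (avg E ^^ n) u x)"
  by (induction n) (auto simp: avg_scale)

lemma tempered_add:
  assumes "tempered c u" "tempered c w"
  shows "tempered c (\<lambda>x. u x + w x)"
proof -
  obtain D1 D2 where D: "\<And>n. (\<integral>x. ((avg E ^^ n) u x)\<^sup>2 \<partial>N) \<le> D1 * c ^ (2 * n)"
      "\<And>n. (\<integral>x. ((avg E ^^ n) w x)\<^sup>2 \<partial>N) \<le> D2 * c ^ (2 * n)"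
    using assms unfolding tempered_def by blast
  have si: "square_integrable u" "square_integrable w" using assms unfolding tempered_def by auto
  have "(\<integral>x. ((avg E ^^ n) (\<lambda>x. u x + w x) x)\<^sup>2 \<partial>N) \<le> (2 * D1 + 2 * D2) * c ^ (2 * n)" for n
    unfolding iter_avg_add
    using square_integrable_add(2)[OF square_integrable_iter_avg[OF si(1), of n] square_integrable_iter_avg[OF si(2), of n]] D[of n]
    by (simp add: distrib_right)
  then show ?thesis
    unfolding tempered_def using square_integrable_add(1)[OF si] assms unfolding tempered_def by fastforce
qed

lemma tempered_scale:
  assumes "tempered c u" "0 \<le> a"
  shows "tempered c (\<lambda>x. a * u x)"
proof -
  obtain D where D: "\<And>n. (\<integral>x. ((avg E ^^ n) u x)\<^sup>2 \<partial>N) \<le> D * c ^ (2 * n)"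
    using assms unfolding tempered_def by blast
  have si: "square_integrable u" using assms unfolding tempered_def by auto
  have "(\<integral>x. ((avg E ^^ n) (\<lambda>x. a * u x) x)\<^sup>2 \<partial>N) \<le> (a\<^sup>2 * D) * c ^ (2 * n)" for n
    unfolding iter_avg_scale power_mult_distrib using D[of n] by (simp add: mult_left_mono mult.assoc)
  moreover have "square_integrable (\<lambda>x. a * u x)"
    using si measurable_N unfolding square_integrable_def by (simp add: power_mult_distrib)
  ultimately show ?thesis using assms unfolding tempered_def by auto
qed

lemma tempered_avg:
  assumes "tempered c u"
  shows "tempered c (avg E u)"
proof -
  obtain D where D: "\<And>n. (\<integral>x. ((avg E ^^ n) u x)\<^sup>2 \<partial>N) \<le> D * c ^ (2 * n)"
    using assms unfolding tempered_def by blast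
  have "(\<integral>x. ((avg E ^^ n) (avg E u) x)\<^sup>2 \<partial>N) \<le> (D * c\<^sup>2) * c ^ (2 * n)" for n
    using D[of "Suc n"] by (simp add: funpow_swap1 power2_eq_square mult.assoc)
  moreover have "square_integrable (avg E u)" "0 \<le> avg E u x" for x
    using assms unfolding tempered_def by (auto intro: square_integrable_avg avg_nonneg)
  ultimately show ?thesis
    unfolding tempered_def by (intro conjI allI exI[of _ "D * c\<^sup>2"])
qed

lemma tempered_root:
  assumes K: "\<And>n. (avg E ^^ (2 * n)) (indicator {r}) r \<le> K * c ^ (2 * n)"
  shows "tempered c (indicator {r})"
proof -
  note si = square_integrable_singleton[OF root_in]
  have "(\<integral>x. ((avg E ^^ n) (indicator {r}) x)\<^sup>2 \<partial>N) \<le> (real (degree E r) * K) * c ^ (2 * n)" for n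
  proof -
    have "(\<integral>x. ((avg E ^^ n) (indicator {r}) x)\<^sup>2 \<partial>N) = (\<integral>x. indicator {r} x * (avg E ^^ (2 * n)) (indicator {r}) x \<partial>N)"
      using iter_avg_selfadjoint[OF si si, of n n] by (simp add: mult_2 power2_eq_square)
    also have "\<dots> = (\<integral>x. indicator {r} x * (avg E ^^ (2 * n)) (indicator {r}) r \<partial>N)"
      by (intro Bochner_Integration.integral_cong) (auto simp: indicator_def)
    also have "\<dots> = real (degree E r) * (avg E ^^ (2 * n)) (indicator {r}) r"
      by (rule singleton_integrable(2)[OF root_in])
    also have "\<dots> \<le> real (degree E r) * (K * c ^ (2 * n))" using K by (intro mult_left_mono) auto
    finally show ?thesis by (simp add: mult.assoc)
  qed
  then show ?thesis unfolding tempered_def using si by auto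
qed

text \<open>
  Along an edge from \<open>u\<close> to \<open>w\<close>, the indicator of \<open>w\<close> is at most \<open>deg w\<close> times the average of the indicator of
  \<open>u\<close>.
\<close>

lemma tempered_vertex:
  assumes root: "tempered c (indicator {r})" and u: "u \<in> V"
  shows "tempered c (indicator {u})"
proof -
  have "(r, u) \<in> E\<^sup>*" using u connected by auto
  then show ?thesis
  proof (induction rule: rtrancl_induct)
    case (step u w)
    have wV: "w \<in> V" and uw: "u \<in> E `` {w}" using step(2) edges sym_edges by (auto dest: symD)
    have t: "tempered c (\<lambda>x. real (degree E w) * avg E (indicator {u}) x)"
      by (intro tempered_scale tempered_avg step) simp
    have "indicator {w} x \<le> real (degree E w) * avg E (indicator {u}) x" for x
    proof (cases "x = w")
      case True
      have "1 = (\<Sum>y\<in>{u}. indicator {u} y :: real)" by simp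
      also have "\<dots> \<le> (\<Sum>y\<in>E `` {w}. indicator {u} y)"
        using uw locally_finite[OF wV] by (intro sum_mono2) auto
      finally show ?thesis using degree_pos[OF wV] True by (simp add: avg_def)
    next
      case False
      then show ?thesis by (simp add: avg_nonneg)
    qed
    then show ?case by (intro tempered_mono[OF t]) simp_all
  qed (rule root)
qed

lemma tempered_finite_support:
  assumes root: "tempered c (indicator {r})" and F: "finite F" "F \<subseteq> V" and u: "\<And>x. 0 \<le> u x"
  shows "tempered c (\<lambda>x. indicator F x * u x)"
  using F
proof (induction F rule: finite_induct)
  case empty
  have "tempered c (\<lambda>x. 0 * indicator {r} x)" by (rule tempered_scale[OF root]) simp
  then show ?case by simp
next
  case (insert y F)
  have "tempered c (\<lambda>x. u y * indicator {y} x + indicator F x * u x)"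
    using insert tempered_vertex[OF root, of y] u by (intro tempered_add tempered_scale) auto
  moreover have "(\<lambda>x. u y * indicator {y} x + indicator F x * u x) = (\<lambda>x. indicator (insert y F) x * u x)"
    using insert(2) by (auto simp: indicator_def)
  ultimately show ?case by simp
qed

lemma norm_markov_le: "cmod (markov E f x) \<le> avg E (\<lambda>y. cmod (f y)) x"
  unfolding markov_def avg_def using norm_sum[of f "E `` {x}"]
  by (simp add: norm_mult norm_divide divide_right_mono)

lemma norm_iter_markov_le: "cmod ((markov E ^^ n) f x) \<le> (avg E ^^ n) (\<lambda>y. cmod (f y)) x"
proof (induction n arbitrary: x)
  case (Suc n)
  have "cmod ((markov E ^^ Suc n) f x) \<le> avg E (\<lambda>y. cmod ((markov E ^^ n) f y)) x" by (simp add: norm_markov_le)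
  also have "\<dots> \<le> avg E ((avg E ^^ n) (\<lambda>y. cmod (f y))) x" by (rule avg_mono) (rule Suc)
  finally show ?case by simp
qed simp

text \<open>
  Let \<open>d n = \<parallel>M\<^sup>n f\<parallel>\<^sup>2 / c\<^bsup>2n\<^esup>\<close>. Symmetry and the inequality \<open>2 a b \<le> a\<^sup>2 / c\<^sup>2 + c\<^sup>2 b\<^sup>2\<close> make this sequence midpoint
  convex. It is bounded because \<open>f\<close> is tempered, and a bounded convex sequence cannot increase. So
  \<open>d 1 \<le> d 0\<close>, which is the claim.
\<close>

lemma norm_bound_finite_support:
  assumes c: "0 < c" and temp: "tempered c (\<lambda>x. cmod (f x))"
  shows "L2_norm N (markov E f) \<le> c * L2_norm N f"
proof -
  interpret L2_operator N "L2 N" "markov E" by (rule L2_operator_markov)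
  have f: "f \<in> L2 N" using temp measurable_N unfolding tempered_def square_integrable_def L2_def by auto
  obtain D where D: "\<And>n. (\<integral>x. ((avg E ^^ n) (\<lambda>x. cmod (f x)) x)\<^sup>2 \<partial>N) \<le> D * c ^ (2 * n)"
    and si: "square_integrable (\<lambda>x. cmod (f x))"
    using temp unfolding tempered_def by blast
  define m where "m n = (L2_norm N ((markov E ^^ n) f))\<^sup>2" for n
  have mD: "m n \<le> D * c ^ (2 * n)" for n
  proof -
    have "m n \<le> (\<integral>x. ((avg E ^^ n) (\<lambda>x. cmod (f x)) x)\<^sup>2 \<partial>N)"
      unfolding m_def L2_norm_square
      using square_integrable_iter_avg[OF si] by (intro square_integrable_mono(2) norm_iter_markov_le) auto
    then show ?thesis using D[of n] by linarith
  qed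
  have mconv: "2 * m (Suc n) \<le> c\<^sup>2 * m n + m (Suc (Suc n)) / c\<^sup>2" for n
  proof -
    let ?g = "(markov E ^^ n) f"
    have g: "?g \<in> L2 N" by (rule Tn_H[OF f])
    have g2: "markov E (markov E ?g) \<in> L2 N" by (intro T_H g)
    have pw: "2 * Re (a * cnj b) \<le> (cmod a)\<^sup>2 / c\<^sup>2 + c\<^sup>2 * (cmod b)\<^sup>2" for a b
    proof -
      have "Re (a * cnj b) \<le> cmod a * cmod b"
        using complex_Re_le_cmod[of "a * cnj b"] by (simp add: norm_mult)
      moreover have "2 * (cmod a / c) * (c * cmod b) \<le> (cmod a / c)\<^sup>2 + (c * cmod b)\<^sup>2"
        by (rule sum_squares_bound)
      then have "2 * (cmod a * cmod b) \<le> (cmod a)\<^sup>2 / c\<^sup>2 + c\<^sup>2 * (cmod b)\<^sup>2"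
        using c by (simp add: power_divide power_mult_distrib)
      ultimately show ?thesis by linarith
    qed
    have int: "integrable N (\<lambda>x. (cmod (markov E (markov E ?g) x))\<^sup>2 / c\<^sup>2 + c\<^sup>2 * (cmod (?g x))\<^sup>2)"
      using L2_integrable[OF g] L2_integrable[OF g2] by simp
    have "m (Suc n) = (\<integral>x. Re (markov E (markov E ?g) x * cnj (?g x)) \<partial>N)"
      unfolding markov_selfadjoint[OF g] m_def by simp
    then have "2 * m (Suc n) = (\<integral>x. 2 * Re (markov E (markov E ?g) x * cnj (?g x)) \<partial>N)"
      by (simp only: integral_mult_right_zero)
    also have "\<dots> \<le> (\<integral>x. (cmod (markov E (markov E ?g) x))\<^sup>2 / c\<^sup>2 + c\<^sup>2 * (cmod (?g x))\<^sup>2 \<partial>N)"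
      by (rule integral_mono'[OF int pw]) simp
    also have "\<dots> = m (Suc (Suc n)) / c\<^sup>2 + c\<^sup>2 * m n"
      using L2_integrable[OF g] L2_integrable[OF g2] unfolding m_def L2_norm_square by simp
    finally show ?thesis by simp
  qed
  define d where "d n = m n / c ^ (2 * n)" for n
  have "d 1 \<le> d 0"
  proof (rule bounded_convex_sequence)
    show "d n \<le> D" for n using mD[of n] c unfolding d_def by (simp add: divide_le_eq)
    show "2 * d (Suc n) \<le> d n + d (Suc (Suc n))" for n
    proof -
      have "2 * m (Suc n) / c ^ (2 * Suc n) \<le> (c\<^sup>2 * m n + m (Suc (Suc n)) / c\<^sup>2) / c ^ (2 * Suc n)"
        using mconv[of n] c by (intro divide_right_mono) auto
      also have "\<dots> = m n / c ^ (2 * n) + m (Suc (Suc n)) / c ^ (2 * Suc (Suc n))"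
        using c by (simp add: add_divide_distrib power2_eq_square)
      finally show ?thesis unfolding d_def by simp
    qed
  qed
  then have "(L2_norm N (markov E f))\<^sup>2 \<le> (c * L2_norm N f)\<^sup>2"
    using c unfolding d_def m_def by (simp add: divide_le_eq power2_eq_square mult_ac)
  then show ?thesis by (rule power2_le_imp_le) (use c L2_norm_nonneg[of N f] in simp)
qed

text \<open>
  On a finite set \<open>F n\<close> of vertices, \<open>M f\<close> depends only on the values of \<open>f\<close> at the finitely many neighbours, so
  \<open>norm_bound_finite_support\<close> applies to the restriction of \<open>f\<close> to these. The sets \<open>F n\<close> exhaust the vertices.
\<close>

lemma norm_bound:
  assumes c: "0 < c" and root: "tempered c (indicator {r})" and f: "f \<in> L2 N"
  shows "L2_norm N (markov E f) \<le> c * L2_norm N f"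
proof -
  let ?h = "\<lambda>x. (cmod (markov E f x))\<^sup>2"
  define F where "F n = from_nat_into V ` {..<n}" for n :: nat
  have V0: "V \<noteq> {}" using root_in by auto
  have F: "finite (F n)" "F n \<subseteq> V" for n unfolding F_def using from_nat_into[OF V0] by auto
  have hint: "integrable N ?h" by (rule L2_integrable[OF markov_L2(1)[OF f]])
  have part: "(\<integral>x. indicator (F n) x * ?h x \<partial>N) \<le> c\<^sup>2 * (L2_norm N f)\<^sup>2" for n
  proof -
    define F' where "F' = (\<Union>x\<in>F n. E `` {x})"
    have F': "finite F'" "F' \<subseteq> V" unfolding F'_def using F[of n] locally_finite edges by auto
    let ?g = "\<lambda>x. indicator F' x * f x"
    have temp: "tempered c (\<lambda>x. cmod (?g x))"
    proof -
      have "(\<lambda>x. cmod (?g x)) = (\<lambda>x. indicator F' x * cmod (f x))" by (auto simp: indicator_def)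
      then show ?thesis using tempered_finite_support[OF root F', of "\<lambda>x. cmod (f x)"] by simp
    qed
    have g: "?g \<in> L2 N" using temp measurable_N unfolding tempered_def square_integrable_def L2_def by auto
    have eq: "markov E ?g x = markov E f x" if "x \<in> F n" for x
      unfolding markov_def using that by (intro arg_cong2[where f = times] sum.cong) (auto simp: F'_def indicator_def)
    have "(\<integral>x. indicator (F n) x * ?h x \<partial>N) \<le> (\<integral>x. (cmod (markov E ?g x))\<^sup>2 \<partial>N)"
    proof (rule integral_mono)
      show "integrable N (\<lambda>x. indicator (F n) x * ?h x)"
        by (rule Bochner_Integration.integrable_bound[OF hint measurable_N]) (auto simp: indicator_def)
      show "integrable N (\<lambda>x. (cmod (markov E ?g x))\<^sup>2)" by (rule L2_integrable[OF markov_L2(1)[OF g]])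
      show "indicator (F n) x * ?h x \<le> (cmod (markov E ?g x))\<^sup>2" for x
        using eq[of x] by (auto simp: indicator_def)
    qed
    also have "\<dots> = (L2_norm N (markov E ?g))\<^sup>2" by (simp add: L2_norm_square)
    also have "\<dots> \<le> (c * L2_norm N ?g)\<^sup>2"
      using norm_bound_finite_support[OF c temp] L2_norm_nonneg by (intro power_mono)
    also have "\<dots> \<le> c\<^sup>2 * (L2_norm N f)\<^sup>2"
      unfolding power_mult_distrib L2_norm_square
    proof (intro mult_left_mono integral_mono L2_integrable g f)
      show "(cmod (?g x))\<^sup>2 \<le> (cmod (f x))\<^sup>2" for x by (simp add: indicator_def)
    qed simp
    finally show ?thesis .
  qed
  have "(\<lambda>n. \<integral>x. indicator (F n) x * ?h x \<partial>N) \<longlonglongrightarrow> (\<integral>x. ?h x \<partial>N)"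
  proof (rule integral_dominated_convergence[where w = ?h])
    show "AE x in N. (\<lambda>n. indicator (F n) x * ?h x) \<longlonglongrightarrow> ?h x"
    proof (rule AE_I2)
      fix x assume "x \<in> space N"
      then obtain k where k: "from_nat_into V k = x" using from_nat_into_surj[OF countable_V] space_N by blast
      then have "x \<in> F n" if "n \<ge> Suc k" for n using that unfolding F_def by auto
      then have "\<forall>\<^sub>F n in sequentially. indicator (F n) x * ?h x = ?h x"
        unfolding eventually_sequentially by (intro exI[of _ "Suc k"]) auto
      then show "(\<lambda>n. indicator (F n) x * ?h x) \<longlonglongrightarrow> ?h x" by (rule tendsto_eventually)
    qed
    show "AE x in N. norm (indicator (F n) x * ?h x) \<le> ?h x" for n by (auto simp: indicator_def)
  qed (use hint measurable_N in auto)
  then have "(\<integral>x. ?h x \<partial>N) \<le> c\<^sup>2 * (L2_norm N f)\<^sup>2"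
    by (rule LIMSEQ_le_const2) (use part in auto)
  then have "(L2_norm N (markov E f))\<^sup>2 \<le> (c * L2_norm N f)\<^sup>2"
    by (simp add: L2_norm_square power_mult_distrib)
  then show ?thesis by (rule power2_le_imp_le) (use c L2_norm_nonneg[of N f] in simp)
qed

lemma spectrum_nonempty: "op_spectrum N (L2 N) (markov E) \<noteq> {}"
proof -
  interpret L2_operator N "L2 N" "markov E" by (rule L2_operator_markov)
  have bd: "L2_norm N (markov E f) \<le> 1 * L2_norm N f" if "f \<in> L2 N" for f
    using markov_L2(2)[OF that] by simp
  have f0: "(\<lambda>x. complex_of_real (indicator {r} x)) \<in> L2 N"
    using square_integrable_singleton[OF root_in] square_integrable_L2 by blast
  have "(L2_norm N (\<lambda>x. complex_of_real (indicator {r} x)))\<^sup>2 = (\<integral>x. indicator {r} x * 1 \<partial>N)"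
    unfolding L2_norm_square by (intro Bochner_Integration.integral_cong) (auto simp: indicator_def)
  also have "\<dots> = real (degree E r) * 1" by (rule singleton_integrable(2)[OF root_in])
  finally have "L2_norm N (\<lambda>x. complex_of_real (indicator {r} x)) \<noteq> 0"
    using degree_pos[OF root_in] by auto
  then show ?thesis
    using selfadjoint_norm_attained[OF bd markov_selfadjoint f0] by blast
qed

lemma spectrum_bound:
  assumes K: "\<And>n. (avg E ^^ (2 * n)) (indicator {r}) r \<le> K * c ^ (2 * n)" and c: "0 < c"
    and z: "z \<in> op_spectrum N (L2 N) (markov E)"
  shows "cmod z \<le> c"
proof (rule ccontr)
  interpret L2_operator N "L2 N" "markov E" by (rule L2_operator_markov)
  assume "\<not> ?thesis"
  then have "z \<notin> op_spectrum N (L2 N) (markov E)"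
    using c norm_bound[OF c tempered_root[OF K]] by (intro not_in_spectrum[of c]) auto
  then show False using z by simp
qed

end

section \<open>Graphings\<close>

text \<open>
  Every point \<open>x\<close> is the intersection of the decreasing cells \<open>cell (n, \<phi> n x)\<close> of points whose first \<open>n\<close> coordinates
  agree with those of \<open>x\<close> up to dyadic precision \<open>n\<close>. As \<open>x\<close> has mass zero, one of these cells has mass at most
  \<open>\<epsilon>\<close>. There are only countably many cells, so the small ones can be made disjoint.
\<close>

lemma fine_partition:
  fixes N :: "'a measure"
  assumes M: "standard_borel M" and sets_eq: "sets N = sets M" and N: "finite_measure N"
    and atomless: "\<And>x. x \<in> space N \<Longrightarrow> {x} \<in> sets N \<Longrightarrow> measure N {x} = 0" and eps: "\<epsilon> > 0"
  shows "\<exists>A :: nat \<Rightarrow> 'a set. range A \<subseteq> sets N \<and> disjoint_family A \<and> (\<Union>i. A i) = space N \<and> (\<forall>i. measure N (A i) \<le> \<epsilon>)"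
proof (cases "space N = {}")
  case True
  then show ?thesis using eps by (intro exI[of _ "\<lambda>_. {}"]) (auto simp: disjoint_family_on_def)
next
  case False
  interpret finite_measure N by (rule N)
  have sp: "space M = space N" using sets_eq_imp_space_eq[OF sets_eq] by simp
  obtain e :: "'a \<Rightarrow> (nat \<Rightarrow> real)" and h where e: "e \<in> M \<rightarrow>\<^sub>M borel" and he: "\<And>x. x \<in> space M \<Longrightarrow> h (e x) = x"
    using standard_borel_retract[OF M] False sp by metis
  have em[measurable]: "(\<lambda>x. e x k) \<in> borel_measurable N" for k
    using measurable_compose[OF e measurable_product_coordinates[of k]] by (simp add: measurable_cong_sets[OF sets_eq refl])
  define \<phi> where "\<phi> n x = map (\<lambda>k. \<lfloor>2 ^ n * e x k\<rfloor>) [0..<n]" for n x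
  define cell where "cell = (\<lambda>(n, l). {x \<in> space N. \<phi> n x = l})"
  have cell_eq: "cell (n, \<phi> n x) = {y \<in> space N. \<forall>k\<in>{..<n}. \<lfloor>2 ^ n * e y k\<rfloor> = \<lfloor>2 ^ n * e x k\<rfloor>}" for n x
    unfolding cell_def \<phi>_def by auto
  have cell_sets: "cell (n, \<phi> n x) \<in> sets N" for n x
    unfolding cell_eq by measurable
  have cell_sets': "cell p \<in> sets N" for p
  proof (cases "cell p = {}")
    case False
    then obtain x where "\<phi> (fst p) x = snd p" unfolding cell_def by (auto split: prod.splits)
    then show ?thesis using cell_sets[of "fst p" x] by simp
  qed simp
  have small: "\<exists>n. measure N (cell (n, \<phi> n x)) \<le> \<epsilon>" if x: "x \<in> space N" for x
  proof -
    have dec: "cell (Suc n, \<phi> (Suc n) x) \<subseteq> cell (n, \<phi> n x)" for n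
    proof
      fix y assume "y \<in> cell (Suc n, \<phi> (Suc n) x)"
      then have y: "y \<in> space N" "\<And>k. k < Suc n \<Longrightarrow> \<lfloor>2 ^ Suc n * e y k\<rfloor> = \<lfloor>2 ^ Suc n * e x k\<rfloor>"
        unfolding cell_eq by auto
      have half: "\<lfloor>2 ^ n * t\<rfloor> = \<lfloor>2 ^ Suc n * t\<rfloor> div 2" for t :: real
        using floor_divide_real_eq_div[of 2 "2 ^ Suc n * t"] by simp
      show "y \<in> cell (n, \<phi> n x)"
        unfolding cell_eq half using y by auto
    qed
    then have decseq: "decseq (\<lambda>n. cell (n, \<phi> n x))" by (rule decseq_SucI)
    have "y = x" if y: "y \<in> (\<Inter>n. cell (n, \<phi> n x))" for y
    proof -
      have "e y k = e x k" for k
      proof (rule ccontr)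
        assume "e y k \<noteq> e x k"
        then have "0 < \<bar>e y k - e x k\<bar>" by simp
        then obtain n where n: "(1/2) ^ n < \<bar>e y k - e x k\<bar>" using real_arch_pow_inv[OF \<open>0 < \<bar>e y k - e x k\<bar>\<close>, of "1/2"] by auto
        define m where "m = max n (Suc k)"
        have "\<lfloor>2 ^ m * e y k\<rfloor> = \<lfloor>2 ^ m * e x k\<rfloor>"
          using y unfolding cell_eq m_def by auto
        then have "\<bar>2 ^ m * e y k - 2 ^ m * e x k\<bar> < 1" by linarith
        then have "2 ^ m * \<bar>e y k - e x k\<bar> < 1" by (simp add: abs_mult[symmetric] right_diff_distrib[symmetric])
        moreover have "(2::real) ^ n \<le> 2 ^ m" unfolding m_def by (intro power_increasing) auto
        then have "2 ^ n * \<bar>e y k - e x k\<bar> \<le> 2 ^ m * \<bar>e y k - e x k\<bar>" by (intro mult_right_mono) auto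
        moreover have "1 < 2 ^ n * \<bar>e y k - e x k\<bar>" using n by (simp add: power_divide field_simps)
        ultimately show False by linarith
      qed
      then have "e y = e x" by auto
      moreover have "y \<in> space N" using y unfolding cell_eq by auto
      ultimately show ?thesis using he x unfolding sp by metis
    qed
    moreover have "x \<in> cell (n, \<phi> n x)" for n using x unfolding cell_def by simp
    ultimately have Inter: "(\<Inter>n. cell (n, \<phi> n x)) = {x}" by blast
    moreover have "(\<Inter>n. cell (n, \<phi> n x)) \<in> sets N" using cell_sets by (intro sets.countable_INT) auto
    ultimately have "{x} \<in> sets N" by (simp only:)
    then have "measure N (\<Inter>n. cell (n, \<phi> n x)) = 0" using atomless[OF x] Inter by simp
    moreover have "(\<lambda>n. measure N (cell (n, \<phi> n x))) \<longlonglongrightarrow> measure N (\<Inter>n. cell (n, \<phi> n x))"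
      using cell_sets decseq by (intro finite_Lim_measure_decseq) auto
    ultimately have "\<forall>\<^sub>F n in sequentially. measure N (cell (n, \<phi> n x)) < \<epsilon>"
      using eps by (intro order_tendstoD(2)) auto
    then show ?thesis by (auto simp: eventually_sequentially intro: less_imp_le)
  qed
  define B where "B i = (let p = from_nat i in if measure N (cell p) \<le> \<epsilon> then cell p else {})" for i :: nat
  have B: "B i \<in> sets N" "measure N (B i) \<le> \<epsilon>" for i
    using cell_sets' eps unfolding B_def by (auto simp: Let_def)
  have "x \<in> (\<Union>i. B i)" if x: "x \<in> space N" for x
  proof -
    obtain n where n: "measure N (cell (n, \<phi> n x)) \<le> \<epsilon>" using small[OF x] by blast
    have "x \<in> B (to_nat (n, \<phi> n x))" using n x unfolding B_def by (simp add: Let_def cell_def)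
    then show ?thesis by blast
  qed
  moreover have "B i \<subseteq> space N" for i using sets.sets_into_space[OF B(1)] .
  ultimately have UB: "(\<Union>i. B i) = space N" by blast
  have "range B \<subseteq> sets N" using B(1) by auto
  then have dm: "range (disjointed B) \<subseteq> sets N" by (rule sets.range_disjointed_sets)
  have "measure N (disjointed B i) \<le> \<epsilon>" for i
  proof -
    have "measure N (disjointed B i) \<le> measure N (B i)"
      using B(1) disjointed_subset[of B i] by (intro finite_measure_mono) auto
    then show ?thesis using B(2)[of i] by linarith
  qed
  then show ?thesis
    using dm UB UN_disjointed_eq[of B] disjoint_family_disjointed[of B]
    by (intro exI[of _ "disjointed B"]) auto
qed

context graphing
begin

lemma edge_in_space: "(x, y) \<in> G \<Longrightarrow> x \<in> space M \<and> y \<in> space M"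
  using sets.sets_into_space[OF borel_graph] by (auto simp: space_pair_measure)

lemma finite_neighbours: "finite (G `` {x})"
proof (cases "x \<in> space M")
  case True
  then show ?thesis using bounded_degree by blast
next
  case False
  then have "G `` {x} = {}" using edge_in_space by auto
  then show ?thesis by simp
qed

lemma neighbour_sum_measurable:
  fixes f :: "'a \<times> 'a \<Rightarrow> 'b::{second_countable_topology, real_normed_vector}"
  assumes "f \<in> borel_measurable (M \<Otimes>\<^sub>M M)"
  shows "(\<lambda>x. \<Sum>y\<in>G `` {x}. f (x, y)) \<in> borel_measurable M"
proof -
  obtain D where "\<And>x. x \<in> space M \<Longrightarrow> finite (G `` {x}) \<and> card (G `` {x}) \<le> D"
    using bounded_degree unfolding degree_def by blast
  then show ?thesis
    by (intro borel_measurable_neighbour_sum[OF standard_borel_space not_empty borel_graph _ assms])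
qed

lemma degree_measurable: "(\<lambda>x. real (degree G x)) \<in> borel_measurable M"
  using neighbour_sum_measurable[of "\<lambda>_. 1 :: real"] by (simp add: degree_def)

lemma mass_transport_product:
  assumes m: "u \<in> borel_measurable M" "v \<in> borel_measurable M" and nonneg: "\<And>x. 0 \<le> u x" "\<And>x. 0 \<le> (v x :: real)"
  shows "(\<integral>\<^sup>+x. (\<Sum>y\<in>G `` {x}. ennreal (v x * u y)) \<partial>M) = (\<integral>\<^sup>+x. (\<Sum>y\<in>G `` {x}. ennreal (u x * v y)) \<partial>M)"
proof -
  let ?f = "\<lambda>p. v (fst p) * u (snd p)"
  have "?f \<in> borel_measurable (M \<Otimes>\<^sub>M M)" using m by measurable
  then have "?f \<in> borel_measurable (restrict_space (M \<Otimes>\<^sub>M M) G)" by (rule measurable_restrict_space1)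
  then have "(\<integral>\<^sup>+x. (\<Sum>y\<in>G `` {x}. ennreal (?f (y, x))) \<partial>M) = (\<integral>\<^sup>+x. (\<Sum>y\<in>G `` {x}. ennreal (?f (x, y))) \<partial>M)"
    by (rule mass_transport) (use nonneg in simp)
  then show ?thesis by (simp add: mult.commute)
qed

lemma singleton_sets:
  assumes "x \<in> space M"
  shows "{x} \<in> sets M"
proof -
  obtain e :: "'a \<Rightarrow> (nat \<Rightarrow> real)" and h where e: "e \<in> M \<rightarrow>\<^sub>M borel" and he: "\<And>x. x \<in> space M \<Longrightarrow> h (e x) = x"
    using standard_borel_retract[OF standard_borel_space not_empty] by metis
  have "{x} = e -` {e x} \<inter> space M" using he assms by (auto dest: arg_cong[of _ _ h])
  moreover have "{e x} \<in> sets borel" by simp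
  ultimately show ?thesis using measurable_sets[OF e] by metis
qed

text \<open>
  Mass transport along a single edge.
\<close>

lemma neighbour_mass_eq:
  assumes ab: "(a, b) \<in> G"
  shows "emeasure M {a} = emeasure M {b}"
proof -
  have s: "{a} \<in> sets M" "{b} \<in> sets M" using singleton_sets edge_in_space[OF ab] by auto
  let ?u = "indicator {b} :: 'a \<Rightarrow> real" and ?v = "indicator {a} :: 'a \<Rightarrow> real"
  have one: "(\<Sum>y\<in>G `` {x}. ennreal (indicator {c} x * indicator {d} y)) = (indicator {c} x :: ennreal)" if "(c, d) \<in> G" for c d x
  proof (cases "x = c")
    case True
    have "(\<Sum>y\<in>G `` {c}. ennreal (indicator {d} y)) = (\<Sum>y\<in>{d}. ennreal (indicator {d} y))"
      using that by (intro sum.mono_neutral_right finite_neighbours) auto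
    then show ?thesis using True by simp
  qed simp
  have ba: "(b, a) \<in> G" using ab symmetric by (auto dest: symD)
  have "(\<integral>\<^sup>+x. (\<Sum>y\<in>G `` {x}. ennreal (?v x * ?u y)) \<partial>M) = (\<integral>\<^sup>+x. (\<Sum>y\<in>G `` {x}. ennreal (?u x * ?v y)) \<partial>M)"
    using s by (intro mass_transport_product) auto
  then show ?thesis unfolding one[OF ab] one[OF ba] using s by simp
qed

end

locale aperiodic_graphing = graphing +
  assumes aperiodic: "aperiodic M G"
begin

lemma AE_infinite_component: "AE x in M. infinite (G\<^sup>* `` {x})"
  using aperiodic unfolding aperiodic_def rooted_component_def by (simp add: Let_def)

lemma degree_pos_component:
  assumes inf: "infinite (G\<^sup>* `` {x})" and u: "(x, u) \<in> G\<^sup>*"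
  shows "0 < degree G u"
proof -
  have "G `` {u} \<noteq> {}"
  proof (cases "u = x")
    case True
    show ?thesis
    proof
      assume "G `` {u} = {}"
      then have "G\<^sup>* `` {x} = {x}" using True by (auto elim: converse_rtranclE)
      then show False using inf by simp
    qed
  next
    case False
    then obtain w where "(w, u) \<in> G" using u by (auto elim: rtranclE)
    then show ?thesis using symmetric by (auto dest: symD)
  qed
  then show ?thesis unfolding degree_def using finite_neighbours by (simp add: card_gt_0_iff)
qed

lemma AE_degree_pos: "AE x in M. 0 < degree G x"
  using AE_infinite_component by eventually_elim (rule degree_pos_component, auto)

text \<open>
  All vertices of a component have the same mass by \<open>neighbour_mass_eq\<close>. A vertex of positive mass would lie in an
  infinite component, which would then have infinite mass.
\<close>

lemma atomless:
  assumes x: "x \<in> space M"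
  shows "measure M {x} = 0"
proof (rule ccontr)
  assume pos: "measure M {x} \<noteq> 0"
  have inf: "infinite (G\<^sup>* `` {x})"
  proof (rule ccontr)
    assume fin: "\<not> ?thesis"
    have "AE y in M. y \<notin> {x}" using AE_infinite_component by eventually_elim (use fin in auto)
    then have "{x} \<in> null_sets M" using AE_iff_null_sets[OF singleton_sets[OF x]] by blast
    then show False using pos by (simp add: measure_def null_setsD1)
  qed
  have eq: "y \<in> space M \<and> measure M {y} = measure M {x}" if "(x, y) \<in> G\<^sup>*" for y
    using that
  proof (induction rule: rtrancl_induct)
    case (step y z)
    then show ?case using neighbour_mass_eq[of y z] edge_in_space[of y z] by (auto simp: measure_def)
  qed (use x in simp)
  have m0: "0 < measure M {x}" using pos by (simp add: zero_less_measure_iff)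
  obtain n where n: "1 < real n * measure M {x}" using reals_Archimedean3[OF m0] by blast
  obtain F where F: "F \<subseteq> G\<^sup>* `` {x}" "finite F" "card F = n"
    using infinite_arbitrarily_large[OF inf] by blast
  have "measure M F = (\<Sum>y\<in>F. measure M {y})"
    using F eq singleton_sets by (intro measure_eq_sum_singleton) auto
  also have "\<dots> = (\<Sum>y\<in>F. measure M {x})" using F(1) eq by (intro sum.cong refl) blast
  also have "\<dots> = real n * measure M {x}" using F(3) by simp
  finally show False using n prob_le_1[of F] by simp
qed

definition mean_degree :: real where
  "mean_degree = (\<integral>y. real (degree G y) \<partial>M)"

lemma integrable_degree: "integrable M (\<lambda>x. real (degree G x))"
proof -
  obtain D where "\<And>x. x \<in> space M \<Longrightarrow> degree G x \<le> D" using bounded_degree by blast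
  then show ?thesis using degree_measurable by (intro integrable_const_bound[where B = "real D"]) auto
qed

lemma mean_degree_pos: "0 < mean_degree"
proof -
  have "(\<integral>x. 1 \<partial>M) \<le> mean_degree"
    unfolding mean_degree_def using AE_degree_pos integrable_degree
    by (intro integral_mono_AE) (auto elim: eventually_mono)
  then show ?thesis by (simp add: prob_space)
qed

abbreviation "N \<equiv> degree_biased M G"

lemma sets_N: "sets N = sets M" and space_N: "space N = space M"
  by (simp_all add: degree_biased_def)

lemma N_def: "N = density M (\<lambda>x. ennreal (real (degree G x) / mean_degree))"
  by (simp add: degree_biased_def mean_degree_def)

lemma density_measurable: "(\<lambda>x. ennreal (real (degree G x) / mean_degree)) \<in> borel_measurable M"
  using degree_measurable by measurable

text \<open>
  Almost all degrees are positive, so the degree-biased measure has the same null sets.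
\<close>

lemma AE_N_iff: "(AE x in N. P x) \<longleftrightarrow> (AE x in M. P x)"
proof -
  have "(AE x in N. P x) \<longleftrightarrow> (AE x in M. 0 < ennreal (real (degree G x) / mean_degree) \<longrightarrow> P x)"
    unfolding N_def by (rule AE_density[OF density_measurable])
  also have "\<dots> \<longleftrightarrow> (AE x in M. P x)"
  proof
    assume "AE x in M. 0 < ennreal (real (degree G x) / mean_degree) \<longrightarrow> P x"
    with AE_degree_pos show "AE x in M. P x"
      by eventually_elim (use mean_degree_pos in simp)
  qed (auto elim: eventually_mono)
  finally show ?thesis .
qed

lemma prob_space_N: "prob_space N"
proof
  have "emeasure N (space N) = (\<integral>\<^sup>+x. ennreal (real (degree G x) / mean_degree) \<partial>M)"
    unfolding N_def using density_measurable by (simp add: emeasure_density cong: nn_integral_cong)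
  also have "\<dots> = ennreal (\<integral>x. real (degree G x) / mean_degree \<partial>M)"
    using integrable_degree mean_degree_pos by (intro nn_integral_eq_integral) auto
  also have "(\<integral>x. real (degree G x) / mean_degree \<partial>M) = 1"
    using mean_degree_pos unfolding mean_degree_def by simp
  finally show "emeasure N (space N) = 1" by simp
qed

lemma reversible_graph_N: "reversible_graph N G"
proof
  fix f :: "'a \<Rightarrow> complex" assume "f \<in> borel_measurable N"
  then have f[measurable]: "f \<in> borel_measurable M" by (simp add: measurable_cong_sets[OF sets_N refl])
  have "(\<lambda>x. \<Sum>y\<in>G `` {x}. f y) \<in> borel_measurable M"
    using neighbour_sum_measurable[of "\<lambda>p. f (snd p)"] by simp
  moreover have "(\<lambda>x. complex_of_real (1 / real (degree G x))) \<in> borel_measurable M"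
    using degree_measurable by measurable
  ultimately have "(\<lambda>x. complex_of_real (1 / real (degree G x)) * (\<Sum>y\<in>G `` {x}. f y)) \<in> borel_measurable M"
    by measurable
  then show "markov G f \<in> borel_measurable N"
    unfolding markov_def[abs_def] measurable_cong_sets[OF sets_N refl] by simp
next
  show "AE x in N. degree G x \<noteq> 0"
    unfolding AE_N_iff using AE_degree_pos by eventually_elim simp
next
  fix u v :: "'a \<Rightarrow> real"
  assume "u \<in> borel_measurable N" "v \<in> borel_measurable N" and nonneg: "\<And>x. 0 \<le> u x" "\<And>x. 0 \<le> v x"
  then have m: "u \<in> borel_measurable M" "v \<in> borel_measurable M" by (simp_all add: measurable_cong_sets[OF sets_N refl])
  have int: "(\<integral>\<^sup>+x. ennreal (v x * avg G u x) \<partial>N) = ennreal (1 / mean_degree) * (\<integral>\<^sup>+x. (\<Sum>y\<in>G `` {x}. ennreal (v x * u y)) \<partial>M)"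
    if m[measurable]: "u \<in> borel_measurable M" "v \<in> borel_measurable M" and nonneg: "\<And>x. 0 \<le> u x" "\<And>x. 0 \<le> v x" for u v :: "'a \<Rightarrow> real"
  proof -
    note [measurable] = degree_measurable
    have s1[measurable]: "(\<lambda>x. \<Sum>y\<in>G `` {x}. u y) \<in> borel_measurable M"
      using neighbour_sum_measurable[of "\<lambda>p. u (snd p)"] by simp
    have am: "avg G u \<in> borel_measurable M" unfolding avg_def[abs_def] by measurable
    have s2: "(\<lambda>x. \<Sum>y\<in>G `` {x}. ennreal (v x * u y)) \<in> borel_measurable M"
    proof -
      have "(\<Sum>y\<in>G `` {x}. ennreal (v x * u y)) = ennreal (v x * (\<Sum>y\<in>G `` {x}. u y))" for x
        using nonneg by (simp add: sum_ennreal sum_distrib_left)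
      then show ?thesis by simp
    qed
    have "(\<integral>\<^sup>+x. ennreal (v x * avg G u x) \<partial>N) =
        (\<integral>\<^sup>+x. ennreal (real (degree G x) / mean_degree) * ennreal (v x * avg G u x) \<partial>M)"
      unfolding N_def using am by (intro nn_integral_density density_measurable) measurable
    also have "\<dots> = (\<integral>\<^sup>+x. ennreal (1 / mean_degree) * (\<Sum>y\<in>G `` {x}. ennreal (v x * u y)) \<partial>M)"
    proof (rule nn_integral_cong)
      fix x
      have a0: "0 \<le> avg G u x" by (rule avg_nonneg) (rule nonneg)
      have da: "real (degree G x) * avg G u x = (\<Sum>y\<in>G `` {x}. u y)"
        using finite_neighbours[of x] by (cases "degree G x = 0") (auto simp: avg_def degree_def)
      have "ennreal (real (degree G x) / mean_degree) * ennreal (v x * avg G u x)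
          = ennreal (1 / mean_degree * (v x * (real (degree G x) * avg G u x)))"
        using mean_degree_pos nonneg a0 by (subst ennreal_mult[symmetric]) (auto simp: mult_ac)
      also have "\<dots> = ennreal (1 / mean_degree) * (\<Sum>y\<in>G `` {x}. ennreal (v x * u y))"
        unfolding da using mean_degree_pos nonneg
        by (subst ennreal_mult) (auto simp: sum_ennreal sum_distrib_left sum_nonneg)
      finally show "ennreal (real (degree G x) / mean_degree) * ennreal (v x * avg G u x) =
          ennreal (1 / mean_degree) * (\<Sum>y\<in>G `` {x}. ennreal (v x * u y))" .
    qed
    also have "\<dots> = ennreal (1 / mean_degree) * (\<integral>\<^sup>+x. (\<Sum>y\<in>G `` {x}. ennreal (v x * u y)) \<partial>M)"
      by (rule nn_integral_cmult[OF s2])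
    finally show ?thesis .
  qed
  show "(\<integral>\<^sup>+x. ennreal (v x * avg G u x) \<partial>N) = (\<integral>\<^sup>+x. ennreal (u x * avg G v x) \<partial>N)"
    unfolding int[OF m nonneg] int[OF m(2,1) nonneg(2,1)] mass_transport_product[OF m nonneg] ..
qed

sublocale degree_biased: reversible_prob_graph N G
  unfolding reversible_prob_graph_def by (intro conjI reversible_graph_N prob_space_N)

lemma fine_partition_N:
  assumes "\<epsilon> > 0"
  shows "\<exists>A :: nat \<Rightarrow> 'a set. range A \<subseteq> sets N \<and> disjoint_family A \<and> (\<Union>i. A i) = space N \<and> (\<forall>i. measure N (A i) \<le> \<epsilon>)"
proof (rule fine_partition[OF standard_borel_space sets_N _ _ assms])
  show "finite_measure N" by unfold_locales
  fix x assume x: "x \<in> space N"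
  then have "emeasure M {x} = 0" using atomless by (simp add: space_N emeasure_eq_measure)
  then have "{x} \<in> null_sets M" using singleton_sets x by (auto simp: space_N)
  then have "AE y in M. y \<notin> {x}" by (rule AE_not_in)
  then have "AE y in N. y \<notin> {x}" unfolding AE_N_iff .
  then have "{x} \<in> null_sets N" using singleton_sets x by (subst AE_iff_null_sets) (auto simp: space_N sets_N)
  then show "measure N {x} = 0" by (auto simp: measure_def)
qed

text \<open>
  Take the centred indicator of a set whose measure is positive and at most 1/2.
\<close>

lemma L2_0_nontrivial: "\<exists>f\<in>L2_0 N. L2_norm N f \<noteq> 0"
proof -
  obtain A :: "nat \<Rightarrow> 'a set" where A: "range A \<subseteq> sets N" "disjoint_family A" "(\<Union>i. A i) = space N" "\<And>i. measure N (A i) \<le> 1/2"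
    using fine_partition_N[of "1/2"] by auto
  have "\<exists>i. measure N (A i) \<noteq> 0"
  proof (rule ccontr)
    assume "\<not> ?thesis"
    then have "(\<Sum>i. emeasure N (A i)) = 0" by (simp add: degree_biased.emeasure_eq_measure)
    then have "emeasure N (space N) = 0" using suminf_emeasure[OF A(1,2)] A(3) by simp
    then show False using degree_biased.emeasure_space_1 by simp
  qed
  then obtain i where i: "measure N (A i) \<noteq> 0" by blast
  define B where "B = A i"
  define a where "a = measure N B"
  have B: "B \<in> sets N" using A(1) unfolding B_def by auto
  have a: "0 < a" "a \<le> 1/2" using i A(4)[of i] unfolding a_def B_def by (auto simp: zero_less_measure_iff)
  let ?f = "\<lambda>x. complex_of_real (indicator B x - a)"
  have "(L2_norm N ?f)\<^sup>2 = (\<integral>x. (indicator B x - a)\<^sup>2 \<partial>N)"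
    unfolding L2_norm_square norm_of_real power2_abs ..
  also have "\<dots> = a * (1 - a)"
    unfolding a_def by (rule degree_biased.centered_indicator(3)[OF B])
  finally have "L2_norm N ?f \<noteq> 0" using a by auto
  then show ?thesis using degree_biased.centered_indicator(4)[OF B] unfolding a_def by blast
qed

text \<open>
  The Markov operator on \<open>L\<^sup>2\<^sub>0\<close> has a norm bound \<open>c\<close> that is attained by a spectral value. The spectrum
  is bounded, as the operator is a contraction, so \<open>c\<close> is at most the supremum that defines the spectral
  radius.
\<close>

lemma global_norm_bound:
  obtains c where "0 \<le> c" "c \<le> global_spectral_radius M G"
    "\<And>f. f \<in> L2_0 N \<Longrightarrow> L2_norm N (markov G f) \<le> c * L2_norm N f"
proof -
  interpret op: L2_operator N "L2_0 N" "markov G" by (rule degree_biased.L2_operator_markov_L2_0)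
  have L: "f \<in> L2 N" if "f \<in> L2_0 N" for f using that by (simp add: L2_0_def)
  have bd: "L2_norm N (markov G f) \<le> 1 * L2_norm N f" if "f \<in> L2_0 N" for f
    using degree_biased.markov_L2(2)[OF L[OF that]] by simp
  obtain f where f: "f \<in> L2_0 N" "L2_norm N f \<noteq> 0" using L2_0_nontrivial by blast
  obtain z where z: "z \<in> op_spectrum N (L2_0 N) (markov G)"
      "\<forall>f\<in>L2_0 N. L2_norm N (markov G f) \<le> cmod z * L2_norm N f"
    using op.selfadjoint_norm_attained[OF bd degree_biased.markov_selfadjoint[OF L] f] by blast
  have "cmod w \<le> 1" if "w \<in> op_spectrum N (L2_0 N) (markov G)" for w
  proof (rule ccontr)
    assume "\<not> cmod w \<le> 1"
    then have "w \<notin> op_spectrum N (L2_0 N) (markov G)" by (intro op.not_in_spectrum[OF _ _ bd]) auto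
    then show False using that by simp
  qed
  then have "bdd_above (cmod ` op_spectrum N (L2_0 N) (markov G))" by (intro bdd_aboveI[of _ 1]) auto
  then have "cmod z \<le> global_spectral_radius M G"
    unfolding global_spectral_radius_def op_spectral_radius_def using z(1) by (intro cSUP_upper)
  then show ?thesis using that[of "cmod z"] z(2) by simp
qed

lemma rooted_network_component:
  assumes inf: "infinite (G\<^sup>* `` {x})"
  defines "V \<equiv> G\<^sup>* `` {x}"
  shows "rooted_network V (G \<inter> V \<times> V) x"
    and "\<And>u. u \<in> V \<Longrightarrow> (G \<inter> V \<times> V) `` {u} = G `` {u}"
proof -
  show nb: "(G \<inter> V \<times> V) `` {u} = G `` {u}" if "u \<in> V" for u
    using that unfolding V_def by (auto intro: rtrancl_into_rtrancl)
  have conn: "(x, u) \<in> (G \<inter> V \<times> V)\<^sup>*" if "(x, u) \<in> G\<^sup>*" for u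
    using that
  proof (induction rule: rtrancl_induct)
    case (step u w)
    have "(u, w) \<in> G \<inter> V \<times> V" using step unfolding V_def by (auto intro: rtrancl_into_rtrancl)
    then show ?case using step by (auto intro: rtrancl_into_rtrancl)
  qed simp
  show "rooted_network V (G \<inter> V \<times> V) x"
  proof
    show "sym (G \<inter> V \<times> V)" using symmetric by (auto simp: sym_def)
    show "V = (G \<inter> V \<times> V)\<^sup>* `` {x}"
      using conn rtrancl_mono[of "G \<inter> V \<times> V" G] unfolding V_def by blast
    show "finite ((G \<inter> V \<times> V) `` {u})" if "u \<in> V" for u
      unfolding nb[OF that] by (rule finite_neighbours)
    show "0 < degree (G \<inter> V \<times> V) u" if "u \<in> V" for u
    proof -
      have "(x, u) \<in> G\<^sup>*" using that unfolding V_def by simp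
      from degree_pos_component[OF inf this] show ?thesis unfolding degree_def nb[OF that] .
    qed
  qed auto
qed

lemma avg_cong:
  "E `` {u} = E' `` {u} \<Longrightarrow> (\<And>w. w \<in> E' `` {u} \<Longrightarrow> h w = h' w) \<Longrightarrow> avg E h u = avg E' h' u"
  by (simp add: avg_def degree_def)

lemma iter_avg_component:
  assumes "\<And>u. u \<in> V \<Longrightarrow> (G \<inter> V \<times> V) `` {u} = G `` {u}" "u \<in> V"
  shows "(avg (G \<inter> V \<times> V) ^^ n) f u = (avg G ^^ n) f u"
  using assms(2)
proof (induction n arbitrary: u)
  case (Suc n)
  have "w \<in> V" if "w \<in> G `` {u}" for w using assms(1)[OF Suc.prems] that by auto
  then have "avg (G \<inter> V \<times> V) ((avg (G \<inter> V \<times> V) ^^ n) f) u = avg G ((avg G ^^ n) f) u"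
    by (intro avg_cong assms(1) Suc)
  then show ?case by simp
qed simp

lemma local_le_global:
  "AE x in M. local_spectral_radius (rooted_component G x) \<le> global_spectral_radius M G"
proof -
  obtain c where c: "0 \<le> c" "c \<le> global_spectral_radius M G"
    "\<And>f. f \<in> L2_0 N \<Longrightarrow> L2_norm N (markov G f) \<le> c * L2_norm N f"
    using global_norm_bound by blast
  have "AE x in N. \<exists>K. \<forall>n. (avg G ^^ (2 * n)) (indicator {x}) x \<le> K * (c + 1 / real (Suc m)) ^ (2 * n)" for m
    by (rule degree_biased.return_probability_bound[OF c(1) c(3) fine_partition_N]) auto
  then have "AE x in M. \<forall>m. \<exists>K. \<forall>n. (avg G ^^ (2 * n)) (indicator {x}) x \<le> K * (c + 1 / real (Suc m)) ^ (2 * n)"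
    unfolding AE_N_iff by (simp only: AE_all_countable) simp
  with AE_infinite_component show ?thesis
  proof eventually_elim
    case (elim x)
    define V where "V = G\<^sup>* `` {x}"
    interpret net: rooted_network V "G \<inter> V \<times> V" x
      using rooted_network_component(1)[OF elim(1)] unfolding V_def .
    have nb: "\<And>u. u \<in> V \<Longrightarrow> (G \<inter> V \<times> V) `` {u} = G `` {u}"
      using rooted_network_component(2)[OF elim(1)] unfolding V_def .
    let ?\<sigma> = "op_spectrum (degree_measure V (G \<inter> V \<times> V)) (L2 (degree_measure V (G \<inter> V \<times> V))) (markov (G \<inter> V \<times> V))"
    have "cmod z \<le> c" if z: "z \<in> ?\<sigma>" for z
    proof (rule field_le_epsilon)
      fix e :: real assume "e > 0"
      then obtain m where m: "1 / real (Suc m) < e" using nat_approx_posE by blast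
      obtain K where "\<And>n. (avg G ^^ (2 * n)) (indicator {x}) x \<le> K * (c + 1 / real (Suc m)) ^ (2 * n)"
        using elim(2) by blast
      then have "cmod z \<le> c + 1 / real (Suc m)"
        using c(1) z by (intro net.spectrum_bound[of K]) (auto simp: iter_avg_component[OF nb net.root_in] intro!: add_nonneg_pos)
      then show "cmod z \<le> c + e" using m by linarith
    qed
    then have "(SUP z\<in>?\<sigma>. cmod z) \<le> c"
      using net.spectrum_nonempty by (intro cSUP_least)
    then have "local_spectral_radius (rooted_component G x) \<le> c"
      unfolding local_spectral_radius_def rooted_component_def op_spectral_radius_def degree_measure_def V_def
      by (simp add: Let_def)
    then show ?case using c(2) by linarith
  qed
qed

end

theorem theorem1p2:
  fixes M :: "'a measure" and G :: "('a \<times> 'a) set"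
  assumes "graphing M G"
    and "aperiodic M G"
  shows "AE x in M. local_spectral_radius (rooted_component G x) \<le> global_spectral_radius M G"
proof -
  interpret aperiodic_graphing M G
    using assms by (simp add: aperiodic_graphing_def aperiodic_graphing_axioms_def)
  show ?thesis by (rule local_le_global)
qed

end
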